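(* Suppose $(Q^{\mathbb C},\varphi)$ is a non-cyclic Toda pair with $\varphi_k=0$ for $k\notin J$, where $J\subset I$ is proper and non-empty. Then the geometric Toda equations $$\Delta_\Sigma w_j=\sum_{k\in I_+}\|\varphi_k\|^2\tfrac{|\alpha_k|^2}{2}e^{w_k}\hat C_{jk}-\sum_{k\in I_-}\|\varphi_k\|^2\tfrac{|\alpha_k|^2}{2}e^{w_k}\hat C_{jk}-d_j,\quad j\in I,$$ for functions $w_j:\Sigma\to\mathbb R$ with $\sum_{j=0}^rm_jw_j=0$, reduce to a union of simple non-affine Toda systems for $\{w_j:j\in J\}$, while for $l\notin J$, $w_l$ and $d_l$ are determined by a linear combination of $\{w_j:j\in J\}$ and $\{d_j:j\in J\}$ respectively.
   Context: Affine root data. Let $\mathfrak g^{\mathbb C}$ be a complex simple Lie algebra with Killing form $\langle\ ,\ \rangle$. Let $\nu$ be a symmetry of its Dynkin diagram, of order $n\in\{1,2,3\}$ (the identity is allowed); $\nu$ also denotes the order $n$ automorphism of $\mathfrak g^{\mathbb C}$ permuting canonical (Chevalley) generators according to this symmetry, with $e^{2\pi ij/n}$-eigenspaces $\mathfrak g^\nu_j$. The subalgebra $\mathfrak g^\nu_0$ is simple; let $\mathfrak t^{\mathbb C}$ be a Cartan subalgebra of $\mathfrak g_0^\nu$ and $r=\dim\mathfrak t^{\mathbb C}$. For $(\alpha,j)\in(\mathfrak t^{\mathbb C})^*\times\mathbb Z_n$ put $\mathfrak g^{(\alpha,j)}=\{\xi\in\mathfrak g^\nu_j:[h,\xi]=\alpha(h)\xi\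 \forall h\in\mathfrak t^{\mathbb C}\}$ and let $\bar R$ be the set of pairs for which this is non-zero. Let $\alpha_1,\dots,\alpha_r$ be simple roots of $\mathfrak g^\nu_0$, $\bar\alpha_j=(\alpha_j,0)$ for $j\ge1$, and let $\bar\alpha_0\in\bar R$, equal to $(\alpha_0,0)$ if $n=1$ and $(\alpha_0,1)$ if $n\neq1$, be characterised by $\bar\alpha_0-\bar\alpha_j\notin\bar R$ for $j\ne0$. There are positive integers $m_0=1,m_1,\dots,m_r$ with $\sum_{j=0}^rm_j\alpha_j=0$. With $h_\alpha\in\mathfrak t^{\mathbb C}$ given by $\alpha=\langle h_\alpha,\cdot\rangle$, set $\langle\alpha,\beta\rangle=\langle h_\alpha,h_\beta\rangle$ and $|\alpha|^2=\langle\alpha,\alpha\rangle$. The affine Cartan matrix is $\hat C_{jk}=2\langle\alpha_j,\alpha_k\rangle/\langle\alpha_k,\alpha_k\rangle$, $j,k\in I=\{0,\dots,r\}$. Fix a labelling $\ell:I\to\{-1,1\}$ with $-1\in\ell(I)$ and $\prod_{j\in I}\ell(j)^{nm_j}=1$, and set $I_\pm=\{j\in I:\ell(j)=\pm1\}$. Toda pairs. $\Sigma$ is a compact Riemann surface of genus $g$ with a Kähler metric of constant curvature $2-2g$ and Kähler form $\omega_\Sigma$, $\int_\Sigma\omega_\Sigma=2\pi$; $K_\Sigma$ is its canonical bundle; $\Delta_\Sigma=d^*d$ is the non-negative Laplacian on functions. A Toda pair $(Q^{\mathbb C},\varphi)$ is a holomorphic principal $T^{\mathbb C}$-bundle over $\Sigma$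 ($T^{\mathbb C}$ the complex torus with Lie algebra $\mathfrak t^{\mathbb C}$ in the adjoint group of $\mathfrak g^{\mathbb C}$) together with a holomorphic section $\varphi=\sum_{j\in I}\varphi_j$ of $Q^{\mathbb C}(\bigoplus_{j\in I}\mathfrak g^{\bar\alpha_j})\otimes K_\Sigma$, where $Q^{\mathbb C}(V)$ denotes the associated bundle with fibre $V$. Equivalently it consists of holomorphic line bundles $Q_k(\mathbb C)=Q^{\mathbb C}(\mathfrak g^{\bar\alpha_k})$, $k\in I$, with $\bigotimes_{k\in I}Q_k(\mathbb C)^{m_k}$ trivial, of degrees $d_k$, and holomorphic sections $\varphi_k\in H^0(Q_k(\mathbb C)\otimes K_\Sigma)$. Each $Q_k(\mathbb C)$ carries the Hermitian metric (unique up to constant scaling) whose Chern connection has curvature $-id_k\omega_\Sigma$; $\|\varphi_k\|$ is the resulting pointwise norm (using the Kähler metric on $K_\Sigma$). The pair, and the system of geometric Toda equations above, is called cyclic if $\varphi_k$ is not identically zero for all $k\in I$, and non-cyclic otherwise; it is called simple non-affine when $\varphi_k=0$ only for $k=0$. In the simple non-affine case the equations for $w_1,\dots,w_r$ form a closed system in which the affine Cartan matrix is replaced by an ordinary (finite type) Cartan matrix. The simple non-affine systems in the claim are those of this form for the connected components of the subdiagram of the affine Dynkin diagram obtained by removing the vertices labelled by $I\setminus J$, whose (possibly decomposable) Cartan matrix is the submatrix $(\hat C_{jk})_{j,k\in J}$.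
   Formalization: For l not in J, w_l is a linear combination of the w_j (j in J) plus a real constant b_l, with the sum of m_l b_l over l not in J equal to 0; without these constants the claim fails when I\J has at least two elements. *)

theory Defs
  imports "HOL-Analysis.Analysis" "HOL-Combinatorics.Permutations"
begin

section \<open>Complex Lie algebras\<close>

class complex_lie_algebra = ab_group_add +
  fixes scaleC :: "complex \<Rightarrow> 'a \<Rightarrow> 'a" (infixr "*\<^sub>C" 75)
    and lie :: "'a \<Rightarrow> 'a \<Rightarrow> 'a"
  assumes scaleC_add_right: "a *\<^sub>C (x + y) = a *\<^sub>C x + a *\<^sub>C y"
    and scaleC_add_left: "(a + b) *\<^sub>C x = a *\<^sub>C x + b *\<^sub>C x"
    and scaleC_scaleC: "a *\<^sub>C b *\<^sub>C x = (a * b) *\<^sub>C x"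
    and scaleC_one: "1 *\<^sub>C x = x"
    and finite_dim: "\<exists>B. finite B \<and> (\<forall>x. \<exists>u. x = (\<Sum>b\<in>B. u b *\<^sub>C b))"
    and lie_add_left: "lie (x + y) z = lie x z + lie y z"
    and lie_scale_left: "lie (a *\<^sub>C x) y = a *\<^sub>C lie x y"
    and lie_self: "lie x x = 0"
    and lie_add_right: "lie x (y + z) = lie x y + lie x z"
    and lie_scale_right: "lie x (a *\<^sub>C y) = a *\<^sub>C lie x y"
    and jacobi: "lie x (lie y z) + lie y (lie z x) + lie z (lie x y) = 0"

global_interpretation cvec: vector_space "scaleC :: complex \<Rightarrow> 'a \<Rightarrow> 'a::complex_lie_algebra"
  by unfold_locales (simp_all add: scaleC_add_right scaleC_add_left scaleC_scaleC scaleC_one)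

definition functional :: "('g::complex_lie_algebra \<Rightarrow> complex) \<Rightarrow> bool" where
  "functional f \<longleftrightarrow> Vector_Spaces.linear scaleC (*) f"

definition ideal :: "'g::complex_lie_algebra set \<Rightarrow> bool" where
  "ideal S \<longleftrightarrow> cvec.subspace S \<and> (\<forall>x. \<forall>y\<in>S. lie x y \<in> S)"

definition simple_lie_algebra :: "'g::complex_lie_algebra itself \<Rightarrow> bool" where
  "simple_lie_algebra _ \<longleftrightarrow>
     (\<exists>x y :: 'g. lie x y \<noteq> 0) \<and> (\<forall>S :: 'g set. ideal S \<longrightarrow> S = {0} \<or> S = UNIV)"

definition trace_op :: "('g::complex_lie_algebra \<Rightarrow> 'g) \<Rightarrow> complex" where
  "trace_op f = (let B = (SOME B. cvec.independent B \<and> cvec.span B = UNIV)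
                 in \<Sum>b\<in>B. cvec.representation B (f b) b)"

definition killing :: "'g::complex_lie_algebra \<Rightarrow> 'g \<Rightarrow> complex" where
  "killing x y = trace_op (\<lambda>z. lie x (lie y z))"

definition lie_automorphism :: "('g::complex_lie_algebra \<Rightarrow> 'g) \<Rightarrow> bool" where
  "lie_automorphism f \<longleftrightarrow> Vector_Spaces.linear scaleC scaleC f \<and> bij f \<and>
     (\<forall>x y. f (lie x y) = lie (f x) (f y))"

text \<open>Cartan subalgebras of a semisimple Lie subalgebra \<open>L\<close>: abelian, equal to their own
  centraliser in \<open>L\<close>, and acting diagonalisably on \<open>L\<close>.\<close>

definition cartan_subalgebra :: "'g::complex_lie_algebra set \<Rightarrow> 'g set \<Rightarrow> bool" where
  "cartan_subalgebra L t \<longleftrightarrow> cvec.subspace t \<and> t \<subseteq> L \<and>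
     (\<forall>h\<in>t. \<forall>h'\<in>t. lie h h' = 0) \<and>
     (\<forall>x\<in>L. (\<forall>h\<in>t. lie h x = 0) \<longrightarrow> x \<in> t) \<and>
     (\<forall>h\<in>t. L \<subseteq> cvec.span {x \<in> L. \<exists>a. lie h x = a *\<^sub>C x})"

text \<open>The dual of a subspace \<open>t\<close>; functionals on \<open>t\<close> are made total by the value 0 outside \<open>t\<close>.\<close>

definition dual :: "'g::complex_lie_algebra set \<Rightarrow> ('g \<Rightarrow> complex) set" where
  "dual t = {\<alpha>. (\<forall>x\<in>t. \<forall>y\<in>t. \<alpha> (x + y) = \<alpha> x + \<alpha> y) \<and>
                (\<forall>a. \<forall>x\<in>t. \<alpha> (a *\<^sub>C x) = a * \<alpha> x) \<and> (\<forall>x. x \<notin> t \<longrightarrow> \<alpha> x = 0)}"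

definition weight_space ::
    "'g::complex_lie_algebra set \<Rightarrow> 'g set \<Rightarrow> ('g \<Rightarrow> complex) \<Rightarrow> 'g set" where
  "weight_space L t \<alpha> = {x \<in> L. \<forall>h\<in>t. lie h x = \<alpha> h *\<^sub>C x}"

definition roots :: "'g::complex_lie_algebra set \<Rightarrow> 'g set \<Rightarrow> ('g \<Rightarrow> complex) set" where
  "roots L t = {\<alpha> \<in> dual t. \<alpha> \<noteq> (\<lambda>h. 0) \<and> weight_space L t \<alpha> \<noteq> {0}}"

definition simple_roots ::
    "'g::complex_lie_algebra set \<Rightarrow> 'g set \<Rightarrow> nat set \<Rightarrow> (nat \<Rightarrow> 'g \<Rightarrow> complex) \<Rightarrow> bool" where
  "simple_roots L t S \<beta> \<longleftrightarrow> finite S \<and> card S = cvec.dim t \<and> \<beta> ` S \<subseteq> roots L t \<and>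
     (\<forall>c. (\<forall>h\<in>t. (\<Sum>i\<in>S. c i * \<beta> i h) = 0) \<longrightarrow> (\<forall>i\<in>S. c i = 0)) \<and>
     (\<forall>\<gamma>\<in>roots L t. \<exists>k :: nat \<Rightarrow> nat.
        (\<forall>h\<in>t. \<gamma> h = (\<Sum>i\<in>S. of_nat (k i) * \<beta> i h)) \<or>
        (\<forall>h\<in>t. \<gamma> h = - (\<Sum>i\<in>S. of_nat (k i) * \<beta> i h)))"

definition has_order :: "('b \<Rightarrow> 'b) \<Rightarrow> nat \<Rightarrow> bool" where
  "has_order f n \<longleftrightarrow> n > 0 \<and> f ^^ n = id \<and> (\<forall>k. 0 < k \<and> k < n \<longrightarrow> f ^^ k \<noteq> id)"

text \<open>\<open>e i\<close> and \<open>f i\<close> are canonical (Chevalley) generators for the simple roots \<open>\<beta> i\<close>, the coroots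
  being \<open>lie (e i) (f i)\<close>. The permutation \<open>\<sigma>\<close> is a symmetry of the Dynkin diagram, i.e. of the
  Cartan matrix, and \<open>\<nu>\<close> is the automorphism it induces.\<close>

definition diagram_automorphism :: "('g::complex_lie_algebra \<Rightarrow> 'g) \<Rightarrow> nat \<Rightarrow> bool" where
  "diagram_automorphism \<nu> n \<longleftrightarrow> n \<in> {1,2,3} \<and> lie_automorphism \<nu> \<and> has_order \<nu> n \<and>
     (\<exists>hh N \<beta> e f \<sigma>. cartan_subalgebra UNIV hh \<and> simple_roots UNIV hh {..<N} \<beta> \<and>
        (\<forall>i<N. e i \<in> weight_space UNIV hh (\<beta> i) \<and> f i \<in> weight_space UNIV hh (\<lambda>h. - \<beta> i h) \<and>
               \<beta> i (lie (e i) (f i)) = 2) \<and>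
        \<sigma> permutes {..<N} \<and> has_order \<sigma> n \<and>
        (\<forall>i<N. \<forall>j<N. \<beta> (\<sigma> j) (lie (e (\<sigma> i)) (f (\<sigma> i))) = \<beta> j (lie (e i) (f i))) \<and>
        (\<forall>i<N. \<nu> (e i) = e (\<sigma> i) \<and> \<nu> (f i) = f (\<sigma> i)))"

section \<open>Affine root data\<close>

text \<open>Classes modulo \<open>n\<close> are represented by integers; \<open>eigenspace \<nu> n j\<close> depends only on
  \<open>j mod n\<close>, so \<open>Rbar\<close> is invariant under shifting the second component by \<open>n\<close>.\<close>

definition eigenspace :: "('g::complex_lie_algebra \<Rightarrow> 'g) \<Rightarrow> nat \<Rightarrow> int \<Rightarrow> 'g set" where
  "eigenspace \<nu> n j = {x. \<nu> x = exp (2 * of_real pi * \<i> * of_int j / of_nat n) *\<^sub>C x}"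

definition gspace ::
    "('g::complex_lie_algebra \<Rightarrow> 'g) \<Rightarrow> nat \<Rightarrow> 'g set \<Rightarrow> ('g \<Rightarrow> complex) \<times> int \<Rightarrow> 'g set" where
  "gspace \<nu> n t a = weight_space (eigenspace \<nu> n (snd a)) t (fst a)"

definition Rbar ::
    "('g::complex_lie_algebra \<Rightarrow> 'g) \<Rightarrow> nat \<Rightarrow> 'g set \<Rightarrow> (('g \<Rightarrow> complex) \<times> int) set" where
  "Rbar \<nu> n t = {a. fst a \<in> dual t \<and> gspace \<nu> n t a \<noteq> {0}}"

definition abar :: "nat \<Rightarrow> (nat \<Rightarrow> 'g \<Rightarrow> complex) \<Rightarrow> nat \<Rightarrow> ('g \<Rightarrow> complex) \<times> int" where
  "abar n \<alpha> j = (\<alpha> j, if j = 0 \<and> n \<noteq> 1 then 1 else 0)"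

definition affine_simple_roots ::
    "('g::complex_lie_algebra \<Rightarrow> 'g) \<Rightarrow> nat \<Rightarrow> 'g set \<Rightarrow> nat \<Rightarrow> (nat \<Rightarrow> 'g \<Rightarrow> complex) \<Rightarrow> bool" where
  "affine_simple_roots \<nu> n t r \<alpha> \<longleftrightarrow> r = cvec.dim t \<and>
     simple_roots (eigenspace \<nu> n 0) t {1..r} \<alpha> \<and>
     abar n \<alpha> 0 \<in> Rbar \<nu> n t \<and>
     (\<forall>j\<in>{1..r}. (\<lambda>h. \<alpha> 0 h - \<alpha> j h, snd (abar n \<alpha> 0) - snd (abar n \<alpha> j)) \<notin> Rbar \<nu> n t)"

definition affine_marks :: "'g set \<Rightarrow> nat \<Rightarrow> (nat \<Rightarrow> 'g \<Rightarrow> complex) \<Rightarrow> (nat \<Rightarrow> nat) \<Rightarrow> bool" where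
  "affine_marks t r \<alpha> m \<longleftrightarrow> m 0 = 1 \<and> (\<forall>j\<in>{0..r}. m j > 0) \<and>
     (\<forall>h\<in>t. (\<Sum>j\<in>{0..r}. of_nat (m j) * \<alpha> j h) = 0)"

definition hvec :: "'g::complex_lie_algebra set \<Rightarrow> ('g \<Rightarrow> complex) \<Rightarrow> 'g" where
  "hvec t \<alpha> = (THE h. h \<in> t \<and> (\<forall>x\<in>t. \<alpha> x = killing h x))"

text \<open>The pairing is real (even rational) on the real span of the roots, so taking real parts only
  changes the type.\<close>

definition root_inner ::
    "'g::complex_lie_algebra set \<Rightarrow> ('g \<Rightarrow> complex) \<Rightarrow> ('g \<Rightarrow> complex) \<Rightarrow> real" where
  "root_inner t \<alpha> \<beta> = Re (killing (hvec t \<alpha>) (hvec t \<beta>))"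

definition affine_cartan ::
    "'g::complex_lie_algebra set \<Rightarrow> (nat \<Rightarrow> 'g \<Rightarrow> complex) \<Rightarrow> nat \<Rightarrow> nat \<Rightarrow> real" where
  "affine_cartan t \<alpha> j k = 2 * root_inner t (\<alpha> j) (\<alpha> k) / root_inner t (\<alpha> k) (\<alpha> k)"

definition toda_labelling :: "nat \<Rightarrow> nat \<Rightarrow> (nat \<Rightarrow> nat) \<Rightarrow> (nat \<Rightarrow> int) \<Rightarrow> bool" where
  "toda_labelling n r m lab \<longleftrightarrow> lab ` {0..r} \<subseteq> {-1, 1} \<and> -1 \<in> lab ` {0..r} \<and>
     (\<Prod>j\<in>{0..r}. lab j ^ (n * m j)) = 1"

text \<open>Cartan matrices of finite type: generalised Cartan matrices with a positive definite
  symmetrisation. They may be decomposable; the simple ones have a connected diagram.\<close>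

definition finite_cartan_matrix :: "(nat \<Rightarrow> nat \<Rightarrow> real) \<Rightarrow> nat set \<Rightarrow> bool" where
  "finite_cartan_matrix C S \<longleftrightarrow> finite S \<and>
     (\<forall>i\<in>S. C i i = 2) \<and>
     (\<forall>i\<in>S. \<forall>j\<in>S. i \<noteq> j \<longrightarrow> C i j \<in> \<int> \<and> C i j \<le> 0) \<and>
     (\<forall>i\<in>S. \<forall>j\<in>S. C i j = 0 \<longleftrightarrow> C j i = 0) \<and>
     (\<exists>D. (\<forall>i\<in>S. D i > 0) \<and> (\<forall>i\<in>S. \<forall>j\<in>S. D i * C i j = D j * C j i) \<and>
        (\<forall>x. (\<exists>i\<in>S. x i \<noteq> 0) \<longrightarrow> (\<Sum>i\<in>S. \<Sum>j\<in>S. x i * (D i * C i j) * x j) > 0))"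

text \<open>Vertex sets of the connected components of the subdiagram on \<open>J\<close>.\<close>

definition diagram_components :: "(nat \<Rightarrow> nat \<Rightarrow> real) \<Rightarrow> nat set \<Rightarrow> nat set set" where
  "diagram_components C J =
     (\<lambda>j. {k. (j, k) \<in> {(x, y). x \<in> J \<and> y \<in> J \<and> x \<noteq> y \<and> C x y \<noteq> 0}\<^sup>*}) ` J"

definition simple_cartan_matrix :: "(nat \<Rightarrow> nat \<Rightarrow> real) \<Rightarrow> nat set \<Rightarrow> bool" where
  "simple_cartan_matrix C S \<longleftrightarrow>
     finite_cartan_matrix C S \<and> S \<noteq> {} \<and> diagram_components C S = {S}"

section \<open>Compact Riemann surfaces\<close>

text \<open>The surface is a whole type \<open>'s\<close>; a chart is a pair of a domain and a coordinate.\<close>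

type_synonym 's chart = "'s set \<times> ('s \<Rightarrow> complex)"

abbreviation cinv :: "'s chart \<Rightarrow> complex \<Rightarrow> 's" where
  "cinv c \<equiv> inv_into (fst c) (snd c)"

definition compact_riemann_surface :: "'s::t2_space chart set \<Rightarrow> bool" where
  "compact_riemann_surface A \<longleftrightarrow> compact (UNIV :: 's set) \<and> connected (UNIV :: 's set) \<and>
     (\<Union>c\<in>A. fst c) = UNIV \<and>
     (\<forall>c\<in>A. open (fst c) \<and> open (snd c ` fst c) \<and>
        homeomorphism (fst c) (snd c ` fst c) (snd c) (cinv c)) \<and>
     (\<forall>c\<in>A. \<forall>c'\<in>A. (snd c' \<circ> cinv c) holomorphic_on snd c ` (fst c \<inter> fst c'))"

definition surface_holomorphic :: "'s chart set \<Rightarrow> 's set \<Rightarrow> ('s \<Rightarrow> complex) \<Rightarrow> bool" where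
  "surface_holomorphic A W f \<longleftrightarrow> (\<forall>c\<in>A. (f \<circ> cinv c) holomorphic_on snd c ` (fst c \<inter> W))"

text \<open>\<open>dcoord c c' p\<close> is \<open>dz' / dz\<close> at \<open>p\<close>, for the coordinates \<open>z\<close>, \<open>z'\<close> of \<open>c\<close>, \<open>c'\<close>.\<close>

definition dcoord :: "'s chart \<Rightarrow> 's chart \<Rightarrow> 's \<Rightarrow> complex" where
  "dcoord c c' p = deriv (snd c' \<circ> cinv c) (snd c p)"

text \<open>A holomorphic 1-form is given by its coefficient \<open>\<theta> c\<close> in \<open>\<theta> = \<theta> c dz\<close> for each chart; the genus
  is the dimension of the space of such forms.\<close>

definition holomorphic_form :: "'s chart set \<Rightarrow> ('s chart \<Rightarrow> 's \<Rightarrow> complex) \<Rightarrow> bool" where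
  "holomorphic_form A \<theta> \<longleftrightarrow> (\<forall>c\<in>A. (\<theta> c \<circ> cinv c) holomorphic_on snd c ` fst c) \<and>
     (\<forall>c\<in>A. \<forall>c'\<in>A. \<forall>p\<in>fst c \<inter> fst c'. \<theta> c p = dcoord c c' p * \<theta> c' p)"

definition has_genus :: "'s chart set \<Rightarrow> nat \<Rightarrow> bool" where
  "has_genus A g \<longleftrightarrow> (\<exists>\<theta>. (\<forall>i<g. holomorphic_form A (\<theta> i)) \<and>
     (\<forall>\<eta>. holomorphic_form A \<eta> \<longrightarrow>
        (\<exists>!a. (\<forall>i\<ge>g. a i = 0) \<and> (\<forall>c\<in>A. \<forall>p\<in>fst c. \<eta> c p = (\<Sum>i<g. a i * \<theta> i c p)))))"

definition pderiv_dir :: "complex \<Rightarrow> (complex \<Rightarrow> real) \<Rightarrow> complex \<Rightarrow> real" where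
  "pderiv_dir v f q = frechet_derivative f (at q) v"

primrec ck_on :: "nat \<Rightarrow> complex set \<Rightarrow> (complex \<Rightarrow> real) \<Rightarrow> bool" where
  "ck_on 0 U f \<longleftrightarrow> continuous_on U f"
| "ck_on (Suc k) U f \<longleftrightarrow> (\<forall>q\<in>U. f differentiable (at q)) \<and>
     ck_on k U (pderiv_dir 1 f) \<and> ck_on k U (pderiv_dir \<i> f)"

definition surface_ck :: "'s chart set \<Rightarrow> nat \<Rightarrow> 's set \<Rightarrow> ('s \<Rightarrow> real) \<Rightarrow> bool" where
  "surface_ck A k W f \<longleftrightarrow> (\<forall>c\<in>A. ck_on k (snd c ` (fst c \<inter> W)) (f \<circ> cinv c))"

definition flat_laplacian :: "'s chart \<Rightarrow> ('s \<Rightarrow> real) \<Rightarrow> 's \<Rightarrow> real" where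
  "flat_laplacian c f p = pderiv_dir 1 (pderiv_dir 1 (f \<circ> cinv c)) (snd c p)
     + pderiv_dir \<i> (pderiv_dir \<i> (f \<circ> cinv c)) (snd c p)"

text \<open>A Kaehler metric is \<open>\<rho> c (dx\<^sup>2 + dy\<^sup>2)\<close> in the chart \<open>c\<close>, with Kaehler form
  \<open>\<rho> c dx \<and> dy\<close>.\<close>

definition kaehler_metric :: "'s chart set \<Rightarrow> ('s chart \<Rightarrow> 's \<Rightarrow> real) \<Rightarrow> bool" where
  "kaehler_metric A \<rho> \<longleftrightarrow>
     (\<forall>c\<in>A. (\<forall>p\<in>fst c. \<rho> c p > 0) \<and> (\<forall>k. ck_on k (snd c ` fst c) (\<rho> c \<circ> cinv c))) \<and>
     (\<forall>c\<in>A. \<forall>c'\<in>A. \<forall>p\<in>fst c \<inter> fst c'. \<rho> c p = (cmod (dcoord c c' p))\<^sup>2 * \<rho> c' p)"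

text \<open>Integration of the Kaehler form: the Borel measure with density \<open>\<rho> c\<close> in each chart.\<close>

definition area_measure ::
    "'s::t2_space chart set \<Rightarrow> ('s chart \<Rightarrow> 's \<Rightarrow> real) \<Rightarrow> 's measure" where
  "area_measure A \<rho> = (THE M. sets M = sets borel \<and>
     (\<forall>c\<in>A. \<forall>B\<in>sets borel. B \<subseteq> fst c \<longrightarrow>
        emeasure M B = (\<integral>\<^sup>+ q. ennreal (\<rho> c (cinv c q)) * indicator (snd c ` B) q \<partial>lborel)))"

definition gauss_curvature :: "('s chart \<Rightarrow> 's \<Rightarrow> real) \<Rightarrow> 's chart \<Rightarrow> 's \<Rightarrow> real" where
  "gauss_curvature \<rho> c p = - flat_laplacian c (\<lambda>x. ln (\<rho> c x)) p / (2 * \<rho> c p)"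

definition normalised_metric ::
    "'s::t2_space chart set \<Rightarrow> nat \<Rightarrow> ('s chart \<Rightarrow> 's \<Rightarrow> real) \<Rightarrow> bool" where
  "normalised_metric A g \<rho> \<longleftrightarrow> kaehler_metric A \<rho> \<and>
     (\<forall>c\<in>A. \<forall>p\<in>fst c. gauss_curvature \<rho> c p = 2 - 2 * real g) \<and>
     emeasure (area_measure A \<rho>) UNIV = ennreal (2 * pi)"

definition chart_at :: "'s chart set \<Rightarrow> 's \<Rightarrow> 's chart" where
  "chart_at A p = (SOME c. c \<in> A \<and> p \<in> fst c)"

text \<open>The non-negative Laplacian \<open>d\<^sup>*d\<close>; on \<open>C\<^sup>2\<close> functions the value does not depend on the
  chart.\<close>

definition laplacian ::
    "'s chart set \<Rightarrow> ('s chart \<Rightarrow> 's \<Rightarrow> real) \<Rightarrow> ('s \<Rightarrow> real) \<Rightarrow> 's \<Rightarrow> real" where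
  "laplacian A \<rho> f p = (let c = chart_at A p in - flat_laplacian c f p / \<rho> c p)"

section \<open>Toda pairs\<close>

definition exp_of :: "('g::complex_lie_algebra \<Rightarrow> 'g) \<Rightarrow> ('g \<Rightarrow> 'g) \<Rightarrow> bool" where
  "exp_of f T \<longleftrightarrow> (\<forall>lam x. functional lam \<longrightarrow> (\<lambda>k. lam ((f ^^ k) x) / fact k) sums lam (T x))"

text \<open>The torus \<open>exp (ad t)\<close> in the adjoint group.\<close>

definition adjoint_torus :: "'g::complex_lie_algebra set \<Rightarrow> ('g \<Rightarrow> 'g) set" where
  "adjoint_torus t = {T. \<exists>h\<in>t. exp_of (lie h) T}"

text \<open>A holomorphic principal bundle with this structure group is given by a trivialising open cover
  \<open>W\<close>, indexed by a type, and a holomorphic cocycle \<open>\<tau>\<close>: in an associated bundle, coordinates \<open>v\<^sub>a\<close>, \<open>v\<^sub>b\<close> of a point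
  over \<open>p\<close> are related by \<open>v\<^sub>a = \<tau> a b p v\<^sub>b\<close>.\<close>

definition principal_bundle ::
    "'s::t2_space chart set \<Rightarrow> 'g::complex_lie_algebra set \<Rightarrow>
     ('i \<Rightarrow> 's set) \<Rightarrow> ('i \<Rightarrow> 'i \<Rightarrow> 's \<Rightarrow> 'g \<Rightarrow> 'g) \<Rightarrow> bool" where
  "principal_bundle A t W \<tau> \<longleftrightarrow> (\<forall>a. open (W a)) \<and> (\<Union>a. W a) = UNIV \<and>
     (\<forall>a b. \<forall>p\<in>W a \<inter> W b. \<tau> a b p \<in> adjoint_torus t) \<and>
     (\<forall>a. \<forall>p\<in>W a. \<tau> a a p = id) \<and>
     (\<forall>a b c. \<forall>p\<in>W a \<inter> W b \<inter> W c. \<tau> a b p \<circ> \<tau> b c p = \<tau> a c p) \<and>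
     (\<forall>a b lam x. functional lam \<longrightarrow> surface_holomorphic A (W a \<inter> W b) (\<lambda>p. lam (\<tau> a b p x)))"

text \<open>A section of the tensor product of the associated bundle with fibre \<open>V\<close> and the canonical
  bundle is \<open>s a c dz\<close> in the trivialisation \<open>a\<close> and the chart \<open>c\<close> with coordinate \<open>z\<close>.\<close>

definition twisted_section ::
    "'s chart set \<Rightarrow> ('i \<Rightarrow> 's set) \<Rightarrow> ('i \<Rightarrow> 'i \<Rightarrow> 's \<Rightarrow> 'g::complex_lie_algebra \<Rightarrow> 'g) \<Rightarrow>
     'g set \<Rightarrow> ('i \<Rightarrow> 's chart \<Rightarrow> 's \<Rightarrow> 'g) \<Rightarrow> bool" where
  "twisted_section A W \<tau> V s \<longleftrightarrow>
     (\<forall>a. \<forall>c\<in>A. \<forall>p\<in>W a \<inter> fst c. s a c p \<in> V) \<and>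
     (\<forall>a. \<forall>c\<in>A. \<forall>lam. functional lam \<longrightarrow>
        (lam \<circ> s a c \<circ> cinv c) holomorphic_on snd c ` (fst c \<inter> W a)) \<and>
     (\<forall>a b. \<forall>c\<in>A. \<forall>c'\<in>A. \<forall>p\<in>W a \<inter> W b \<inter> fst c \<inter> fst c'.
        s a c p = dcoord c c' p *\<^sub>C \<tau> a b p (s b c' p))"

definition section_zero ::
    "'s chart set \<Rightarrow> ('i \<Rightarrow> 's set) \<Rightarrow> ('i \<Rightarrow> 's chart \<Rightarrow> 's \<Rightarrow> 'g::zero) \<Rightarrow> bool" where
  "section_zero A W s \<longleftrightarrow> (\<forall>a. \<forall>c\<in>A. \<forall>p\<in>W a \<inter> fst c. s a c p = 0)"

text \<open>The torus preserves each summand of the fibre, so a section of the direct sum is the same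
  as the family of its components \<open>\<phi> k\<close>.\<close>

definition toda_pair ::
    "'s::t2_space chart set \<Rightarrow> ('g::complex_lie_algebra \<Rightarrow> 'g) \<Rightarrow> nat \<Rightarrow> 'g set \<Rightarrow> nat \<Rightarrow>
     (nat \<Rightarrow> 'g \<Rightarrow> complex) \<Rightarrow> ('i \<Rightarrow> 's set) \<Rightarrow> ('i \<Rightarrow> 'i \<Rightarrow> 's \<Rightarrow> 'g \<Rightarrow> 'g) \<Rightarrow>
     (nat \<Rightarrow> 'i \<Rightarrow> 's chart \<Rightarrow> 's \<Rightarrow> 'g) \<Rightarrow> bool" where
  "toda_pair A \<nu> n t r \<alpha> W \<tau> \<phi> \<longleftrightarrow> principal_bundle A t W \<tau> \<and>
     (\<forall>k\<in>{0..r}. twisted_section A W \<tau> (gspace \<nu> n t (abar n \<alpha> k)) (\<phi> k))"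

definition noncyclic ::
    "'s chart set \<Rightarrow> nat \<Rightarrow> ('i \<Rightarrow> 's set) \<Rightarrow> (nat \<Rightarrow> 'i \<Rightarrow> 's chart \<Rightarrow> 's \<Rightarrow> 'g::zero) \<Rightarrow> bool" where
  "noncyclic A r W \<phi> \<longleftrightarrow> \<not> (\<forall>k\<in>{0..r}. \<not> section_zero A W (\<phi> k))"

text \<open>A smooth Hermitian metric on the associated line bundle with one-dimensional fibre \<open>V\<close>:
  \<open>H a p v\<close> is the squared norm at \<open>p\<close> of the vector with coordinate \<open>v\<close> in the trivialisation \<open>a\<close>.\<close>

definition hermitian_metric ::
    "'s chart set \<Rightarrow> ('i \<Rightarrow> 's set) \<Rightarrow> ('i \<Rightarrow> 'i \<Rightarrow> 's \<Rightarrow> 'g::complex_lie_algebra \<Rightarrow> 'g) \<Rightarrow>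
     'g set \<Rightarrow> ('i \<Rightarrow> 's \<Rightarrow> 'g \<Rightarrow> real) \<Rightarrow> bool" where
  "hermitian_metric A W \<tau> V H \<longleftrightarrow>
     (\<forall>a. \<forall>p\<in>W a. \<forall>v\<in>V. (v \<noteq> 0 \<longrightarrow> H a p v > 0) \<and>
        (\<forall>z. H a p (z *\<^sub>C v) = (cmod z)\<^sup>2 * H a p v)) \<and>
     (\<forall>a b. \<forall>p\<in>W a \<inter> W b. \<forall>v\<in>V. H a p (\<tau> a b p v) = H b p v) \<and>
     (\<forall>a k. \<forall>v\<in>V. surface_ck A k (W a) (\<lambda>p. H a p v))"

text \<open>A non-zero constant \<open>v\<close> is a holomorphic frame over \<open>W a\<close>, so the curvature of the Chern
  connection is \<open>F = - \<partial> \<partial>bar (log (H a p v))\<close>, which equals \<open>- \<i> f \<omega>\<close> with \<open>f\<close> half the Laplacian of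
  \<open>log (H a p v)\<close>. The next function is this \<open>f\<close>.\<close>

definition chern_density ::
    "'s chart set \<Rightarrow> ('s chart \<Rightarrow> 's \<Rightarrow> real) \<Rightarrow> ('i \<Rightarrow> 's \<Rightarrow> 'g \<Rightarrow> real) \<Rightarrow> 'i \<Rightarrow> 'g \<Rightarrow> 's \<Rightarrow> real" where
  "chern_density A \<rho> H a v p = laplacian A \<rho> (\<lambda>x. ln (H a x v)) p / 2"

text \<open>The degree by Chern-Weil theory: \<open>deg = \<i> / (2 pi) \<integral> F = 1 / (2 pi) \<integral> f \<omega>\<close> for every Hermitian
  metric.\<close>

definition bundle_degree ::
    "'s::t2_space chart set \<Rightarrow> ('s chart \<Rightarrow> 's \<Rightarrow> real) \<Rightarrow> ('i \<Rightarrow> 's set) \<Rightarrow>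
     ('i \<Rightarrow> 'i \<Rightarrow> 's \<Rightarrow> 'g::complex_lie_algebra \<Rightarrow> 'g) \<Rightarrow> 'g set \<Rightarrow> int" where
  "bundle_degree A \<rho> W \<tau> V = (THE d. \<forall>H. hermitian_metric A W \<tau> V H \<longrightarrow>
     has_bochner_integral (area_measure A \<rho>)
       (\<lambda>p. chern_density A \<rho> H (SOME a. p \<in> W a) (SOME v. v \<in> V \<and> v \<noteq> 0) p)
       (2 * pi * of_int d))"

definition constant_curvature_metric ::
    "'s chart set \<Rightarrow> ('s chart \<Rightarrow> 's \<Rightarrow> real) \<Rightarrow> ('i \<Rightarrow> 's set) \<Rightarrow>
     ('i \<Rightarrow> 'i \<Rightarrow> 's \<Rightarrow> 'g::complex_lie_algebra \<Rightarrow> 'g) \<Rightarrow> 'g set \<Rightarrow> int \<Rightarrow>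
     ('i \<Rightarrow> 's \<Rightarrow> 'g \<Rightarrow> real) \<Rightarrow> bool" where
  "constant_curvature_metric A \<rho> W \<tau> V d H \<longleftrightarrow> hermitian_metric A W \<tau> V H \<and>
     (\<forall>a. \<forall>p\<in>W a. \<forall>v\<in>V. v \<noteq> 0 \<longrightarrow> chern_density A \<rho> H a v p = of_int d)"

text \<open>Squared pointwise norm of a section twisted by the canonical bundle. The Hermitian
  extension of the metric to complex covectors gives \<open>dz\<close> the squared norm \<open>2 / \<rho> c\<close>.\<close>

definition section_norm2 ::
    "'s chart set \<Rightarrow> ('s chart \<Rightarrow> 's \<Rightarrow> real) \<Rightarrow> ('i \<Rightarrow> 's set) \<Rightarrow> ('i \<Rightarrow> 's \<Rightarrow> 'g \<Rightarrow> real) \<Rightarrow>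
     ('i \<Rightarrow> 's chart \<Rightarrow> 's \<Rightarrow> 'g) \<Rightarrow> 's \<Rightarrow> real" where
  "section_norm2 A \<rho> W H s p =
     (let c = chart_at A p; a = (SOME a. p \<in> W a) in H a p (s a c p) * (2 / \<rho> c p))"

definition toda_coefficient ::
    "'s chart set \<Rightarrow> ('s chart \<Rightarrow> 's \<Rightarrow> real) \<Rightarrow> 'g::complex_lie_algebra set \<Rightarrow>
     (nat \<Rightarrow> 'g \<Rightarrow> complex) \<Rightarrow> ('i \<Rightarrow> 's set) \<Rightarrow> (nat \<Rightarrow> 'i \<Rightarrow> 's \<Rightarrow> 'g \<Rightarrow> real) \<Rightarrow>
     (nat \<Rightarrow> 'i \<Rightarrow> 's chart \<Rightarrow> 's \<Rightarrow> 'g) \<Rightarrow> nat \<Rightarrow> 's \<Rightarrow> real" where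
  "toda_coefficient A \<rho> t \<alpha> W H \<phi> k p =
     section_norm2 A \<rho> W (H k) (\<phi> k) p * (root_inner t (\<alpha> k) (\<alpha> k) / 2)"

text \<open>The Toda equations with Cartan matrix \<open>(C j k)\<close> for \<open>j\<close>, \<open>k\<close> in \<open>S\<close>. They involve only the
  functions \<open>w j\<close> and the data \<open>q j\<close>, \<open>d j\<close> with \<open>j \<in> S\<close>: the geometric (affine) system is
  \<open>S = {0..r}\<close>, and the system is a simple non-affine one when the submatrix of \<open>C\<close> on \<open>S\<close> satisfies
  \<open>simple_cartan_matrix\<close>.\<close>

definition toda_equations ::
    "'s chart set \<Rightarrow> ('s chart \<Rightarrow> 's \<Rightarrow> real) \<Rightarrow> (nat \<Rightarrow> int) \<Rightarrow> (nat \<Rightarrow> nat \<Rightarrow> real) \<Rightarrow>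
     (nat \<Rightarrow> 's \<Rightarrow> real) \<Rightarrow> (nat \<Rightarrow> int) \<Rightarrow> nat set \<Rightarrow> (nat \<Rightarrow> 's \<Rightarrow> real) \<Rightarrow> bool" where
  "toda_equations A \<rho> lab C q d S w \<longleftrightarrow> (\<forall>j\<in>S. \<forall>p. laplacian A \<rho> (w j) p =
     (\<Sum>k\<in>{k\<in>S. lab k = 1}. q k p * exp (w k p) * C j k)
     - (\<Sum>k\<in>{k\<in>S. lab k = -1}. q k p * exp (w k p) * C j k) - of_int (d j))"

end

theory Submission
  imports Defs "HOL-Complex_Analysis.Complex_Analysis"
    "HOL-Computational_Algebra.Fundamental_Theorem_Algebra"
begin

text \<open>For \<open>k \<notin> J\<close> the coefficient \<open>q k\<close> vanishes, so the right-hand sides of the Toda equations only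
  involve the columns \<open>k \<in> J\<close> of the affine Cartan matrix. The roots \<open>\<alpha> j\<close>, \<open>j \<in> J\<close>, are linearly
  independent because the only relation between all of them has no vanishing coefficient; hence the
  submatrix on \<open>J\<close> is of finite type, and the rows \<open>l \<notin> J\<close> are combinations, with coefficients
  \<open>\<kappa> l j\<close>, of the rows in \<open>J\<close>. Then \<open>w l - (\<Sum>j\<in>J. \<kappa> l j * w j)\<close> has constant Laplacian, so by the
  maximum principle that constant is zero and the function itself is constant.

  That the pairing of roots is real and positive definite and that the Cartan integers are integers
  is derived from the theory of \<open>sl\<^sub>2\<close>-strings. Nondegeneracy of the Killing form \<open>K\<close> follows from
  \<open>K(h, h) > 0\<close> for a Chevalley coroot \<open>h\<close>, all of whose eigenvalues are integers. The subalgebra \<open>t\<close>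
  acts diagonalisably on the whole algebra, not only on the fixed algebra of the automorphism, since
  the semisimple part of \<open>lie h\<close> is an inner derivation.\<close>

section \<open>Linear maps and brackets\<close>

text \<open>The obstacle is that the data give less than a root system. The fixed algebra is not
  assumed to be simple, and \<open>t\<close> is only known to act diagonalisably on that algebra,
  while the root vector for \<open>\<alpha> 0\<close> lies outside it when
  \<open>n \<noteq> 1\<close>. The Jordan decomposition and inner derivations enter to bridge this
  gap. Strings are run with \<open>hvec t \<alpha>\<close> instead of a coroot: normalising to a
  coroot divides by the norm of \<alpha>, and that this norm is nonzero is itself drawn from the
  string argument.

  The coefficients \<kappa> solve Gram equations. A column of \<open>C\<close> is a rescaled column
  of the Gram matrix, so the same \<kappa> expresses the rows of \<open>C\<close>. The marks
  annihilate the Gram matrix, which forces the sum of \<open>m l * \<kappa> l j\<close> over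
  \<open>l \<notin> J\<close> to be \<open>- m j\<close>. Hence the constraint on all
  \<open>w j\<close> becomes a constraint on the additive constants \<open>b l\<close> alone. Those
  constants cannot be dropped from the conclusion: the equations see only Laplacians, so they fix
  \<open>w l\<close> up to a constant. With the constants included, the reduction is an equivalence
  and solutions can be reassembled from the components.\<close>

abbreviation clinear :: "('g::complex_lie_algebra \<Rightarrow> 'g) \<Rightarrow> bool" where
  "clinear f \<equiv> Vector_Spaces.linear scaleC scaleC f"

lemma clinear_iff:
  "clinear f \<longleftrightarrow> (\<forall>x y. f (x + y) = f x + f y) \<and> (\<forall>a x. f (a *\<^sub>C x) = a *\<^sub>C f x)"
  by (simp add: Vector_Spaces.linear_iff cvec.vector_space_axioms)

lemma clinear_add: "clinear f \<Longrightarrow> f (x + y) = f x + f y"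
  and clinear_scale: "clinear f \<Longrightarrow> f (a *\<^sub>C x) = a *\<^sub>C f x"
  by (simp_all add: clinear_iff)

lemma clinear_0: "clinear f \<Longrightarrow> f 0 = 0"
  using clinear_scale[of f 0 0] by simp

lemma clinear_neg: "clinear f \<Longrightarrow> f (- x) = - f x"
  using clinear_scale[of f "-1" x] by simp

lemma clinear_diff: "clinear f \<Longrightarrow> f (x - y) = f x - f y"
  using clinear_add[of f x "- y"] by (simp add: clinear_neg)

lemma clinear_sum: "clinear f \<Longrightarrow> f (\<Sum>i\<in>I. g i) = (\<Sum>i\<in>I. f (g i))"
  by (induction I rule: infinite_finite_induct) (auto simp: clinear_0 clinear_add)

lemmas clinear_rules = clinear_add clinear_scale clinear_0 clinear_neg clinear_diff clinear_sum

lemma clinear_comp: "clinear f \<Longrightarrow> clinear g \<Longrightarrow> clinear (\<lambda>x. f (g x))"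
  by (simp add: clinear_iff)

lemma clinear_plus: "clinear f \<Longrightarrow> clinear g \<Longrightarrow> clinear (\<lambda>x. f x + g x)"
  and clinear_minus: "clinear f \<Longrightarrow> clinear g \<Longrightarrow> clinear (\<lambda>x. f x - g x)"
  by (simp_all add: clinear_iff scaleC_add_right cvec.scale_right_diff_distrib)

lemma clinear_cmult: "clinear f \<Longrightarrow> clinear (\<lambda>x. a *\<^sub>C f x)"
  by (simp add: clinear_iff scaleC_add_right mult.commute)

lemma clinear_funpow: "clinear f \<Longrightarrow> clinear (f ^^ k)"
  by (induction k) (auto simp: clinear_iff)

lemma clinear_eq_on_span:
  assumes "clinear f" "clinear g" "\<And>x. x \<in> S \<Longrightarrow> f x = g x" "x \<in> cvec.span S"
  shows "f x = g x"
  using assms(4) by (induction rule: cvec.span_induct_alt) (auto simp: assms clinear_rules)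

lemma clinear_lie: "clinear (lie x)"
  by (simp add: clinear_iff lie_add_right lie_scale_right)

lemma clinear_lie_left: "clinear (\<lambda>x. lie x y)"
  by (simp add: clinear_iff lie_add_left lie_scale_left)

lemma lie_0 [simp]: "lie x 0 = 0" "lie 0 x = 0"
  using clinear_0[OF clinear_lie] clinear_0[OF clinear_lie_left] by auto

lemma lie_anti: "lie y x = - lie x y"
proof -
  have "lie (x + y) (x + y) = lie x y + lie y x"
    unfolding lie_add_left lie_add_right by (simp add: lie_self)
  then show ?thesis by (simp add: lie_self eq_neg_iff_add_eq_0 add.commute)
qed

lemma lie_lie: "lie (lie x y) z = lie x (lie y z) - lie y (lie x z)"
proof -
  have "lie (lie x y) z = - lie z (lie x y)" by (rule lie_anti)
  also have "\<dots> = lie x (lie y z) + lie y (lie z x)"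
    by (rule minus_unique) (use jacobi[of x y z] in \<open>simp add: add.commute\<close>)
  also have "lie y (lie z x) = - lie y (lie x z)"
    by (simp add: lie_anti[of z x] clinear_neg[OF clinear_lie])
  finally show ?thesis by simp
qed

lemma lie_deriv: "lie x (lie y z) = lie (lie x y) z + lie y (lie x z)"
  by (simp add: lie_lie)

section \<open>Finite bases\<close>

lemma independent_finite:
  assumes "cvec.independent (B :: 'g::complex_lie_algebra set)"
  shows "finite B"
proof -
  obtain T :: "'g set" where "finite T" "\<forall>x. \<exists>u. x = (\<Sum>b\<in>T. u b *\<^sub>C b)"
    using finite_dim by blast
  moreover have "x \<in> cvec.span T" for x
  proof -
    obtain u where "x = (\<Sum>b\<in>T. u b *\<^sub>C b)"
      using calculation by blast
    then show ?thesis
      by (simp add: cvec.span_sum cvec.span_scale cvec.span_base)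
  qed
  ultimately show ?thesis
    using cvec.independent_span_bound[OF _ assms, of T] by auto
qed

lemma basis_within:
  assumes "(UNIV :: 'g::complex_lie_algebra set) \<subseteq> cvec.span E"
  obtains B where "B \<subseteq> E" "cvec.independent B" "cvec.span B = UNIV" "finite B"
proof -
  obtain B where B: "B \<subseteq> E" "cvec.independent B" "E \<subseteq> cvec.span B"
    using cvec.maximal_independent_subset by blast
  then have "cvec.span E \<subseteq> cvec.span B"
    by (simp add: cvec.span_minimal)
  then have "cvec.span B = UNIV" using assms by auto
  then show ?thesis using that[OF B(1,2)] independent_finite[OF B(2)] by blast
qed

section \<open>Traces\<close>

lemma clinear_representation:
  assumes "cvec.independent B" "cvec.span B = UNIV"
  shows "cvec.representation B (x + y) b = cvec.representation B x b + cvec.representation B y b"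
    and "cvec.representation B (x - y) b = cvec.representation B x b - cvec.representation B y b"
    and "cvec.representation B (a *\<^sub>C x) b = a * cvec.representation B x b"
    and "cvec.representation B (\<Sum>i\<in>I. f i) b = (\<Sum>i\<in>I. cvec.representation B (f i) b)"
  using assms by (simp_all add: cvec.representation_add cvec.representation_diff
      cvec.representation_scale cvec.representation_sum)

lemma representation_expand:
  assumes "cvec.independent B" "cvec.span B = UNIV"
  shows "(\<Sum>b\<in>B. cvec.representation B x b *\<^sub>C b) = x"
  using assms by (intro cvec.sum_representation_eq) (auto intro: independent_finite)

text \<open>Both sides are one double sum over \<open>B\<close> and \<open>C\<close>, read in the
  two orders. \<open>trace_op\<close> picks its basis by choice, so this is what allows traces to be
  computed in an adapted basis.\<close>

lemma trace_basis_indep: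
  assumes f: "clinear f" and B: "cvec.independent B" "cvec.span B = UNIV"
    and C: "cvec.independent C" "cvec.span C = UNIV"
  shows "(\<Sum>b\<in>B. cvec.representation B (f b) b) = (\<Sum>c\<in>C. cvec.representation C (f c) c)"
proof -
  have "(\<Sum>b\<in>B. cvec.representation B (f b) b) =
      (\<Sum>b\<in>B. \<Sum>c\<in>C. cvec.representation C (f b) c * cvec.representation B c b)"
  proof (rule sum.cong)
    fix b assume "b \<in> B"
    have "cvec.representation B (\<Sum>c\<in>C. cvec.representation C (f b) c *\<^sub>C c) b =
      (\<Sum>c\<in>C. cvec.representation C (f b) c * cvec.representation B c b)"
      by (simp add: clinear_representation[OF B])
    then show "cvec.representation B (f b) b =
      (\<Sum>c\<in>C. cvec.representation C (f b) c * cvec.representation B c b)"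
      by (simp add: representation_expand[OF C])
  qed simp
  also have "\<dots> = (\<Sum>c\<in>C. \<Sum>b\<in>B. cvec.representation B c b * cvec.representation C (f b) c)"
    by (subst sum.swap) (simp add: mult.commute)
  also have "\<dots> = (\<Sum>c\<in>C. cvec.representation C (f c) c)"
  proof (rule sum.cong)
    fix c assume "c \<in> C"
    have "f c = f (\<Sum>b\<in>B. cvec.representation B c b *\<^sub>C b)"
      by (simp add: representation_expand[OF B])
    also have "\<dots> = (\<Sum>b\<in>B. cvec.representation B c b *\<^sub>C f b)"
      by (simp add: clinear_rules[OF f])
    finally show "(\<Sum>b\<in>B. cvec.representation B c b * cvec.representation C (f b) c)
       = cvec.representation C (f c) c"
      by (simp add: clinear_representation[OF C])
  qed simp
  finally show ?thesis .
qed

lemma trace_op_eq: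
  assumes "clinear f" "cvec.independent B" "cvec.span B = UNIV"
  shows "trace_op f = (\<Sum>b\<in>B. cvec.representation B (f b) b)"
proof -
  define B' where "B' = (SOME B :: 'a set. cvec.independent B \<and> cvec.span B = UNIV)"
  have "cvec.independent B' \<and> cvec.span B' = UNIV"
    unfolding B'_def by (rule someI[where x = B]) (use assms in auto)
  then show ?thesis
    unfolding trace_op_def Let_def B'_def[symmetric]
    by (intro trace_basis_indep) (use assms in auto)
qed

lemma basis_obtain:
  obtains B :: "'g::complex_lie_algebra set"
  where "cvec.independent B" "cvec.span B = UNIV" "finite B"
  using basis_within[of UNIV] by auto

lemma trace_op_add:
  assumes "clinear f" "clinear g"
  shows "trace_op (\<lambda>x. f x + g x) = trace_op f + trace_op g"
proof -
  obtain B :: "'a set" where B: "cvec.independent B" "cvec.span B = UNIV" "finite B"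
    by (rule basis_obtain)
  show ?thesis
    by (simp add: trace_op_eq[OF _ B(1,2)] assms clinear_plus clinear_representation[OF B(1,2)]
        sum.distrib)
qed

lemma trace_op_cmult:
  assumes "clinear f"
  shows "trace_op (\<lambda>x. a *\<^sub>C f x) = a * trace_op f"
proof -
  obtain B :: "'a set" where B: "cvec.independent B" "cvec.span B = UNIV" "finite B"
    by (rule basis_obtain)
  show ?thesis
    by (simp add: trace_op_eq[OF _ B(1,2)] assms clinear_cmult clinear_representation[OF B(1,2)]
        sum_distrib_left)
qed

lemma trace_op_diff:
  assumes "clinear f" "clinear g"
  shows "trace_op (\<lambda>x. f x - g x) = trace_op f - trace_op g"
  using trace_op_add[OF assms(1) clinear_cmult[OF assms(2), of "-1"]]
    trace_op_cmult[OF assms(2), of "-1"] by simp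

lemma trace_op_comm:
  assumes f: "clinear f" and g: "clinear g"
  shows "trace_op (\<lambda>x. f (g x)) = trace_op (\<lambda>x. g (f x))"
proof -
  obtain B :: "'a set" where B: "cvec.independent B" "cvec.span B = UNIV" "finite B"
    by (rule basis_obtain)
  have *: "cvec.representation B (f (g b)) b =
      (\<Sum>c\<in>B. cvec.representation B (g b) c * cvec.representation B (f c) b)"
    if "clinear f" for f g :: "'a \<Rightarrow> 'a" and b
  proof -
    have "f (g b) = f (\<Sum>c\<in>B. cvec.representation B (g b) c *\<^sub>C c)"
      by (simp add: representation_expand[OF B(1,2)])
    also have "\<dots> = (\<Sum>c\<in>B. cvec.representation B (g b) c *\<^sub>C f c)"
      by (simp add: clinear_rules[OF that])
    finally show ?thesis by (simp add: clinear_representation[OF B(1,2)])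
  qed
  have "trace_op (\<lambda>x. f (g x)) =
      (\<Sum>b\<in>B. \<Sum>c\<in>B. cvec.representation B (g b) c * cvec.representation B (f c) b)"
    by (simp add: trace_op_eq[OF _ B(1,2)] clinear_comp f g *)
  also have "\<dots> = (\<Sum>c\<in>B. \<Sum>b\<in>B. cvec.representation B (f c) b * cvec.representation B (g b) c)"
    by (subst sum.swap) (simp add: mult.commute)
  also have "\<dots> = trace_op (\<lambda>x. g (f x))"
    by (simp add: trace_op_eq[OF _ B(1,2)] clinear_comp f g *)
  finally show ?thesis .
qed

lemma trace_op_eigenbasis:
  assumes f: "clinear f" and B: "cvec.independent B" "cvec.span B = UNIV"
    and "\<And>b. b \<in> B \<Longrightarrow> f b = a b *\<^sub>C b"
  shows "trace_op f = sum a B"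
  unfolding trace_op_eq[OF f B]
  by (rule sum.cong)
     (simp_all add: assms(4) clinear_representation[OF B] cvec.representation_basis[OF B(1)])

lemma subspace_range:
  assumes "clinear f"
  shows "cvec.subspace (range f)"
  unfolding cvec.subspace_def
proof safe
  show "0 \<in> range f" using clinear_0[OF assms] by (metis rangeI)
  show "f x + f y \<in> range f" for x y using clinear_add[OF assms] by (metis rangeI)
  show "c *\<^sub>C f x \<in> range f" for c x using clinear_scale[OF assms] by (metis rangeI)
qed

text \<open>The ranges of the powers of \<open>f\<close> descend to 0. A basis grown from the
  smallest range to the whole space is one in which \<open>f\<close> sends each new vector into the
  span of the older ones, so the diagonal is zero.\<close>

lemma trace_op_nilpotent:
  assumes f: "clinear f" and nil: "\<And>x. (f ^^ k) x = 0"
  shows "trace_op f = 0"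
proof -
  have "\<exists>B. cvec.independent B \<and> cvec.span B = range (f ^^ j) \<and>
      (\<forall>b\<in>B. cvec.representation B (f b) b = 0)" if "j \<le> k" for j
    using that
  proof (induction rule: inc_induct)
    case base
    have "range (f ^^ k) = {0}" using nil by auto
    then show ?case by (intro exI[of _ "{}"]) (simp add: cvec.independent_empty)
  next
    case (step j)
    then obtain B where B: "cvec.independent B" "cvec.span B = range (f ^^ Suc j)"
      "\<forall>b\<in>B. cvec.representation B (f b) b = 0" by blast
    have sub: "range (f ^^ Suc j) \<subseteq> range (f ^^ j)"
      by (auto simp: funpow_swap1)
    have "B \<subseteq> range (f ^^ j)"
      using sub B(2) cvec.span_superset by blast
    then obtain C where C: "B \<subseteq> C" "C \<subseteq> range (f ^^ j)" "cvec.independent C"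
      "range (f ^^ j) \<subseteq> cvec.span C"
      by (rule cvec.maximal_independent_subset_extend[OF _ B(1)])
    have span: "cvec.span C = range (f ^^ j)"
      using cvec.span_minimal[OF C(2) subspace_range[OF clinear_funpow[OF f]]] C(4) by blast
    have "cvec.representation C (f c) c = 0" if "c \<in> C" for c
    proof -
      obtain x where "c = (f ^^ j) x" using \<open>c \<in> C\<close> C by auto
      then have fc: "f c \<in> cvec.span B" using B(2) by auto
      \<comment> \<open>Since \<open>f c\<close> lies in the span of \<open>B\<close>, its
        coordinates in \<open>C\<close> vanish off \<open>B\<close>; on \<open>B\<close> the earlier
        basis already gave 0.\<close>
      have eq: "cvec.representation C (f c) = cvec.representation B (f c)"
        by (rule cvec.representation_extend[OF C(3) fc C(1)])
      show ?thesis
      proof (cases "c \<in> B")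
        case False
        then show ?thesis unfolding eq by (meson cvec.representation_ne_zero)
      qed (simp add: eq B)
    qed
    then show ?case
      by (intro exI[of _ C] conjI ballI C(3) span)
  qed
  from this[of 0] obtain B where B: "cvec.independent B" "cvec.span B = UNIV"
      "\<forall>b\<in>B. cvec.representation B (f b) b = 0" by auto
  show ?thesis
    unfolding trace_op_eq[OF f B(1,2)] using B(3) by simp
qed

section \<open>Generalised eigenspaces\<close>

text \<open>The exponent is left unbounded, so that membership passes from
  \<open>T x - a *\<^sub>C x\<close> to \<open>x\<close> without any dimension count.\<close>

definition gen_eigenspace :: "('g::complex_lie_algebra \<Rightarrow> 'g) \<Rightarrow> complex \<Rightarrow> 'g set" where
  "gen_eigenspace T a = {x. \<exists>k. ((\<lambda>y. T y - a *\<^sub>C y) ^^ k) x = 0}"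

lemma clinear_shift: "clinear T \<Longrightarrow> clinear (\<lambda>y. T y - a *\<^sub>C y)"
  by (intro clinear_minus clinear_cmult) (auto simp: clinear_iff)

lemma gen_eigenspace_step:
  "T x - a *\<^sub>C x \<in> gen_eigenspace T a \<Longrightarrow> x \<in> gen_eigenspace T a"
  unfolding gen_eigenspace_def
proof clarify
  fix k assume "((\<lambda>y. T y - a *\<^sub>C y) ^^ k) (T x - a *\<^sub>C x) = 0"
  then have "((\<lambda>y. T y - a *\<^sub>C y) ^^ Suc k) x = 0"
    by (simp add: funpow_Suc_right del: funpow.simps)
  then show "\<exists>k. ((\<lambda>y. T y - a *\<^sub>C y) ^^ k) x = 0" ..
qed

lemma eigenvector_in_gen_eigenspace: "T x = a *\<^sub>C x \<Longrightarrow> x \<in> gen_eigenspace T a"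
  unfolding gen_eigenspace_def by (intro CollectI exI[of _ 1]) simp

text \<open>Induction on an exponent that kills \<open>x\<close>, packaged so that later proofs
  never mention powers of the shifted operator.\<close>

lemma gen_eigenspace_induct [consumes 1, case_names zero step]:
  assumes "x \<in> gen_eigenspace T a" "P 0"
    and step: "\<And>x. x \<in> gen_eigenspace T a \<Longrightarrow> T x - a *\<^sub>C x \<in> gen_eigenspace T a \<Longrightarrow>
      P (T x - a *\<^sub>C x) \<Longrightarrow> P x"
  shows "P x"
proof -
  obtain k where "((\<lambda>y. T y - a *\<^sub>C y) ^^ k) x = 0"
    using assms(1) by (auto simp: gen_eigenspace_def)
  then show ?thesis
  proof (induction k arbitrary: x)
    case 0
    then show ?case using assms(2) by simp
  next
    case (Suc k)
    then have *: "((\<lambda>y. T y - a *\<^sub>C y) ^^ k) (T x - a *\<^sub>C x) = 0"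
      by (simp add: funpow_Suc_right del: funpow.simps)
    then have **: "T x - a *\<^sub>C x \<in> gen_eigenspace T a"
      by (auto simp: gen_eigenspace_def)
    show ?case
      by (rule step[OF gen_eigenspace_step[OF **] ** Suc.IH[OF *]])
  qed
qed

lemma subspace_gen_eigenspace:
  assumes T: "clinear T"
  shows "cvec.subspace (gen_eigenspace T a)"
proof -
  let ?D = "\<lambda>y. T y - a *\<^sub>C y"
  have D: "clinear (?D ^^ k)" for k
    by (intro clinear_funpow clinear_shift T)
  have mono: "(?D ^^ (j + k)) x = 0" if "(?D ^^ k) x = 0" for j k x
    by (simp only: funpow_add comp_apply that clinear_0[OF D])
  have "x + y \<in> gen_eigenspace T a" if xy: "x \<in> gen_eigenspace T a" "y \<in> gen_eigenspace T a" for x y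
  proof -
    obtain j k where "(?D ^^ j) x = 0" "(?D ^^ k) y = 0"
      using xy by (auto simp: gen_eigenspace_def)
    then have "(?D ^^ (j + k)) (x + y) = 0"
      using mono[where j = j and k = k and x = y] mono[where j = k and k = j and x = x]
      by (simp only: clinear_add[OF D] add.commute[of j k]) simp
    then show ?thesis unfolding gen_eigenspace_def by blast
  qed
  moreover have "c *\<^sub>C x \<in> gen_eigenspace T a" if x: "x \<in> gen_eigenspace T a" for c x
  proof -
    obtain j where "(?D ^^ j) x = 0"
      using x by (auto simp: gen_eigenspace_def)
    then have "(?D ^^ j) (c *\<^sub>C x) = 0" by (simp only: clinear_scale[OF D]) simp
    then show ?thesis unfolding gen_eigenspace_def by blast
  qed
  moreover have "0 \<in> gen_eigenspace T a"
    unfolding gen_eigenspace_def by (intro CollectI exI[of _ 0]) simp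
  ultimately show ?thesis unfolding cvec.subspace_def by blast
qed

lemma gen_eigenspace_shift:
  assumes "clinear T" "x \<in> gen_eigenspace T a"
  shows "T x - c *\<^sub>C x \<in> gen_eigenspace T a"
  using assms(2)
proof (induction rule: gen_eigenspace_induct)
  case zero
  then show ?case
    using assms subspace_gen_eigenspace[OF assms(1)] by (simp add: clinear_rules cvec.subspace_0)
next
  case (step x)
  have "T x - c *\<^sub>C x = (T x - a *\<^sub>C x) + (a - c) *\<^sub>C x"
    by (simp add: cvec.scale_left_diff_distrib)
  then show ?case
    using step subspace_gen_eigenspace[OF assms(1)]
    by (simp only:) (intro cvec.subspace_add cvec.subspace_scale)
qed

text \<open>On a generalised eigenspace for \<open>b\<close> the operator \<open>T - a\<close> is
  injective modulo \<open>M\<close>: once \<open>(T - b) x\<close> is known to lie in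
  \<open>M\<close>, subtracting it from \<open>(T - a) x\<close> leaves
  \<open>(b - a) x\<close>.\<close>

lemma gen_eigenspace_cancel:
  assumes T: "clinear T" and M: "cvec.subspace M" "\<And>x. x \<in> M \<Longrightarrow> T x \<in> M"
    and x: "x \<in> gen_eigenspace T b" and "a \<noteq> b" "T x - a *\<^sub>C x \<in> M"
  shows "x \<in> M"
  using x assms(6)
proof (induction rule: gen_eigenspace_induct)
  case zero
  then show ?case using M by (simp add: cvec.subspace_0)
next
  case (step x)
  let ?y = "T x - b *\<^sub>C x"
  have "T ?y - a *\<^sub>C ?y = T (T x - a *\<^sub>C x) - b *\<^sub>C (T x - a *\<^sub>C x)"
    by (simp add: clinear_rules[OF T] cvec.scale_right_diff_distrib mult.commute)
  also have "\<dots> \<in> M"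
    using step.prems M by (simp add: cvec.subspace_diff cvec.subspace_scale)
  finally have "?y \<in> M" by (rule step.IH)
  then have "(T x - a *\<^sub>C x) - ?y \<in> M"
    by (rule cvec.subspace_diff[OF M(1) step.prems])
  moreover have "(T x - a *\<^sub>C x) - ?y = (b - a) *\<^sub>C x"
    by (simp add: cvec.scale_left_diff_distrib)
  ultimately have "(1 / (b - a)) *\<^sub>C ((b - a) *\<^sub>C x) \<in> M"
    using M by (metis cvec.subspace_scale)
  then show ?case using \<open>a \<noteq> b\<close> by simp
qed

text \<open>A power of \<open>T - a\<close> kills one component and reduces to fewer summands;
  cancellation then undoes that power on the rest. With \<open>M = {0}\<close> this is uniqueness of
  components, with a joint eigenspace as \<open>M\<close> it drives simultaneous
  diagonalisation.\<close>

lemma gen_eigenspace_separate: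
  assumes T: "clinear T" and M: "cvec.subspace M" "\<And>x. x \<in> M \<Longrightarrow> T x \<in> M"
    and I: "finite I" "\<And>a. a \<in> I \<Longrightarrow> f a \<in> gen_eigenspace T a" "(\<Sum>a\<in>I. f a) \<in> M"
    and "a \<in> I"
  shows "f a \<in> M"
proof -
  have "\<forall>a\<in>I. f a \<in> M" using I
  proof (induction arbitrary: f rule: finite_induct)
    case (insert a I)
    let ?D = "\<lambda>y. T y - a *\<^sub>C y"
    have D: "clinear (?D ^^ k)" for k
      by (intro clinear_funpow clinear_shift T)
    have DM: "(?D ^^ k) x \<in> M" if "x \<in> M" for k x
      using that by (induction k) (auto intro!: cvec.subspace_diff cvec.subspace_scale M)
    have DG: "(?D ^^ k) x \<in> gen_eigenspace T b" if "x \<in> gen_eigenspace T b" for k x b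
      using that by (induction k) (auto intro!: gen_eigenspace_shift T)
    obtain k where k: "(?D ^^ k) (f a) = 0"
      using insert.prems by (auto simp: gen_eigenspace_def)
    have "(?D ^^ k) (\<Sum>b\<in>insert a I. f b) \<in> M"
      using insert.prems by (intro DM)
    also have "(?D ^^ k) (\<Sum>b\<in>insert a I. f b) = (\<Sum>b\<in>I. (?D ^^ k) (f b))"
      using insert.hyps by (simp only: clinear_sum[OF D]) (simp add: k)
    finally have g: "(?D ^^ k) (f b) \<in> M" if "b \<in> I" for b
      using insert.IH[of "\<lambda>b. (?D ^^ k) (f b)"] insert.prems DG that by blast
    \<comment> \<open>The factors of the power are removed one at a time, each by
      \<open>gen_eigenspace_cancel\<close>.\<close>
    have *: "x \<in> M" if "(?D ^^ k) x \<in> M" "x \<in> gen_eigenspace T b" "a \<noteq> b" for x b k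
      using that
    proof (induction k arbitrary: x)
      case (Suc k)
      then show ?case
        using gen_eigenspace_cancel[OF T M, where a = a and b = b and x = x]
          gen_eigenspace_shift[OF T, of x b a]
        by (simp add: funpow_Suc_right del: funpow.simps)
    qed simp
    have I: "f b \<in> M" if "b \<in> I" for b
      using *[OF g[OF that], of b] insert that by blast
    have "(\<Sum>b\<in>insert a I. f b) - (\<Sum>b\<in>I. f b) \<in> M"
      by (rule cvec.subspace_diff[OF M(1) insert.prems(2) cvec.subspace_sum[OF M(1) I]])
    with I insert.hyps show ?case by simp
  qed simp
  with \<open>a \<in> I\<close> show ?thesis by blast
qed

text \<open>Complement to \<open>gen_eigenspace_cancel\<close>: it supplies the preimages used to
  correct a vector in \<open>span_gen_eigenspaces\<close>.\<close>

lemma gen_eigenspace_onto: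
  assumes T: "clinear T" and "x \<in> gen_eigenspace T b" and ab: "a \<noteq> b"
  shows "\<exists>y\<in>gen_eigenspace T b. T y - a *\<^sub>C y = x"
  using assms(2)
proof (induction rule: gen_eigenspace_induct)
  case zero
  then show ?case
    using subspace_gen_eigenspace[OF T] by (intro bexI[of _ 0]) (auto simp: clinear_rules[OF T] cvec.subspace_0)
next
  case (step x)
  then obtain y where y: "y \<in> gen_eigenspace T b" "T y - a *\<^sub>C y = T x - b *\<^sub>C x" by blast
  \<comment> \<open>With \<open>(T - a) y = (T - b) x\<close> one gets
    \<open>(T - a) (x - y) = (b - a) x\<close>.\<close>
  let ?z = "(1 / (b - a)) *\<^sub>C (x - y)"
  have "T ?z - a *\<^sub>C ?z = (1 / (b - a)) *\<^sub>C ((T x - a *\<^sub>C x) - (T y - a *\<^sub>C y))"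
    by (simp add: clinear_rules[OF T] cvec.scale_right_diff_distrib mult.commute)
  also have "\<dots> = (1 / (b - a)) *\<^sub>C ((b - a) *\<^sub>C x)"
    unfolding y by (simp add: cvec.scale_left_diff_distrib)
  also have "\<dots> = x" using ab by simp
  finally show ?case
    using step y subspace_gen_eigenspace[OF T]
    by (intro bexI[of _ ?z]) (auto intro: cvec.subspace_scale cvec.subspace_diff)
qed

section \<open>Completeness of generalised eigenspaces and the semisimple part\<close>

lemma span_UN_decompose:
  assumes V: "\<And>a. cvec.subspace (V a)" and x: "x \<in> cvec.span (\<Union>a. V a)"
  shows "\<exists>I f. finite I \<and> (\<forall>a. f a \<in> V a) \<and> (\<forall>a. a \<notin> I \<longrightarrow> f a = 0) \<and> x = (\<Sum>a\<in>I. f a)"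
  using x
proof (induction rule: cvec.span_induct_alt)
  case base
  show ?case by (intro exI[of _ "{}"] exI[of _ "\<lambda>_. 0"]) (simp add: V cvec.subspace_0)
next
  case (step c x y)
  then obtain I f b where f: "finite I" "\<And>a. f a \<in> V a" "\<And>a. a \<notin> I \<Longrightarrow> f a = 0"
    "y = (\<Sum>a\<in>I. f a)" and b: "x \<in> V b" by blast
  let ?f = "\<lambda>a. (if a = b then c *\<^sub>C x else 0) + f a"
  have "(\<Sum>a\<in>I. f a) = (\<Sum>a\<in>insert b I. f a)"
    using f by (intro sum.mono_neutral_left) auto
  then have "c *\<^sub>C x + y = (\<Sum>a\<in>insert b I. ?f a)"
    using f(1,4) by (simp add: sum.distrib)
  moreover have "?f a \<in> V a" for a
    using f b by (auto intro: cvec.subspace_add[OF V] cvec.subspace_scale[OF V])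
  ultimately show ?case
    using f by (intro exI[of _ "insert b I"] exI[of _ ?f]) auto
qed

text \<open>Take a polynomial of least degree which maps a given vector outside \<open>U\<close> into \<open>U\<close>, and divide off
  a linear factor.\<close>

lemma eigenvector_modulo_subspace:
  fixes T :: "'g::complex_lie_algebra \<Rightarrow> 'g"
  assumes T: "clinear T" and U: "cvec.subspace U" "U \<noteq> UNIV"
  shows "\<exists>v a. v \<notin> U \<and> T v - a *\<^sub>C v \<in> U"
proof -
  obtain w where w: "w \<notin> U" using U by blast
  obtain B :: "'g set" where B: "cvec.independent B" "cvec.span B = UNIV" "finite B"
    by (rule basis_obtain)
  define n where "n = Suc (card B)"
  \<comment> \<open>This is \<open>p\<close> evaluated at \<open>T\<close> and applied to
    \<open>w\<close>, but cut off at degree \<open>n\<close>; hence the degree bounds carried along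
    below.\<close>
  define act where "act p = (\<Sum>i\<le>n. coeff p i *\<^sub>C (T ^^ i) w)" for p
  have act_diff: "act (p - q) = act p - act q" and act_smult: "act (smult c p) = c *\<^sub>C act p"
    for p q c
    by (simp_all add: act_def cvec.scale_left_diff_distrib sum_subtractf cvec.scale_sum_right)
  have act_pCons: "act (pCons 0 q) = T (act q)" if "degree q < n" for q
  proof -
    have "act (pCons 0 q) = (\<Sum>i\<le>card B. coeff q i *\<^sub>C (T ^^ Suc i) w)"
      unfolding act_def n_def sum.atMost_Suc_shift by simp
    also have "\<dots> = (\<Sum>i\<le>n. coeff q i *\<^sub>C (T ^^ Suc i) w)"
      using that by (simp add: n_def coeff_eq_0)
    also have "\<dots> = T (act q)"
      unfolding act_def by (simp add: clinear_rules[OF T])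
    finally show ?thesis .
  qed
  \<comment> \<open>A relation between the powers of \<open>T\<close> on \<open>w\<close>.
    Coinciding powers are treated apart, because as a set they may be independent; there a
    difference of two monomials serves.\<close>
  have "\<exists>p. p \<noteq> 0 \<and> degree p \<le> n \<and> act p = 0"
  proof (cases "inj_on (\<lambda>i. (T ^^ i) w) {..n}")
    case True
    let ?S = "(\<lambda>i. (T ^^ i) w) ` {..n}"
    have "card ?S = Suc n" using True by (simp add: card_image)
    then have "cvec.dependent ?S"
      using cvec.independent_span_bound[OF B(3), of ?S] B(2) by (auto simp: n_def)
    then obtain u where u: "\<exists>v\<in>?S. u v \<noteq> 0" "(\<Sum>v\<in>?S. u v *\<^sub>C v) = 0"
      by (auto simp: cvec.dependent_finite)
    define p where "p = (\<Sum>i\<le>n. monom (u ((T ^^ i) w)) i)"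
    have cf: "coeff p i = (if i \<le> n then u ((T ^^ i) w) else 0)" for i
      by (simp add: p_def coeff_sum coeff_monom if_distrib[where f = u] sum.delta)
    have "act p = (\<Sum>i\<le>n. u ((T ^^ i) w) *\<^sub>C (T ^^ i) w)"
      unfolding act_def by (rule sum.cong) (auto simp: cf)
    also have "\<dots> = 0" using u(2) True by (simp add: sum.reindex)
    finally have "act p = 0" .
    moreover have "p \<noteq> 0" using u(1) cf by (metis (no_types, lifting) atMost_iff coeff_0 imageE)
    moreover have "degree p \<le> n" by (rule degree_le) (simp add: cf)
    ultimately show ?thesis by blast
  next
    case False
    then obtain i j where ij: "i \<le> n" "j \<le> n" "i \<noteq> j" "(T ^^ i) w = (T ^^ j) w"
      by (auto simp: inj_on_def)
    define p :: "complex poly" where "p = monom 1 i - monom 1 j"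
    have "act (monom 1 k) = (T ^^ k) w" if "k \<le> n" for k
    proof -
      have "act (monom 1 k) = (\<Sum>i\<le>n. if k = i then (T ^^ i) w else 0)"
        unfolding act_def by (rule sum.cong) (auto simp: coeff_monom)
      with that show ?thesis by simp
    qed
    then have "act p = 0" using ij by (simp add: p_def act_diff)
    moreover have "coeff p i = 1" using ij by (simp add: p_def)
    then have "p \<noteq> 0" by auto
    moreover have "degree p \<le> n"
      unfolding p_def using ij by (intro degree_diff_le) (auto simp: degree_monom_eq)
    ultimately show ?thesis by blast
  qed
  then have ex: "\<exists>p. p \<noteq> 0 \<and> degree p \<le> n \<and> act p \<in> U"
    using U by (metis cvec.subspace_0)
  define p where "p = (ARG_MIN degree p. p \<noteq> 0 \<and> degree p \<le> n \<and> act p \<in> U)"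
  have p: "p \<noteq> 0" "degree p \<le> n" "act p \<in> U"
    and minp: "\<And>q. q \<noteq> 0 \<Longrightarrow> degree q \<le> n \<Longrightarrow> act q \<in> U \<Longrightarrow> degree p \<le> degree q"
    using arg_min_nat_lemma[of "\<lambda>p. p \<noteq> 0 \<and> degree p \<le> n \<and> act p \<in> U" _ degree] ex
    unfolding p_def by blast+
  have "degree p \<noteq> 0"
  proof
    assume "degree p = 0"
    then obtain c where c: "p = [:c:]" by (rule degree_eq_zeroE)
    then have "act p = c *\<^sub>C w"
      unfolding act_def n_def sum.atMost_Suc_shift by simp
    then have "(1 / c) *\<^sub>C (c *\<^sub>C w) \<in> U" using p U by (metis cvec.subspace_scale)
    then show False using p c w by simp
  qed
  then have "\<not> constant (poly p)" by (simp add: constant_degree)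
  then obtain a where "poly p a = 0" using fundamental_theorem_of_algebra by blast
  then obtain q where q: "p = [:- a, 1:] * q" by (auto simp: poly_eq_0_iff_dvd)
  then have q0: "q \<noteq> 0" using p by auto
  have deg: "degree p = Suc (degree q)" unfolding q using q0 by (subst degree_mult_eq) auto
  have "act q \<notin> U" using minp[of q] q0 deg p(2) by force
  moreover have "act p = T (act q) - a *\<^sub>C act q"
  proof -
    have "p = pCons 0 q - smult a q" by (simp add: q)
    then show ?thesis using deg p(2) by (simp add: act_diff act_smult act_pCons)
  qed
  ultimately show ?thesis using p(3) by metis
qed

text \<open>If the span \<open>?U\<close> were proper, some \<open>v\<close> outside it would
  satisfy \<open>(T - a) v \<in> ?U\<close>. Preimages under \<open>T - a\<close> remove every
  component of \<open>(T - a) v\<close> for eigenvalues other than \<open>a\<close>, and the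
  corrected \<open>v\<close> is a generalised eigenvector.\<close>

lemma span_gen_eigenspaces:
  assumes T: "clinear T"
  shows "cvec.span (\<Union>a. gen_eigenspace T a) = UNIV"
proof (rule ccontr)
  let ?U = "cvec.span (\<Union>a. gen_eigenspace T a)"
  assume "?U \<noteq> UNIV"
  then obtain v a where v: "v \<notin> ?U" "T v - a *\<^sub>C v \<in> ?U"
    using eigenvector_modulo_subspace[OF T cvec.subspace_span] by blast
  then obtain I f where f: "finite I" "\<And>b. f b \<in> gen_eigenspace T b" "\<And>b. b \<notin> I \<Longrightarrow> f b = 0"
     "T v - a *\<^sub>C v = (\<Sum>b\<in>I. f b)"
    using span_UN_decompose[of "gen_eigenspace T", OF subspace_gen_eigenspace[OF T] v(2)] by blast
  have "\<forall>b. \<exists>y. b \<noteq> a \<longrightarrow> y \<in> gen_eigenspace T b \<and> T y - a *\<^sub>C y = f b"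
    using gen_eigenspace_onto[OF T f(2)] by metis
  then obtain g where g: "\<And>b. b \<noteq> a \<Longrightarrow> g b \<in> gen_eigenspace T b"
    "\<And>b. b \<noteq> a \<Longrightarrow> T (g b) - a *\<^sub>C g b = f b" by metis
  let ?v = "v - (\<Sum>b\<in>I - {a}. g b)"
  have "T ?v - a *\<^sub>C ?v = (T v - a *\<^sub>C v) - (\<Sum>b\<in>I - {a}. T (g b) - a *\<^sub>C g b)"
    by (simp add: clinear_rules[OF T] cvec.scale_right_diff_distrib sum_subtractf cvec.scale_sum_right)
  also have "(\<Sum>b\<in>I - {a}. T (g b) - a *\<^sub>C g b) = (\<Sum>b\<in>I - {a}. f b)"
    by (rule sum.cong) (auto simp: g)
  also have "T v - a *\<^sub>C v - \<dots> = f a"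
    using f(1,3) by (cases "a \<in> I") (auto simp: f(4) sum.remove)
  finally have "?v \<in> gen_eigenspace T a"
    using f(2) by (metis gen_eigenspace_step)
  then have "?v + (\<Sum>b\<in>I - {a}. g b) \<in> ?U"
    using g by (intro cvec.span_add cvec.span_sum cvec.span_base) blast+
  with v show False by simp
qed

text \<open>The index set is fixed once for all \<open>x\<close>, by a basis of generalised
  eigenvectors, so that a linear map can be defined by a single finite sum.\<close>

lemma gen_eigenspaces_finite:
  assumes T: "clinear T"
  obtains I where "finite I"
    "\<And>x. \<exists>f. (\<forall>a. f a \<in> gen_eigenspace T a) \<and> (\<forall>a. a \<notin> I \<longrightarrow> f a = 0) \<and> x = (\<Sum>a\<in>I. f a)"
proof -
  obtain B :: "'a set" where B: "B \<subseteq> (\<Union>a. gen_eigenspace T a)" "cvec.independent B"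
      "cvec.span B = UNIV" "finite B"
    using basis_within[of "\<Union>a. gen_eigenspace T a"] span_gen_eigenspaces[OF T] by blast
  have "\<forall>b\<in>B. \<exists>a. b \<in> gen_eigenspace T a" using B by blast
  then obtain ev where ev: "\<And>b. b \<in> B \<Longrightarrow> b \<in> gen_eigenspace T (ev b)" by metis
  have "\<exists>f. (\<forall>a. f a \<in> gen_eigenspace T a) \<and> (\<forall>a. a \<notin> ev ` B \<longrightarrow> f a = 0) \<and> x = (\<Sum>a\<in>ev ` B. f a)"
    for x
  proof -
    have "x \<in> cvec.span B" using B by simp
    then show ?thesis
    proof (induction rule: cvec.span_induct_alt)
      case base
      then show ?case using subspace_gen_eigenspace[OF T]
        by (intro exI[of _ "\<lambda>_. 0"]) (auto simp: cvec.subspace_0)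
    next
      case (step c b y)
      then obtain f where f: "\<And>a. f a \<in> gen_eigenspace T a" "\<And>a. a \<notin> ev ` B \<Longrightarrow> f a = 0"
        "y = (\<Sum>a\<in>ev ` B. f a)" by blast
      let ?f = "\<lambda>a. (if a = ev b then c *\<^sub>C b else 0) + f a"
      have "c *\<^sub>C b + y = (\<Sum>a\<in>ev ` B. ?f a)"
        using B step by (simp add: sum.distrib f(3))
      moreover have "?f a \<in> gen_eigenspace T a" for a
        using f ev[OF step(1)] cvec.subspace_add[OF subspace_gen_eigenspace[OF T]]
          cvec.subspace_scale[OF subspace_gen_eigenspace[OF T]] by auto
      ultimately show ?case
        using f step by (intro exI[of _ ?f]) auto
    qed
  qed
  with B that show thesis by blast
qed

lemma gen_eigenspace_unique:
  assumes T: "clinear T" and "finite I" "\<And>a. a \<in> I \<Longrightarrow> f a \<in> gen_eigenspace T a"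
    "\<And>a. a \<in> I \<Longrightarrow> g a \<in> gen_eigenspace T a" "(\<Sum>a\<in>I. f a) = (\<Sum>a\<in>I. g a)" "a \<in> I"
  shows "f a = g a"
  using gen_eigenspace_separate[OF T, of "{0}" I "\<lambda>a. f a - g a" a] assms
    subspace_gen_eigenspace[OF T]
  by (simp add: clinear_rules[OF T] sum_subtractf cvec.subspace_diff)

lemma gen_eigenvalues_finite:
  assumes T: "clinear T"
  shows "finite {a. \<exists>x\<in>gen_eigenspace T a. x \<noteq> 0}"
proof -
  obtain I where I: "finite I"
    "\<And>x. \<exists>f. (\<forall>a. f a \<in> gen_eigenspace T a) \<and> (\<forall>a. a \<notin> I \<longrightarrow> f a = 0) \<and> x = (\<Sum>a\<in>I. f a)"
    by (rule gen_eigenspaces_finite[OF T]) blast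
  have "x = 0" if "x \<in> gen_eigenspace T a" "a \<notin> I" for x a
  proof -
    obtain f where f: "\<And>a. f a \<in> gen_eigenspace T a" "\<And>a. a \<notin> I \<Longrightarrow> f a = 0" "x = (\<Sum>a\<in>I. f a)"
      using I(2)[of x] by blast
    have "f a = x"
    proof (rule gen_eigenspace_unique[OF T, where I = "insert a I" and a = a and f = f
          and g = "\<lambda>b. if b = a then x else 0", THEN trans])
      show "(\<Sum>a\<in>insert a I. f a) = (\<Sum>b\<in>insert a I. if b = a then x else 0)"
        using I f that by simp
    qed (use I f that subspace_gen_eigenspace[OF T] in \<open>auto simp: cvec.subspace_0\<close>)
    with f that show ?thesis by simp
  qed
  then have "{a. \<exists>x\<in>gen_eigenspace T a. x \<noteq> 0} \<subseteq> I" by blast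
  then show ?thesis by (rule finite_subset[OF _ I(1)])
qed

text \<open>Uniqueness makes the components of \<open>x\<close> additive and homogeneous in
  \<open>x\<close>, so weighting them by their eigenvalues is linear. This is the semisimple part of
  the additive Jordan decomposition.\<close>

lemma semisimple_part:
  assumes T: "clinear T"
  obtains S where "clinear S" "\<And>a x. x \<in> gen_eigenspace T a \<Longrightarrow> S x = a *\<^sub>C x"
proof -
  obtain I where I: "finite I"
    "\<And>x. \<exists>f. (\<forall>a. f a \<in> gen_eigenspace T a) \<and> (\<forall>a. a \<notin> I \<longrightarrow> f a = 0) \<and> x = (\<Sum>a\<in>I. f a)"
    by (rule gen_eigenspaces_finite[OF T]) blast
  have "\<exists>p. \<forall>x. (\<forall>a. p x a \<in> gen_eigenspace T a) \<and> (\<forall>a. a \<notin> I \<longrightarrow> p x a = 0) \<and>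
      x = (\<Sum>a\<in>I. p x a)"
    by (rule choice) (use I(2) in blast)
  then obtain p where p: "\<And>x a. p x a \<in> gen_eigenspace T a" "\<And>x a. a \<notin> I \<Longrightarrow> p x a = 0"
    "\<And>x. x = (\<Sum>a\<in>I. p x a)" by blast
  from p(3) have p3: "\<And>x. (\<Sum>a\<in>I. p x a) = x" by (rule sym)
  note p = p(1,2) p3
  note sub = subspace_gen_eigenspace[OF T]
  have uniq: "p x a = f a" if "\<And>a. f a \<in> gen_eigenspace T a" "(\<Sum>a\<in>I. f a) = x" "a \<in> I" for x f a
    by (rule gen_eigenspace_unique[OF T I(1)]) (use p that in auto)
  have add: "p (x + y) a = p x a + p y a" if "a \<in> I" for x y a
    by (rule uniq) (use p that sub in \<open>auto simp: sum.distrib cvec.subspace_add\<close>)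
  have scale: "p (c *\<^sub>C x) a = c *\<^sub>C p x a" if "a \<in> I" for x c a
    by (rule uniq) (use p that sub in \<open>auto simp: cvec.scale_sum_right[symmetric] cvec.subspace_scale\<close>)
  define S where "S x = (\<Sum>a\<in>I. a *\<^sub>C p x a)" for x
  have "clinear S"
    by (auto simp: clinear_iff S_def add scale scaleC_add_right sum.distrib cvec.scale_sum_right
        mult.commute)
  moreover have "S x = a *\<^sub>C x" if x: "x \<in> gen_eigenspace T a" for x a
  proof (cases "a \<in> I")
    case True
    have "p x b = (if b = a then x else 0)" if "b \<in> I" for b
      by (rule uniq) (use x True that sub I(1) in \<open>auto simp: cvec.subspace_0\<close>)
    then have "S x = (\<Sum>b\<in>I. if b = a then a *\<^sub>C x else 0)"
      unfolding S_def by (intro sum.cong) auto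
    with True I show ?thesis by simp
  next
    \<comment> \<open>Here the generalised eigenspace is zero: over \<open>insert a I\<close> the
      vector \<open>x\<close> is its own component at \<open>a\<close>, and that component is
      0.\<close>
    case False
    have "p x a = x"
    proof (rule gen_eigenspace_unique[OF T, where I = "insert a I" and a = a and f = "p x"
          and g = "\<lambda>b. if b = a then x else 0", THEN trans])
      show "(\<Sum>a\<in>insert a I. p x a) = (\<Sum>b\<in>insert a I. if b = a then x else 0)"
        using I p False by simp
    qed (use I p x sub in \<open>auto simp: cvec.subspace_0\<close>)
    with p False have "x = 0" by metis
    with \<open>clinear S\<close> show ?thesis by (simp add: clinear_0)
  qed
  ultimately show thesis by (rule that)
qed

section \<open>The Killing form\<close>

lemmas clinear_lie2 = clinear_comp[OF clinear_lie clinear_lie]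

lemma killing_add_left: "killing (x + y) z = killing x z + killing y z"
  unfolding killing_def lie_add_left by (rule trace_op_add) (rule clinear_lie2)+

lemma killing_scale_left: "killing (a *\<^sub>C x) y = a * killing x y"
  unfolding killing_def lie_scale_left by (rule trace_op_cmult) (rule clinear_lie2)

lemma killing_sym: "killing x y = killing y x"
  unfolding killing_def by (rule trace_op_comm) (rule clinear_lie)+

lemma killing_add_right: "killing x (y + z) = killing x y + killing x z"
  by (simp add: killing_sym[of x] killing_add_left)

lemma killing_scale_right: "killing x (a *\<^sub>C y) = a * killing x y"
  by (simp add: killing_sym[of x] killing_scale_left)

lemma killing_0 [simp]: "killing 0 y = 0" "killing x 0 = 0"
  using killing_scale_left[of 0 0 y] killing_scale_right[of x 0 0] by simp_all

lemma killing_minus_left: "killing (- x) y = - killing x y"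
  using killing_scale_left[of "-1" x y] by simp

lemma killing_minus_right: "killing x (- y) = - killing x y"
  using killing_scale_right[of x "-1" y] by simp

lemma killing_diff_left: "killing (x - y) z = killing x z - killing y z"
  using killing_add_left[of x "- y" z] by (simp add: killing_minus_left)

lemma killing_sum_right: "killing x (\<Sum>i\<in>I. f i) = (\<Sum>i\<in>I. killing x (f i))"
  by (induction I rule: infinite_finite_induct) (auto simp: killing_add_right)

lemma killing_sum_left: "killing (\<Sum>i\<in>I. f i) y = (\<Sum>i\<in>I. killing (f i) y)"
  by (induction I rule: infinite_finite_induct) (auto simp: killing_add_left)

lemma killing_invariant: "killing (lie x y) z = killing x (lie y z)"
proof -
  have c: "clinear (\<lambda>w. lie x (lie y (lie z w)))" "clinear (\<lambda>w. lie y (lie x (lie z w)))"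
    "clinear (\<lambda>w. lie x (lie z (lie y w)))" for x y z :: 'a
    by (intro clinear_comp[OF clinear_lie] clinear_lie)+
  have "killing (lie x y) z = trace_op (\<lambda>w. lie x (lie y (lie z w))) - trace_op (\<lambda>w. lie y (lie x (lie z w)))"
    unfolding killing_def lie_lie by (rule trace_op_diff) (rule c)+
  also have "trace_op (\<lambda>w. lie y (lie x (lie z w))) = trace_op (\<lambda>w. lie x (lie z (lie y w)))"
    by (rule trace_op_comm[of "lie y"]) (rule clinear_lie clinear_lie2)+
  also have "trace_op (\<lambda>w. lie x (lie y (lie z w))) - \<dots> = killing x (lie y z)"
    unfolding killing_def lie_lie clinear_diff[OF clinear_lie]
    by (rule trace_op_diff[symmetric]) (rule c)+
  finally show ?thesis .
qed

lemma killing_skew: "killing (lie x y) z = - killing y (lie x z)"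
  by (simp add: lie_anti[of x y] killing_minus_left killing_invariant)

text \<open>The operator \<open>lie (f x)\<close> is the conjugate of \<open>lie x\<close> by
  \<open>f\<close>, and conjugation preserves traces.\<close>

lemma killing_automorphism:
  assumes "lie_automorphism f"
  shows "killing (f x) (f y) = killing x y"
proof -
  have f: "clinear f" "bij f" "\<And>x y. f (lie x y) = lie (f x) (f y)"
    using assms by (auto simp: lie_automorphism_def)
  define g where "g = inv f"
  have fg: "f (g z) = z" and gf: "g (f z) = z" for z
    using f(2) by (simp_all add: g_def bij_is_surj surj_f_inv_f bij_is_inj)
  have g: "clinear g"
    unfolding clinear_iff by (metis f(1) fg gf clinear_add clinear_scale)
  have "killing (f x) (f y) = trace_op (\<lambda>z. f (lie x (lie y (g z))))"
    unfolding killing_def by (simp add: f(3) fg)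
  also have "\<dots> = trace_op (\<lambda>z. lie x (lie y (g (f z))))"
    by (rule trace_op_comm[OF f(1)]) (intro clinear_comp[OF clinear_lie] g)
  also have "\<dots> = killing x y" by (simp add: gf killing_def)
  finally show ?thesis .
qed

lemma killing_diagonal:
  assumes diag: "(UNIV :: 'g::complex_lie_algebra set) \<subseteq> cvec.span E"
    and E: "\<And>x. x \<in> E \<Longrightarrow> lie h x = a x *\<^sub>C x \<and> lie h' x = b x *\<^sub>C x"
  obtains B where "B \<subseteq> E" "finite B" "cvec.independent B" "cvec.span B = (UNIV :: 'g set)"
    "killing h h' = (\<Sum>x\<in>B. a x * b x)"
proof -
  obtain B where B: "B \<subseteq> E" "cvec.independent B" "cvec.span B = UNIV" "finite B"
    by (rule basis_within[OF diag])
  have "killing h h' = (\<Sum>x\<in>B. a x * b x)"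
    unfolding killing_def
  proof (rule trace_op_eigenbasis[OF clinear_lie2 B(2,3)])
    fix x assume "x \<in> B"
    then have x: "lie h x = a x *\<^sub>C x" "lie h' x = b x *\<^sub>C x"
      using E B by blast+
    then show "lie h (lie h' x) = (a x * b x) *\<^sub>C x"
      by (simp add: lie_scale_right mult.commute)
  qed
  with B show thesis by (intro that) auto
qed

section \<open>Strings of eigenvectors\<close>

abbreviation eigenvectors :: "'g::complex_lie_algebra \<Rightarrow> 'g set" where
  "eigenvectors h \<equiv> {x. \<exists>a. lie h x = a *\<^sub>C x}"

lemma lie_eigenvector_funpow:
  assumes "lie h e = c *\<^sub>C e" "lie h x = a *\<^sub>C x"
  shows "lie h ((lie e ^^ k) x) = (a + of_nat k * c) *\<^sub>C (lie e ^^ k) x"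
proof (induction k)
  case (Suc k)
  have "lie h ((lie e ^^ Suc k) x) = lie (lie h e) ((lie e ^^ k) x) + lie e (lie h ((lie e ^^ k) x))"
    by (simp add: lie_deriv[of h e "(lie e ^^ k) x"])
  also have "\<dots> = c *\<^sub>C (lie e ^^ Suc k) x + (a + of_nat k * c) *\<^sub>C (lie e ^^ Suc k) x"
    by (simp add: assms Suc lie_scale_left lie_scale_right)
  also have "\<dots> = (a + of_nat (Suc k) * c) *\<^sub>C (lie e ^^ Suc k) x"
    by (simp only: scaleC_add_left[symmetric]) (simp add: algebra_simps)
  finally show ?case .
qed (simp add: assms)

text \<open>On an eigenvector of \<open>h\<close>, powers of \<open>lie e\<close> shift the
  eigenvalue by multiples of \<open>c\<close>; only finitely many eigenvalues exist, so the string
  breaks off.\<close>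

lemma locally_nilpotent_lie:
  assumes diag: "x \<in> cvec.span (eigenvectors h)"
    and e: "lie h e = c *\<^sub>C e" "c \<noteq> 0"
  shows "\<exists>k. (lie e ^^ k) x = 0"
proof -
  have eig: "\<exists>k. (lie e ^^ k) x = 0" if x: "lie h x = a *\<^sub>C x" for x a
  proof (rule ccontr)
    assume nz: "\<nexists>k. (lie e ^^ k) x = 0"
    have "(lie e ^^ k) x \<in> gen_eigenspace (lie h) (a + of_nat k * c)" for k
      by (rule eigenvector_in_gen_eigenspace) (rule lie_eigenvector_funpow[OF e(1) x])
    then have "range (\<lambda>k. a + of_nat k * c) \<subseteq> {b. \<exists>y\<in>gen_eigenspace (lie h) b. y \<noteq> 0}"
      using nz by blast
    then have "finite (range (\<lambda>k. a + of_nat k * c))"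
      by (rule finite_subset) (rule gen_eigenvalues_finite[OF clinear_lie])
    moreover have "inj (\<lambda>k::nat. a + of_nat k * c)"
      using e(2) by (intro injI) simp
    ultimately show False
      using finite_imageD infinite_UNIV_nat by blast
  qed
  have lin: "clinear (lie e ^^ k)" for k by (intro clinear_funpow clinear_lie)
  have mono: "(lie e ^^ (j + k)) x = 0" if "(lie e ^^ k) x = 0" for j k x
    by (simp only: funpow_add comp_apply that clinear_0[OF lin])
  show ?thesis using diag
  proof (induction rule: cvec.span_induct_alt)
    case base
    show ?case by (intro exI[of _ 0]) simp
  next
    case (step b x y)
    then obtain j k where "(lie e ^^ j) x = 0" "(lie e ^^ k) y = 0" using eig by blast
    then have "(lie e ^^ (j + k)) (b *\<^sub>C x + y) = 0"
      using mono[of k y j] mono[of j x k]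
      by (simp only: clinear_add[OF lin] clinear_scale[OF lin] add.commute[of k j]) simp
    then show ?case by blast
  qed
qed

lemma funpow_last_nonzero:
  fixes f :: "'b \<Rightarrow> 'b::zero"
  assumes "\<exists>k. (f ^^ k) x = 0" "x \<noteq> 0"
  obtains j where "(f ^^ j) x \<noteq> 0" "(f ^^ Suc j) x = 0"
proof -
  define k where "k = (LEAST k. (f ^^ k) x = 0)"
  have k: "(f ^^ k) x = 0" unfolding k_def by (rule LeastI_ex[OF assms(1)])
  then have "k \<noteq> 0" using assms(2) by (metis funpow_0)
  then obtain j where j: "k = Suc j" using not0_implies_Suc by blast
  have "j < (LEAST k. (f ^^ k) x = 0)" using j unfolding k_def by linarith
  then have "(f ^^ j) x \<noteq> 0" by (rule not_less_Least)
  with j k that show thesis by blast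
qed

text \<open>For \<open>a = 2\<close> this is the computation behind the representation theory of \<open>sl\<^sub>2\<close>; for \<open>a = 0\<close> the three
  elements span a Heisenberg algebra.\<close>

lemma highest_weight:
  assumes ef: "lie e f = h" and he: "lie h e = a *\<^sub>C e" and hf: "lie h f = (- a) *\<^sub>C f"
    and nil: "\<exists>k. (lie f ^^ k) x = 0"
    and x: "x \<noteq> 0" "lie h x = b *\<^sub>C x" "lie e x = 0"
  shows "\<exists>k::nat. 2 * b = a * of_nat k"
proof -
  \<comment> \<open>Each \<open>f\<close> that \<open>e\<close> is commuted past contributes an
    eigenvalue of \<open>h\<close>; the coefficient is the sum of \<open>b - a * i\<close> over
    \<open>i \<le> j\<close>.\<close>
  have *: "lie e ((lie f ^^ Suc j) x) =
      (of_nat (Suc j) * (b - a * of_nat j / 2)) *\<^sub>C (lie f ^^ j) x" for j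
  proof (induction j)
    case 0
    have "lie e (lie f x) = lie h x + lie f (lie e x)" by (simp add: lie_deriv[of e f x] ef)
    then show ?case by (simp add: x)
  next
    case (Suc j)
    let ?v = "(lie f ^^ Suc j) x"
    have "lie e ((lie f ^^ Suc (Suc j)) x) = lie h ?v + lie f (lie e ?v)"
      using lie_deriv[of e f ?v] by (simp add: ef)
    also have "\<dots> = (b + of_nat (Suc j) * (- a)) *\<^sub>C ?v +
        (of_nat (Suc j) * (b - a * of_nat j / 2)) *\<^sub>C ?v"
      unfolding lie_eigenvector_funpow[OF hf x(2)] Suc.IH by (simp add: lie_scale_right)
    also have "\<dots> = (of_nat (Suc (Suc j)) * (b - a * of_nat (Suc j) / 2)) *\<^sub>C ?v"
      by (simp only: scaleC_add_left[symmetric]) (simp add: field_simps)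
    finally show ?case .
  qed
  obtain j where j: "(lie f ^^ j) x \<noteq> 0" "(lie f ^^ Suc j) x = 0"
    by (rule funpow_last_nonzero[OF nil x(1)])
  have "(of_nat (Suc j) * (b - a * of_nat j / 2)) *\<^sub>C (lie f ^^ j) x = 0"
    unfolding *[symmetric] j by simp
  with j(1) have "of_nat (Suc j) * (b - a * of_nat j / 2) = 0" by simp
  then have "b - a * of_nat j / 2 = 0" unfolding mult_eq_0_iff by (simp del: of_nat_Suc)
  then show ?thesis by (intro exI[of _ j]) (simp add: field_simps)
qed

text \<open>Exchange \<open>e\<close> with \<open>f\<close> and negate \<open>h\<close>; the
  parameter \<open>a\<close> stays the same.\<close>

lemma lowest_weight:
  assumes ef: "lie e f = h" and he: "lie h e = a *\<^sub>C e" and hf: "lie h f = (- a) *\<^sub>C f"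
    and nil: "\<exists>k. (lie e ^^ k) x = 0"
    and x: "x \<noteq> 0" "lie h x = b *\<^sub>C x" "lie f x = 0"
  shows "\<exists>k::nat. 2 * b = - a * of_nat k"
proof -
  have "\<exists>k::nat. 2 * (- b) = a * of_nat k"
  proof (rule highest_weight[where e = f and f = e and h = "- h"])
    show "lie f e = - h" unfolding ef[symmetric] by (rule lie_anti)
  qed (use assms in \<open>simp_all add: clinear_neg[OF clinear_lie_left]\<close>)
  then obtain k :: nat where "2 * (- b) = a * of_nat k" by blast
  then have "2 * b = - a * of_nat k" by (simp add: minus_equation_iff[of "2 * b"])
  then show ?thesis by blast
qed

text \<open>Climbing with \<open>e\<close> reaches a highest weight vector, of weight
  \<open>b + i * a\<close>. For \<open>a = 0\<close> the conclusion says \<open>b = 0\<close>, and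
  that degenerate case is what excludes roots of norm zero.\<close>

lemma weight_integral:
  assumes ef: "lie e f = h" and he: "lie h e = a *\<^sub>C e" and hf: "lie h f = (- a) *\<^sub>C f"
    and nil: "\<And>x. \<exists>k. (lie e ^^ k) x = 0" "\<And>x. \<exists>k. (lie f ^^ k) x = 0"
    and x: "x \<noteq> 0" "lie h x = b *\<^sub>C x"
  shows "\<exists>k::int. 2 * b = a * of_int k"
proof -
  obtain i where i: "(lie e ^^ i) x \<noteq> 0" "(lie e ^^ Suc i) x = 0"
    by (rule funpow_last_nonzero[OF nil(1) x(1)])
  have "\<exists>k::nat. 2 * (b + of_nat i * a) = a * of_nat k"
    using i by (intro highest_weight[OF ef he hf nil(2) i(1)] lie_eigenvector_funpow he x) simp
  then obtain k :: nat where "2 * (b + of_nat i * a) = a * of_nat k" by blast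
  then have "2 * b = a * of_int (int k - 2 * int i)" by (simp add: algebra_simps)
  then show ?thesis by blast
qed

section \<open>Nondegeneracy\<close>

lemma killing_radical_ideal: "ideal {x. \<forall>y. killing x y = 0}"
  unfolding ideal_def cvec.subspace_def
  by (auto simp: killing_add_left killing_scale_left killing_skew)

lemma weight_lie:
  assumes "lie h x = a *\<^sub>C x" "lie h y = b *\<^sub>C y"
  shows "lie h (lie x y) = (a + b) *\<^sub>C lie x y"
  unfolding lie_deriv[of h x y] assms by (simp add: lie_scale_left lie_scale_right scaleC_add_left)

text \<open>The radical is an ideal, so simplicity leaves only the form that vanishes identically to
  be excluded. The Chevalley generators contained in \<open>diagram_automorphism\<close> provide the
  coroot for this: a vanishing sum of squares of its eigenvalues would make it central.\<close>

lemma killing_nondegenerate: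
  fixes \<nu> :: "'g::complex_lie_algebra \<Rightarrow> 'g" and x :: 'g
  assumes simple: "simple_lie_algebra TYPE('g)" and nu: "diagram_automorphism \<nu> n"
    and x: "\<And>y. killing x y = 0"
  shows "x = 0"
proof (rule ccontr)
  assume "x \<noteq> 0"
  let ?R = "{x :: 'g. \<forall>y. killing x y = 0}"
  have "x \<in> ?R" using x by simp
  with \<open>x \<noteq> 0\<close> have "?R \<noteq> {0}" by (metis singletonD)
  moreover have "?R = {0} \<or> ?R = UNIV"
    using simple killing_radical_ideal unfolding simple_lie_algebra_def by metis
  ultimately have K0: "killing x y = 0" for x y :: 'g by auto
  obtain hh N \<beta> e f where hh: "cartan_subalgebra (UNIV :: 'g set) hh"
    and \<beta>: "simple_roots UNIV hh {..<N} \<beta>"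
    and ef: "\<forall>i<N. e i \<in> weight_space UNIV hh (\<beta> i) \<and> f i \<in> weight_space UNIV hh (\<lambda>h. - \<beta> i h) \<and>
               \<beta> i (lie (e i) (f i)) = (2::complex)"
    using nu unfolding diagram_automorphism_def by blast
  \<comment> \<open>Without simple roots \<open>hh\<close> is zero; being its own centraliser it is
    then the whole algebra, against the existence of a nonzero bracket.\<close>
  have "N \<noteq> 0"
  proof
    assume "N = 0"
    then have dim: "cvec.dim hh = 0" using \<beta> by (simp add: simple_roots_def)
    obtain B where B: "B \<subseteq> hh" "cvec.independent B" "hh \<subseteq> cvec.span B" "card B = cvec.dim hh"
      by (rule cvec.basis_exists)
    then have "B = {}" using dim independent_finite[OF B(2)] by simp
    then have "hh \<subseteq> {0}" using B by simp
    then have "y = 0" for y :: 'g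
      using hh unfolding cartan_subalgebra_def by (metis UNIV_I lie_0(2) singletonD subsetD)
    with simple show False unfolding simple_lie_algebra_def by metis
  qed
  then have e: "lie h (e 0) = \<beta> 0 h *\<^sub>C e 0" and f: "lie h (f 0) = (- \<beta> 0 h) *\<^sub>C f 0"
    if "h \<in> hh" for h
    using ef that unfolding weight_space_def by blast+
  define h where "h = lie (e 0) (f 0)"
  have two: "\<beta> 0 h = 2" using ef \<open>N \<noteq> 0\<close> by (simp add: h_def)
  have "lie h' h = 0" if "h' \<in> hh" for h'
    using weight_lie[OF e[OF that] f[OF that]] by (simp add: h_def)
  then have "h \<in> hh" using hh unfolding cartan_subalgebra_def by blast
  have diag: "UNIV \<subseteq> cvec.span (eigenvectors h)"
    using hh \<open>h \<in> hh\<close> unfolding cartan_subalgebra_def by simp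
  have he: "lie h (e 0) = 2 *\<^sub>C e 0" and hf: "lie h (f 0) = (- 2) *\<^sub>C f 0"
    using e f \<open>h \<in> hh\<close> two by simp_all
  have "\<beta> 0 \<in> dual hh"
    using \<beta> \<open>N \<noteq> 0\<close> unfolding simple_roots_def roots_def by auto
  moreover have "0 \<in> hh"
    using hh by (simp add: cartan_subalgebra_def cvec.subspace_0)
  ultimately have "\<beta> 0 (0 *\<^sub>C 0) = 0 * \<beta> 0 0"
    unfolding dual_def by blast
  then have "\<beta> 0 0 = 0" by simp
  \<comment> \<open>If \<open>e 0\<close> were 0, then \<open>h\<close> would be 0 and
    \<open>\<beta> 0 h\<close> could not be 2.\<close>
  then have "e 0 \<noteq> 0" using two unfolding h_def by (metis lie_0(2) zero_neq_numeral)
  define ev where "ev y = (SOME a. lie h y = a *\<^sub>C y)" for y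
  have ev: "lie h y = ev y *\<^sub>C y" if "y \<in> eigenvectors h" for y
    unfolding ev_def using that by (intro someI_ex[of "\<lambda>a. lie h y = a *\<^sub>C y"]) simp
  obtain B where B: "B \<subseteq> eigenvectors h" "finite B" "cvec.independent B" "cvec.span B = UNIV"
    "killing h h = (\<Sum>y\<in>B. ev y * ev y)"
    by (rule killing_diagonal[OF diag, of h ev h ev]) (use ev in blast)+
  have span: "x \<in> cvec.span (eigenvectors h)" for x using diag by blast
  have nil: "\<exists>k. (lie (e 0) ^^ k) x = 0" "\<exists>k. (lie (f 0) ^^ k) x = 0" for x
    using locally_nilpotent_lie[OF span he] locally_nilpotent_lie[OF span hf] by auto
  have int: "ev y \<in> \<int>" if "y \<in> B" for y
  proof -
    have "y \<noteq> 0" using that B(3) cvec.dependent_zero by blast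
    have "\<exists>k::int. 2 * ev y = 2 * of_int k"
      by (rule weight_integral[OF h_def[symmetric] he hf nil \<open>y \<noteq> 0\<close> ev])
        (use that B(1) in blast)
    then show ?thesis by auto
  qed
  have "Re (\<Sum>y\<in>B. ev y * ev y) = (\<Sum>y\<in>B. (Re (ev y))\<^sup>2)"
    unfolding Re_sum
  proof (rule sum.cong)
    fix y assume "y \<in> B"
    then obtain k where "ev y = of_int k" using int Ints_cases by metis
    then show "Re (ev y * ev y) = (Re (ev y))\<^sup>2" by (simp add: power2_eq_square)
  qed simp
  then have "(\<Sum>y\<in>B. (Re (ev y))\<^sup>2) = 0" using B(5) K0[of h h] by (metis zero_complex.sel(1))
  then have "Re (ev y) = 0" if "y \<in> B" for y
    using that B(2) by (simp add: sum_nonneg_eq_0_iff)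
  then have "ev y = 0" if "y \<in> B" for y
    using int[OF that] that by (metis Ints_cases Re_complex_of_real of_int_eq_0_iff of_real_0 of_real_of_int_eq)
  then have "lie h y = 0" if "y \<in> B" for y
    using ev[of y] that B(1) by auto
  note zero = this
  have "lie h (e 0) = 0 *\<^sub>C e 0"
  proof (rule clinear_eq_on_span[where S = B and f = "lie h"])
    show "clinear (\<lambda>x::'g. 0 *\<^sub>C x)" by (simp add: clinear_iff)
    show "lie h y = 0 *\<^sub>C y" if "y \<in> B" for y using zero[OF that] by simp
    show "e 0 \<in> cvec.span B" using B(4) by simp
  qed (rule clinear_lie)
  with he \<open>e 0 \<noteq> 0\<close> show False by simp
qed

section \<open>Derivations and joint eigenvectors\<close>

text \<open>In terms of a basis, \<open>f\<close> sends \<open>x\<close> to its list of pairings;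
  nondegeneracy makes it injective, hence onto by dimension, and a preimage of the list of values of
  \<phi> represents \<phi>. Used for the whole algebra and for \<open>t\<close>.\<close>

lemma killing_represents:
  assumes V: "cvec.subspace (V :: 'g::complex_lie_algebra set)"
    and nondeg: "\<And>x. x \<in> V \<Longrightarrow> (\<And>y. y \<in> V \<Longrightarrow> killing x y = 0) \<Longrightarrow> x = 0"
    and \<phi>: "\<And>x y. x \<in> V \<Longrightarrow> y \<in> V \<Longrightarrow> \<phi> (x + y) = \<phi> x + \<phi> y"
      "\<And>a x. x \<in> V \<Longrightarrow> \<phi> (a *\<^sub>C x) = a * \<phi> x"
  shows "\<exists>d\<in>V. \<forall>x\<in>V. killing d x = \<phi> x"
proof -
  obtain B where B: "B \<subseteq> V" "cvec.independent B" "V \<subseteq> cvec.span B"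
    by (rule cvec.maximal_independent_subset)
  have fin: "finite B" by (rule independent_finite[OF B(2)])
  have span: "cvec.span B = V" using B cvec.span_minimal[OF B(1) V] by blast
  define f where "f x = (\<Sum>b\<in>B. killing x b *\<^sub>C b)" for x
  have f: "clinear f"
    by (simp add: clinear_iff f_def killing_add_left killing_scale_left scaleC_add_left sum.distrib
        cvec.scale_sum_right)
  have fV: "f x \<in> V" for x
    unfolding f_def span[symmetric] by (intro cvec.span_sum cvec.span_scale cvec.span_base)
  have coeff: "u b = v b" if "(\<Sum>b\<in>B. u b *\<^sub>C b) = (\<Sum>b\<in>B. v b *\<^sub>C b)" "b \<in> B" for u v b
  proof -
    have "(\<Sum>b\<in>B. (u b - v b) *\<^sub>C b) = 0"
      using that(1) by (simp add: cvec.scale_left_diff_distrib sum_subtractf)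
    then have "u b - v b = 0"
      by (rule cvec.independentD[OF B(2) fin subset_refl, where u = "\<lambda>b. u b - v b", OF _ that(2)])
    then show ?thesis by simp
  qed
  have on_V: "P y" if "y \<in> V" "P 0" "\<And>c b y. b \<in> B \<Longrightarrow> y \<in> V \<Longrightarrow> P y \<Longrightarrow> P (c *\<^sub>C b + y)" for P y
  proof -
    have "y \<in> V \<and> P y"
      using that(1)[folded span]
    proof (induction rule: cvec.span_induct_alt)
      case (step c b y)
      then show ?case using that(3) B(1) V by (meson cvec.subspace_add cvec.subspace_scale subsetD)
    qed (use that V in \<open>simp add: cvec.subspace_0\<close>)
    then show ?thesis ..
  qed
  have inj: "inj_on f (cvec.span B)"
  proof (rule inj_onI)
    fix x y assume xy: "x \<in> cvec.span B" "y \<in> cvec.span B" "f x = f y"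
    have eq: "killing (x - y) b = 0" if "b \<in> B" for b
      using coeff[OF xy(3)[unfolded f_def] that] by (simp add: killing_diff_left)
    have "killing (x - y) z = 0" if "z \<in> V" for z
      using that by (rule on_V) (auto simp: eq killing_add_right killing_scale_right)
    then have "x - y = 0"
      using xy V span by (intro nondeg) (auto intro: cvec.subspace_diff)
    then show "x = y" by simp
  qed
  interpret P: vector_space_pair "scaleC :: complex \<Rightarrow> 'g \<Rightarrow> 'g" "scaleC :: complex \<Rightarrow> 'g \<Rightarrow> 'g"
    by unfold_locales
  have ind: "cvec.independent (f ` B)"
    by (rule P.linear_independent_injective_image[OF f B(2) inj])
  have onto: "V \<subseteq> cvec.span (f ` B)"
  proof
    fix v assume v: "v \<in> V"
    show "v \<in> cvec.span (f ` B)"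
    proof (rule ccontr)
      assume nv: "v \<notin> cvec.span (f ` B)"
      then have "cvec.independent (insert v (f ` B))"
        using ind by (simp add: cvec.independent_insert)
      moreover have "insert v (f ` B) \<subseteq> cvec.span B" using v fV span by blast
      ultimately have "card (insert v (f ` B)) \<le> card B"
        using cvec.independent_span_bound[OF fin] by blast
      moreover have "v \<notin> f ` B" using nv cvec.span_base[of v "f ` B"] by auto
      moreover have "card (f ` B) = card B"
        by (rule card_image[OF inj_on_subset[OF inj cvec.span_superset]])
      ultimately show False using fin by simp
    qed
  qed
  have "(\<Sum>b\<in>B. \<phi> b *\<^sub>C b) \<in> V"
    unfolding span[symmetric] by (intro cvec.span_sum cvec.span_scale cvec.span_base)
  then have "(\<Sum>b\<in>B. \<phi> b *\<^sub>C b) \<in> f ` V"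
    using onto P.linear_span_image[OF f, of B] span by auto
  then obtain d where d: "d \<in> V" "f d = (\<Sum>b\<in>B. \<phi> b *\<^sub>C b)" by auto
  have db: "killing d b = \<phi> b" if "b \<in> B" for b
    using coeff[OF d(2)[unfolded f_def] that] .
  have "\<phi> 0 = 0" using \<phi>(2)[of 0 0] V by (simp add: cvec.subspace_0)
  have "killing d x = \<phi> x" if "x \<in> V" for x
    using that
  proof (rule on_V)
    show "killing d (c *\<^sub>C b + y) = \<phi> (c *\<^sub>C b + y)" if "b \<in> B" "y \<in> V" "killing d y = \<phi> y" for c b y
      using that B(1) \<phi>(1)[of "c *\<^sub>C b" y] \<phi>(2)[of b c] cvec.subspace_scale[OF V, of b c]
      by (auto simp: killing_add_right killing_scale_right db)
  qed (simp add: \<open>\<phi> 0 = 0\<close>)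
  with d show ?thesis by blast
qed

text \<open>Choose \<open>d\<close> so that \<open>E = D - lie d\<close> is trace-orthogonal to
  every \<open>lie x\<close>. As \<open>E\<close> is a derivation, \<open>lie (E x)\<close> is the
  commutator of \<open>E\<close> and \<open>lie x\<close>, and cycling the trace turns the pairing
  of \<open>E x\<close> with \<open>y\<close> into the trace of \<open>E\<close> composed with
  \<open>lie (lie x y)\<close>, which is zero.\<close>

lemma derivation_inner:
  fixes D :: "'g::complex_lie_algebra \<Rightarrow> 'g"
  assumes nondeg: "\<And>x :: 'g. (\<And>y. killing x y = 0) \<Longrightarrow> x = 0"
    and D: "clinear D" and der: "\<And>x y. D (lie x y) = lie (D x) y + lie x (D y)"
  shows "\<exists>d. \<forall>x. D x = lie d x"
proof -
  note lin = clinear_comp[OF D] clinear_comp[OF clinear_lie] clinear_lie clinear_minus D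
  have "\<exists>d\<in>UNIV. \<forall>x\<in>UNIV. killing d x = trace_op (\<lambda>z. D (lie x z))"
  proof (rule killing_represents)
    show "trace_op (\<lambda>z. D (lie (x + y) z)) = trace_op (\<lambda>z. D (lie x z)) + trace_op (\<lambda>z. D (lie y z))" for x y
      unfolding lie_add_left clinear_add[OF D] by (intro trace_op_add lin)
    show "trace_op (\<lambda>z. D (lie (a *\<^sub>C x) z)) = a * trace_op (\<lambda>z. D (lie x z))" for a x
      unfolding lie_scale_left clinear_scale[OF D] by (intro trace_op_cmult lin)
  qed (use nondeg in auto)
  then obtain d where d: "\<And>x. killing d x = trace_op (\<lambda>z. D (lie x z))" by blast
  define E where "E x = D x - lie d x" for x
  have E: "clinear E" unfolding E_def by (intro lin)
  note lin = lin clinear_comp[OF E] E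
  have trE: "trace_op (\<lambda>z. E (lie x z)) = 0" for x
  proof -
    have "trace_op (\<lambda>z. E (lie x z)) = trace_op (\<lambda>z. D (lie x z)) - trace_op (\<lambda>z. lie d (lie x z))"
      unfolding E_def by (intro trace_op_diff lin)
    then show ?thesis using d[of x] by (simp add: killing_def)
  qed
  have Eder: "lie (E x) z = E (lie x z) - lie x (E z)" for x z
    by (simp add: E_def der clinear_diff[OF clinear_lie] clinear_diff[OF clinear_lie_left]
        lie_lie[of d x z])
  have "E x = 0" for x
  proof (rule nondeg)
    fix y
    have "killing (E x) y = trace_op (\<lambda>z. E (lie x (lie y z)) - lie x (E (lie y z)))"
      unfolding killing_def Eder ..
    also have "\<dots> = trace_op (\<lambda>z. E (lie x (lie y z))) - trace_op (\<lambda>z. lie x (E (lie y z)))"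
      by (intro trace_op_diff lin)
    also have "trace_op (\<lambda>z. lie x (E (lie y z))) = trace_op (\<lambda>z. E (lie y (lie x z)))"
      by (rule trace_op_comm[of "lie x" "\<lambda>z. E (lie y z)"]) (intro lin)+
    also have "trace_op (\<lambda>z. E (lie x (lie y z))) - \<dots> =
        trace_op (\<lambda>z. E (lie x (lie y z)) - E (lie y (lie x z)))"
      by (rule trace_op_diff[symmetric]) (intro lin)+
    also have "\<dots> = trace_op (\<lambda>z. E (lie (lie x y) z))"
      by (simp add: lie_lie clinear_diff[OF E])
    finally show "killing (E x) y = 0" using trE by simp
  qed
  then have "D x = lie d x" for x unfolding E_def by simp
  then show ?thesis by blast
qed

text \<open>The joint eigenspace \<open>M\<close> of \<open>F\<close> through \<open>x\<close> is
  preserved by \<open>lie h\<close>, because the operators commute. So the components of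
  \<open>x\<close> for \<open>lie h\<close> stay in \<open>M\<close> and are joint eigenvectors for
  one more element.\<close>

lemma joint_eigenvectors_span:
  fixes L :: "'g::complex_lie_algebra set"
  assumes "finite F" and L: "cvec.subspace L" "\<And>h x. h \<in> F \<Longrightarrow> x \<in> L \<Longrightarrow> lie h x \<in> L"
    and comm: "\<And>h h'. h \<in> F \<Longrightarrow> h' \<in> F \<Longrightarrow> lie h h' = 0"
    and diag: "\<And>h. h \<in> F \<Longrightarrow> L \<subseteq> cvec.span {x \<in> L. \<exists>a. lie h x = a *\<^sub>C x}"
  shows "L \<subseteq> cvec.span {x \<in> L. \<forall>h\<in>F. \<exists>a. lie h x = a *\<^sub>C x}"
  using assms(1) L(2) comm diag
proof (induction rule: finite_induct)
  case empty
  have "{x \<in> L. \<forall>h\<in>{}. \<exists>a. lie h x = a *\<^sub>C x} = L" by simp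
  then show ?case using cvec.span_superset by metis
next
  case (insert h F)
  let ?E = "{x \<in> L. \<forall>h\<in>F. \<exists>a. lie h x = a *\<^sub>C x}"
  let ?E' = "{x \<in> L. \<forall>h\<in>insert h F. \<exists>a. lie h x = a *\<^sub>C x}"
  have "?E \<subseteq> cvec.span ?E'"
  proof
    fix x assume x: "x \<in> ?E"
    then have "\<forall>k\<in>F. \<exists>a. lie k x = a *\<^sub>C x" by blast
    then obtain a where a: "\<And>k. k \<in> F \<Longrightarrow> lie k x = a k *\<^sub>C x" by metis
    define M where "M = {y \<in> L. \<forall>k\<in>F. lie k y = a k *\<^sub>C y}"
    have M: "cvec.subspace M"
      using L(1) unfolding M_def cvec.subspace_def
      by (auto simp: lie_add_right lie_scale_right scaleC_add_right mult.commute)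
    have TM: "lie h y \<in> M" if "y \<in> M" for y
    proof -
      have "lie k (lie h y) = a k *\<^sub>C lie h y" if "k \<in> F" for k
        using \<open>y \<in> M\<close> insert.prems(2)[of k h] that lie_deriv[of k h y]
        by (simp add: M_def lie_scale_right)
      then show ?thesis using \<open>y \<in> M\<close> insert.prems(1) by (simp add: M_def)
    qed
    let ?V = "\<lambda>b. {y \<in> L. lie h y = b *\<^sub>C y}"
    have V: "cvec.subspace (?V b)" for b
      using L(1) unfolding cvec.subspace_def
      by (auto simp: lie_add_right lie_scale_right scaleC_add_right mult.commute)
    have "{y \<in> L. \<exists>b. lie h y = b *\<^sub>C y} = (\<Union>b. ?V b)" by blast
    then have "x \<in> cvec.span (\<Union>b. ?V b)"
      using insert.prems(3)[of h] x by auto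
    from span_UN_decompose[of ?V, OF V this] obtain I f where
      f: "finite I" "\<And>b. f b \<in> ?V b" "x = (\<Sum>b\<in>I. f b)" by blast
    have "f b \<in> M" if "b \<in> I" for b
    proof (rule gen_eigenspace_separate[OF clinear_lie M TM f(1) _ _ that])
      show "f c \<in> gen_eigenspace (lie h) c" for c
        using f(2) by (intro eigenvector_in_gen_eigenspace) simp
      show "(\<Sum>c\<in>I. f c) \<in> M"
        using x a f(3) by (simp add: M_def)
    qed
    then have "f b \<in> ?E'" if "b \<in> I" for b
      using f(2)[of b] that unfolding M_def by blast
    then show "x \<in> cvec.span ?E'"
      unfolding f(3) by (intro cvec.span_sum cvec.span_base) 
  qed
  then have "cvec.span ?E \<subseteq> cvec.span ?E'"
    by (rule cvec.span_minimal) (rule cvec.subspace_span)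
  moreover have "L \<subseteq> cvec.span ?E"
    by (rule insert.IH) (use insert.prems in simp_all)
  ultimately show ?case by (rule subset_trans[rotated])
qed

lemma joint_eigenvectors_span_subspace:
  fixes L :: "'g::complex_lie_algebra set"
  assumes L: "cvec.subspace L" "\<And>h x. h \<in> t \<Longrightarrow> x \<in> L \<Longrightarrow> lie h x \<in> L"
    and comm: "\<And>h h'. h \<in> t \<Longrightarrow> h' \<in> t \<Longrightarrow> lie h h' = 0"
    and diag: "\<And>h. h \<in> t \<Longrightarrow> L \<subseteq> cvec.span {x \<in> L. \<exists>a. lie h x = a *\<^sub>C x}"
  shows "L \<subseteq> cvec.span {x \<in> L. \<forall>h\<in>t. \<exists>a. lie h x = a *\<^sub>C x}"
proof -
  obtain F where F: "F \<subseteq> t" "cvec.independent F" "t \<subseteq> cvec.span F"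
    by (rule cvec.maximal_independent_subset)
  have "L \<subseteq> cvec.span {x \<in> L. \<forall>h\<in>F. \<exists>a. lie h x = a *\<^sub>C x}"
    by (rule joint_eigenvectors_span[OF independent_finite[OF F(2)] L(1)])
      (use F(1) L(2) comm diag in \<open>simp_all add: subset_iff\<close>)
  also have "{x \<in> L. \<forall>h\<in>F. \<exists>a. lie h x = a *\<^sub>C x} \<subseteq> {x \<in> L. \<forall>h\<in>t. \<exists>a. lie h x = a *\<^sub>C x}"
  proof safe
    fix x h assume x: "\<forall>h\<in>F. \<exists>a. lie h x = a *\<^sub>C x" and "h \<in> t"
    then have "h \<in> cvec.span F" using F by blast
    then show "\<exists>a. lie h x = a *\<^sub>C x"
    proof (induction rule: cvec.span_induct_alt)
      case base
      show ?case by (intro exI[of _ 0]) simp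
    next
      case (step c h y)
      then obtain a b where "lie h x = a *\<^sub>C x" "lie y x = b *\<^sub>C x" using x by blast
      then have "lie (c *\<^sub>C h + y) x = (c * a + b) *\<^sub>C x"
        by (simp add: lie_add_left lie_scale_left scaleC_add_left)
      then show ?case by blast
    qed
  qed
  then have "cvec.span {x \<in> L. \<forall>h\<in>F. \<exists>a. lie h x = a *\<^sub>C x} \<subseteq>
      cvec.span {x \<in> L. \<forall>h\<in>t. \<exists>a. lie h x = a *\<^sub>C x}"
    by (rule cvec.span_mono)
  finally show ?thesis .
qed

text \<open>The sum of the exponents over a finite basis serves as a common exponent. A uniform
  exponent is what \<open>trace_op_nilpotent\<close> asks for.\<close>

lemma locally_nilpotent_imp_nilpotent:
  fixes F :: "'g::complex_lie_algebra \<Rightarrow> 'g"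
  assumes F: "clinear F" and nil: "\<And>x. x \<in> E \<Longrightarrow> \<exists>k. (F ^^ k) x = 0"
    and E: "cvec.span E = UNIV"
  shows "\<exists>k. \<forall>x. (F ^^ k) x = 0"
proof -
  obtain B where B: "B \<subseteq> E" "cvec.independent B" "cvec.span B = UNIV" "finite B"
    by (rule basis_within[of E]) (use E in auto)
  have lin: "clinear (F ^^ k)" for k by (intro clinear_funpow F)
  have mono: "(F ^^ (j + k)) x = 0" if "(F ^^ k) x = 0" for j k x
    by (simp only: funpow_add comp_apply that clinear_0[OF lin])
  have "\<forall>b\<in>B. \<exists>k. (F ^^ k) b = 0" using nil B(1) by blast
  then obtain k where k: "\<And>b. b \<in> B \<Longrightarrow> (F ^^ k b) b = 0" by metis
  have "(F ^^ (\<Sum>b\<in>B. k b)) b = 0" if "b \<in> B" for b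
  proof -
    have "(\<Sum>b\<in>B. k b) = (\<Sum>b\<in>B - {b}. k b) + k b"
      using that B(4) by (simp add: sum.remove[of B b])
    then show ?thesis using mono[OF k[OF that]] by simp
  qed
  note zero = this
  have "(F ^^ (\<Sum>b\<in>B. k b)) x = 0 *\<^sub>C x" for x
    by (rule clinear_eq_on_span[OF lin, where S = B and g = "\<lambda>x. 0 *\<^sub>C x"])
      (simp_all add: zero B(3) clinear_iff)
  then show ?thesis by (intro exI[of _ "\<Sum>b\<in>B. k b"]) simp
qed

section \<open>Cartan subalgebras of the fixed algebra\<close>

locale twisted_cartan =
  fixes \<nu> :: "'g::complex_lie_algebra \<Rightarrow> 'g" and n :: nat and t :: "'g set"
  assumes simple: "simple_lie_algebra TYPE('g)"
    and nu: "diagram_automorphism \<nu> n"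
    and cartan: "cartan_subalgebra (eigenspace \<nu> n 0) t"
begin

lemma nondegenerate:
  fixes x :: 'g
  assumes "\<And>y. killing x y = 0"
  shows "x = 0"
  using killing_nondegenerate[OF simple nu assms] .

lemma center_trivial:
  fixes x :: 'g
  assumes "\<And>y. lie x y = 0"
  shows "x = 0"
proof (rule nondegenerate)
  show "killing x y = 0" for y
    unfolding killing_def
    by (rule trace_op_nilpotent[OF clinear_lie2, where k = 1]) (simp add: assms)
qed

lemma automorphism: "lie_automorphism \<nu>"
  and linear_nu: "clinear \<nu>" and nu_lie: "\<nu> (lie x y) = lie (\<nu> x) (\<nu> y)" and bij_nu: "bij \<nu>"
  and n_pos: "n > 0" and nu_pow: "(\<nu> ^^ n) x = x"
  using nu by (auto simp: diagram_automorphism_def lie_automorphism_def has_order_def)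

lemma nu_pow_lie: "(\<nu> ^^ k) (lie x y) = lie ((\<nu> ^^ k) x) ((\<nu> ^^ k) y)"
  by (induction k) (auto simp: nu_lie)

lemma nu_pow_killing: "killing ((\<nu> ^^ k) x) ((\<nu> ^^ k) y) = killing x y"
  by (induction k) (auto simp: killing_automorphism[OF automorphism])

section \<open>The cyclic grading defined by \<open>\<nu>\<close>\<close>

definition unit_root :: "int \<Rightarrow> complex" where
  "unit_root j = exp (2 * of_real pi * \<i> * of_int j / of_nat n)"

lemma eigenspace_iff: "x \<in> eigenspace \<nu> n j \<longleftrightarrow> \<nu> x = unit_root j *\<^sub>C x"
  by (simp add: eigenspace_def unit_root_def)

lemma unit_root_add: "unit_root (i + j) = unit_root i * unit_root j"
  by (simp add: unit_root_def exp_add[symmetric] ring_distribs add_divide_distrib)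

lemma unit_root_0 [simp]: "unit_root 0 = 1"
  by (simp add: unit_root_def)

lemma unit_root_pow: "unit_root j ^ n = 1"
proof -
  have "unit_root j ^ n = exp (2 * of_int j * of_real pi * \<i>)"
    unfolding unit_root_def exp_of_nat_mult[symmetric] using n_pos by (simp add: field_simps)
  also have "\<dots> = 1"
    using exp_integer_2pi[of "of_int j"] by (simp add: mult_ac)
  finally show ?thesis .
qed

lemma eigenspace_lie:
  "x \<in> eigenspace \<nu> n i \<Longrightarrow> y \<in> eigenspace \<nu> n j \<Longrightarrow> lie x y \<in> eigenspace \<nu> n (i + j)"
  by (simp add: eigenspace_iff nu_lie lie_scale_left lie_scale_right unit_root_add mult.commute)

lemma subspace_eigenspace: "cvec.subspace (eigenspace \<nu> n j)"
  unfolding cvec.subspace_def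
  by (auto simp: eigenspace_iff clinear_rules[OF linear_nu] scaleC_add_right mult.commute)

text \<open>Average over the cyclic group generated by \<open>\<nu>\<close>, weighted by a
  character: the projection onto the eigenspace of index \<open>j\<close>.\<close>

definition proj :: "int \<Rightarrow> 'g \<Rightarrow> 'g" where
  "proj j x = (1 / of_nat n) *\<^sub>C (\<Sum>k<n. unit_root (- j) ^ k *\<^sub>C (\<nu> ^^ k) x)"

lemma proj_eigenspace: "proj j x \<in> eigenspace \<nu> n j"
proof -
  let ?c = "unit_root (- j)" and ?g = "\<lambda>k. unit_root (- j) ^ k *\<^sub>C (\<nu> ^^ k) x"
  have c: "unit_root j * ?c = 1" by (simp add: unit_root_add[symmetric])
  have "(\<Sum>k<n. ?g (Suc k)) = (\<Sum>k<n. ?g k)"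
  proof -
    have "(\<Sum>k<Suc n. ?g k) = ?g 0 + (\<Sum>k<n. ?g (Suc k))" by (rule sum.lessThan_Suc_shift)
    moreover have "?g n = ?g 0" by (simp add: unit_root_pow nu_pow)
    ultimately show ?thesis by simp
  qed
  moreover have "\<nu> (?g k) = unit_root j *\<^sub>C ?g (Suc k)" for k
  proof -
    have "unit_root j * (?c * ?c ^ k) = ?c ^ k"
      using c by (simp only: mult.assoc[symmetric]) simp
    then show ?thesis by (simp add: clinear_rules[OF linear_nu])
  qed
  ultimately have "\<nu> (\<Sum>k<n. ?g k) = unit_root j *\<^sub>C (\<Sum>k<n. ?g k)"
    by (simp only: clinear_sum[OF linear_nu] cvec.scale_sum_right[symmetric])
  then show ?thesis
    by (simp add: eigenspace_iff proj_def clinear_scale[OF linear_nu])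
qed

text \<open>By invariance of the form under \<open>\<nu>\<close>, every term of the average has the
  same pairing with \<open>y\<close>. Thus a vector pairing nontrivially with \<open>y\<close> can
  be moved into the opposite eigenspace.\<close>

lemma killing_proj:
  assumes "y \<in> eigenspace \<nu> n (- j)"
  shows "killing y (proj j x) = killing y x"
proof -
  have y: "(\<nu> ^^ k) y = unit_root (- j) ^ k *\<^sub>C y" for k
    by (induction k) (use assms in \<open>simp_all add: eigenspace_iff clinear_rules[OF linear_nu] mult.commute\<close>)
  have "unit_root (- j) ^ k * killing y ((\<nu> ^^ k) x) = killing y x" for k
    using nu_pow_killing[of k y x] by (simp add: y killing_scale_left)
  then show ?thesis
    using n_pos by (simp add: proj_def killing_scale_right killing_sum_right)
qed

lemma lie_proj:
  assumes "h \<in> eigenspace \<nu> n 0"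
  shows "lie h (proj j x) = proj j (lie h x)"
proof -
  have "(\<nu> ^^ k) h = h" for k
    by (induction k) (use assms in \<open>simp_all add: eigenspace_iff\<close>)
  then show ?thesis
    by (simp add: proj_def clinear_rules[OF clinear_lie] nu_pow_lie)
qed

lemma proj_scale: "proj j (a *\<^sub>C x) = a *\<^sub>C proj j x"
  by (simp add: proj_def clinear_scale[OF clinear_funpow[OF linear_nu]] cvec.scale_sum_right mult_ac)

section \<open>Diagonalisability of \<open>t\<close> on the whole algebra\<close>

lemma t_subset: "t \<subseteq> eigenspace \<nu> n 0" and subspace_t: "cvec.subspace t"
  and t_abelian: "h \<in> t \<Longrightarrow> h' \<in> t \<Longrightarrow> lie h h' = 0"
  and t_centralizer: "x \<in> eigenspace \<nu> n 0 \<Longrightarrow> (\<And>h. h \<in> t \<Longrightarrow> lie h x = 0) \<Longrightarrow> x \<in> t"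
  and t_diagonal: "h \<in> t \<Longrightarrow> eigenspace \<nu> n 0 \<subseteq>
    cvec.span {x \<in> eigenspace \<nu> n 0. \<exists>a. lie h x = a *\<^sub>C x}"
  using cartan by (auto simp: cartan_subalgebra_def)

lemma joint_span_fixed:
  "eigenspace \<nu> n 0 \<subseteq> cvec.span {x \<in> eigenspace \<nu> n 0. \<forall>h\<in>t. \<exists>a. lie h x = a *\<^sub>C x}"
proof (rule joint_eigenvectors_span_subspace[OF subspace_eigenspace _ t_abelian t_diagonal])
  show "lie h x \<in> eigenspace \<nu> n 0" if "h \<in> t" "x \<in> eigenspace \<nu> n 0" for h x
    using eigenspace_lie[of h 0 x 0] that t_subset by auto
qed

lemma killing_nonzero_on_span:
  assumes "x \<in> cvec.span E" "killing h x \<noteq> 0"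
  shows "\<exists>z\<in>E. killing h z \<noteq> 0"
proof (rule ccontr)
  assume "\<not> ?thesis"
  then have E: "killing h z = 0" if "z \<in> E" for z using that by blast
  have "killing h x = 0"
    using assms(1)
    by (induction rule: cvec.span_induct_alt) (simp_all add: killing_add_right killing_scale_right E)
  with assms(2) show False by simp
qed

text \<open>A partner of \<open>h\<close> may be projected to the fixed algebra and then taken to be
  a joint eigenvector \<open>z\<close>. Since \<open>h\<close> commutes with \<open>t\<close>,
  invariance forces the weight of \<open>z\<close> to be 0, so \<open>z\<close> lies in
  \<open>t\<close>.\<close>

lemma nondegenerate_t:
  assumes h: "h \<in> t" and orth: "\<And>y. y \<in> t \<Longrightarrow> killing h y = 0"
  shows "h = 0"
proof (rule ccontr)
  assume "h \<noteq> 0"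
  then obtain y where "killing h y \<noteq> 0" using nondegenerate by blast
  then have "killing h (proj 0 y) \<noteq> 0"
    using killing_proj[of h 0 y] h t_subset by auto
  then obtain z where z: "z \<in> eigenspace \<nu> n 0" "\<forall>h\<in>t. \<exists>a. lie h z = a *\<^sub>C z" "killing h z \<noteq> 0"
    using killing_nonzero_on_span[of "proj 0 y"] joint_span_fixed proj_eigenspace[of 0 y] by blast
  have "lie h' z = 0" if h': "h' \<in> t" for h'
  proof -
    obtain a where a: "lie h' z = a *\<^sub>C z" using z(2) h' by blast
    have "killing (lie h' h) z = - killing h (lie h' z)" by (rule killing_skew)
    then have "a * killing h z = 0" using t_abelian[OF h' h] by (simp add: a killing_scale_right)
    with z(3) a show ?thesis by simp
  qed
  then have "z \<in> t" by (rule t_centralizer[OF z(1)])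
  with orth z(3) show False by simp
qed

text \<open>The semisimple part of \<open>lie h\<close> is a derivation, hence of the form \<open>lie s\<close>; it agrees with
  \<open>lie h\<close> on the fixed algebra, so that \<open>h - s\<close> is an element of \<open>t\<close> which is orthogonal to \<open>t\<close>
  because \<open>lie (h - s)\<close> is nilpotent.\<close>

lemma semisimple_t:
  assumes h: "h \<in> t"
  shows "UNIV \<subseteq> cvec.span (eigenvectors h)"
proof -
  let ?G = "gen_eigenspace (lie h)"
  note span = span_gen_eigenspaces[OF clinear_lie, of h]
  note sub = subspace_gen_eigenspace[OF clinear_lie, of h]
  obtain S where S: "clinear S" "\<And>a x. x \<in> ?G a \<Longrightarrow> S x = a *\<^sub>C x"
    by (rule semisimple_part[OF clinear_lie, of h]) blast
  \<comment> \<open>\<open>lie h\<close> is a derivation, so brackets add eigenvalues; the two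
    nested inductions replace the binomial formula for powers of the shifted operator.\<close>
  have lieG: "lie x y \<in> ?G (a + b)" if x: "x \<in> ?G a" and y: "y \<in> ?G b" for x y a b
    using x y
  proof (induction arbitrary: y rule: gen_eigenspace_induct)
    case zero
    then show ?case using sub by (simp add: cvec.subspace_0)
  next
    case (step x)
    from step.prems show ?case
    proof (induction rule: gen_eigenspace_induct)
      case zero
      then show ?case using sub by (simp add: cvec.subspace_0)
    next
      case inner: (step y)
      have "lie h (lie x y) - (a + b) *\<^sub>C lie x y =
          lie (lie h x - a *\<^sub>C x) y + lie x (lie h y - b *\<^sub>C y)"
        using lie_deriv[of h x y]
        by (simp add: clinear_diff[OF clinear_lie] clinear_diff[OF clinear_lie_left]
            lie_scale_left lie_scale_right scaleC_add_left)
      also have "\<dots> \<in> ?G (a + b)"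
        by (rule cvec.subspace_add[OF sub step.IH[OF inner.hyps(1)] inner.IH])
      finally show ?case by (rule gen_eigenspace_step)
    qed
  qed
  have der: "S (lie x y) = lie (S x) y + lie x (S y)" for x y
  proof -
    have 1: "S (lie x y) = lie (S x) y + lie x (S y)" if "x \<in> ?G a" for x y a
    proof (rule clinear_eq_on_span[where S = "\<Union>b. ?G b" and f = "\<lambda>y. S (lie x y)"])
      show "clinear (\<lambda>y. S (lie x y))" "clinear (\<lambda>y. lie (S x) y + lie x (S y))"
        by (intro clinear_plus clinear_comp[OF S(1)] clinear_comp[OF clinear_lie] clinear_lie S)+
      show "S (lie x y) = lie (S x) y + lie x (S y)" if y: "y \<in> (\<Union>b. ?G b)" for y
      proof -
        obtain b where "y \<in> ?G b" using y by blast
        then show ?thesis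
          using S(2)[OF lieG[OF \<open>x \<in> ?G a\<close>]] S(2)[OF \<open>x \<in> ?G a\<close>] S(2)[of y b]
          by (simp add: lie_scale_left lie_scale_right scaleC_add_left)
      qed
    qed (simp add: span)
    show ?thesis
    proof (rule clinear_eq_on_span[where S = "\<Union>b. ?G b" and f = "\<lambda>x. S (lie x y)"])
      show "clinear (\<lambda>x. S (lie x y))" "clinear (\<lambda>x. lie (S x) y + lie x (S y))"
        using S(1) by (simp_all add: clinear_iff lie_add_left lie_scale_left lie_add_right scaleC_add_right)
    qed (use 1 span in auto)
  qed
  obtain s where s: "\<And>x. S x = lie s x"
    using derivation_inner[OF nondegenerate S(1) der] by blast
  have h0: "h \<in> eigenspace \<nu> n 0" using h t_subset by blast
  then have nuh: "\<nu> h = h" by (simp add: eigenspace_iff)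
  \<comment> \<open>As \<open>\<nu>\<close> fixes \<open>h\<close>, it preserves these spaces and so
    commutes with \<open>S\<close>; the trivial centre then shows that \<open>\<nu>\<close> fixes
    \<open>s\<close>.\<close>
  have nuG: "\<nu> x \<in> ?G a" if "x \<in> ?G a" for x a
    using that
  proof (induction rule: gen_eigenspace_induct)
    case zero
    then show ?case using sub by (simp add: clinear_0[OF linear_nu] cvec.subspace_0)
  next
    case (step x)
    have "lie h (\<nu> x) - a *\<^sub>C \<nu> x = \<nu> (lie h x - a *\<^sub>C x)"
      by (simp add: clinear_rules[OF linear_nu] nu_lie nuh)
    then have "lie h (\<nu> x) - a *\<^sub>C \<nu> x \<in> ?G a" using step.IH by (simp only:)
    then show ?case by (rule gen_eigenspace_step)
  qed
  have Snu: "S (\<nu> x) = \<nu> (S x)" for x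
  proof (rule clinear_eq_on_span[where S = "\<Union>b. ?G b" and f = "\<lambda>x. S (\<nu> x)"])
    show "clinear (\<lambda>x. S (\<nu> x))" "clinear (\<lambda>x. \<nu> (S x))"
      by (rule clinear_comp[OF S(1) linear_nu], rule clinear_comp[OF linear_nu S(1)])
    show "S (\<nu> x) = \<nu> (S x)" if "x \<in> (\<Union>b. ?G b)" for x
      using that S(2) nuG by (auto simp: clinear_scale[OF linear_nu])
  qed (simp add: span)
  have "lie (\<nu> s - s) z = 0" for z
  proof -
    obtain y where "z = \<nu> y" using bij_nu by (metis bij_pointE)
    then show ?thesis
      using Snu[of y] by (simp add: s nu_lie clinear_diff[OF clinear_lie_left])
  qed
  then have "\<nu> s - s = 0" by (rule center_trivial)
  then have s0: "s \<in> eigenspace \<nu> n 0" by (simp add: eigenspace_iff)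
  define z where "z = h - s"
  have z0: "z \<in> eigenspace \<nu> n 0"
    unfolding z_def by (rule cvec.subspace_diff[OF subspace_eigenspace h0 s0])
  have zx: "lie z x = 0" if "x \<in> eigenspace \<nu> n 0" for x
  proof -
    have "lie z x = 0 *\<^sub>C x"
    proof (rule clinear_eq_on_span[OF clinear_lie, where g = "\<lambda>x. 0 *\<^sub>C x"])
      show "x \<in> cvec.span {x \<in> eigenspace \<nu> n 0. \<exists>a. lie h x = a *\<^sub>C x}"
        using t_diagonal[OF h] that by blast
      show "clinear (\<lambda>x::'g. 0 *\<^sub>C x)" by (simp add: clinear_iff)
      show "lie z x = 0 *\<^sub>C x" if x: "x \<in> {x \<in> eigenspace \<nu> n 0. \<exists>a. lie h x = a *\<^sub>C x}" for x
      proof -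
        obtain a where a: "lie h x = a *\<^sub>C x" using x by blast
        then have "S x = a *\<^sub>C x" by (intro S(2) eigenvector_in_gen_eigenspace)
        with a show ?thesis by (simp add: z_def clinear_diff[OF clinear_lie_left] s)
      qed
    qed
    then show ?thesis by simp
  qed
  have "z \<in> t"
    by (rule t_centralizer[OF z0]) (use zx t_subset lie_anti[of z] in auto)
  have "z = 0"
  proof (rule nondegenerate_t[OF \<open>z \<in> t\<close>])
    fix y assume y: "y \<in> t"
    have "\<exists>k. \<forall>x. (lie z ^^ k) x = 0"
    proof (rule locally_nilpotent_imp_nilpotent[OF clinear_lie _ span])
      fix x assume "x \<in> (\<Union>a. ?G a)"
      then obtain a where a: "x \<in> ?G a" by blast
      then show "\<exists>k. (lie z ^^ k) x = 0"
      proof (induction rule: gen_eigenspace_induct)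
        case zero
        show ?case by (intro exI[of _ 0]) simp
      next
        case (step x)
        have "lie z x = lie h x - a *\<^sub>C x"
          using S(2)[OF step.hyps(1)] by (simp add: z_def clinear_diff[OF clinear_lie_left] s)
        then obtain k where "(lie z ^^ k) (lie z x) = 0" using step.IH by auto
        then have "(lie z ^^ Suc k) x = 0" by (simp add: funpow_Suc_right del: funpow.simps)
        then show ?case by blast
      qed
    qed
    then obtain k where k: "\<And>x. (lie z ^^ k) x = 0" by blast
    have comm: "lie z (lie y x) = lie y (lie z x)" for x
      using lie_deriv[of z y x] t_abelian[OF \<open>z \<in> t\<close> y] by simp
    have comm': "lie z ((lie y ^^ j) x) = (lie y ^^ j) (lie z x)" for j x
      by (induction j) (simp_all add: comm)
    \<comment> \<open>Both elements lie in the abelian \<open>t\<close>, so their operators commute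
      and a power of the product contains a power of \<open>lie z\<close>, which vanishes.\<close>
    have "((\<lambda>w. lie z (lie y w)) ^^ j) x = (lie y ^^ j) ((lie z ^^ j) x)" for j x
      by (induction j) (simp_all add: comm comm')
    then have "((\<lambda>w. lie z (lie y w)) ^^ k) x = 0" for x
      by (simp add: k clinear_0[OF clinear_funpow[OF clinear_lie]])
    then show "killing z y = 0"
      unfolding killing_def by (rule trace_op_nilpotent[OF clinear_lie2])
  qed
  then have "lie h x = S x" for x by (simp add: z_def s)
  then have "?G a \<subseteq> eigenvectors h" for a using S(2)[of _ a] by auto
  then have "(\<Union>a. ?G a) \<subseteq> eigenvectors h" by blast
  from cvec.span_mono[OF this] span show ?thesis by simp
qed

definition joint_eigenvectors :: "'g set" where
  "joint_eigenvectors = {x. \<forall>h\<in>t. \<exists>a. lie h x = a *\<^sub>C x}"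

lemma joint_span: "UNIV \<subseteq> cvec.span joint_eigenvectors"
proof -
  have "(UNIV :: 'g set) \<subseteq> cvec.span {x \<in> UNIV. \<forall>h\<in>t. \<exists>a. lie h x = a *\<^sub>C x}"
    by (rule joint_eigenvectors_span_subspace) (use t_abelian semisimple_t in auto)
  then show ?thesis by (simp add: joint_eigenvectors_def)
qed

section \<open>Roots\<close>

lemma hvec_in: "\<alpha> \<in> dual t \<Longrightarrow> hvec t \<alpha> \<in> t"
  and killing_hvec: "\<alpha> \<in> dual t \<Longrightarrow> h \<in> t \<Longrightarrow> killing (hvec t \<alpha>) h = \<alpha> h"
proof -
  assume \<alpha>: "\<alpha> \<in> dual t"
  have "\<exists>d\<in>t. \<forall>x\<in>t. killing d x = \<alpha> x"
    by (rule killing_represents[OF subspace_t nondegenerate_t])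
      (use \<alpha> in \<open>auto simp: dual_def\<close>)
  then obtain d where d: "d \<in> t" "\<And>x. x \<in> t \<Longrightarrow> \<alpha> x = killing d x" by auto
  have "hvec t \<alpha> \<in> t \<and> (\<forall>x\<in>t. \<alpha> x = killing (hvec t \<alpha>) x)"
    unfolding hvec_def
  proof (rule theI[of "\<lambda>h. h \<in> t \<and> (\<forall>x\<in>t. \<alpha> x = killing h x)"])
    show "d \<in> t \<and> (\<forall>x\<in>t. \<alpha> x = killing d x)" using d by simp
    fix h assume h: "h \<in> t \<and> (\<forall>x\<in>t. \<alpha> x = killing h x)"
    have "h - d = 0"
      by (rule nondegenerate_t) (use h d subspace_t in \<open>auto simp: cvec.subspace_diff killing_diff_left\<close>)
    then show "h = d" by simp
  qed
  then show "hvec t \<alpha> \<in> t" "h \<in> t \<Longrightarrow> killing (hvec t \<alpha>) h = \<alpha> h" by auto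
qed

text \<open>Elements of \<open>Rbar\<close> with nonzero first component: the pairs
  \<open>(0, j)\<close>, the imaginary roots, have no strings.\<close>

definition affine_root :: "('g \<Rightarrow> complex) \<Rightarrow> int \<Rightarrow> bool" where
  "affine_root \<alpha> j \<longleftrightarrow> \<alpha> \<in> dual t \<and> \<alpha> \<noteq> (\<lambda>h. 0) \<and> gspace \<nu> n t (\<alpha>, j) \<noteq> {0}"

lemma weight_space_nonzero:
  assumes "cvec.subspace L" "weight_space L t \<alpha> \<noteq> {0}"
  obtains x where "x \<in> weight_space L t \<alpha>" "x \<noteq> 0"
proof -
  have "0 \<in> weight_space L t \<alpha>"
    using assms(1) by (simp add: weight_space_def cvec.subspace_0)
  with assms(2) that show thesis by blast
qed

lemma affine_root_vector:
  assumes "affine_root \<alpha> j"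
  obtains e where "e \<in> eigenspace \<nu> n j" "\<And>h. h \<in> t \<Longrightarrow> lie h e = \<alpha> h *\<^sub>C e" "e \<noteq> 0"
proof -
  obtain x where "x \<in> weight_space (eigenspace \<nu> n j) t \<alpha>" "x \<noteq> 0"
    by (rule weight_space_nonzero[OF subspace_eigenspace])
      (use assms in \<open>auto simp: affine_root_def gspace_def\<close>)
  then show thesis by (intro that[of x]) (auto simp: weight_space_def)
qed

text \<open>Some joint eigenvector \<open>z\<close> pairs nontrivially with \<open>e\<close>, and
  invariance leaves \<open>- \<alpha>\<close> as its only possible weight. Once
  \<open>killing e f = 1\<close>, the bracket commutes with \<open>t\<close>, so it lies in
  \<open>t\<close>, and there it pairs like \<alpha>.\<close>

lemma opposite_root_vector:
  assumes \<alpha>: "\<alpha> \<in> dual t" and e: "e \<in> eigenspace \<nu> n j" "\<And>h. h \<in> t \<Longrightarrow> lie h e = \<alpha> h *\<^sub>C e" "e \<noteq> 0"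
  shows "\<exists>f. f \<in> eigenspace \<nu> n (- j) \<and> (\<forall>h\<in>t. lie h f = (- \<alpha> h) *\<^sub>C f) \<and>
    lie e f = hvec t \<alpha>"
proof -
  obtain y where "killing e y \<noteq> 0" using nondegenerate[of e] e(3) by blast
  then obtain z where z: "z \<in> joint_eigenvectors" "killing e z \<noteq> 0"
    using killing_nonzero_on_span[of y joint_eigenvectors e] joint_span by auto
  have hz: "lie h z = (- \<alpha> h) *\<^sub>C z" if "h \<in> t" for h
  proof -
    obtain a where a: "lie h z = a *\<^sub>C z" using z(1) \<open>h \<in> t\<close> by (auto simp: joint_eigenvectors_def)
    have "killing (lie h e) z = - killing e (lie h z)" by (rule killing_skew)
    then have "\<alpha> h * killing e z = - a * killing e z"
      by (simp add: a e(2)[OF that] killing_scale_left killing_scale_right)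
    then have "(a + \<alpha> h) * killing e z = 0" by (simp add: distrib_right)
    then have "a = - \<alpha> h" using z(2) by (simp add: eq_neg_iff_add_eq_0)
    with a show ?thesis by simp
  qed
  \<comment> \<open>The projection keeps the weight, since \<open>\<nu>\<close> fixes
    \<open>t\<close>, and keeps the pairing with \<open>e\<close>; the factor normalises that
    pairing to 1.\<close>
  define f where "f = (1 / killing e z) *\<^sub>C proj (- j) z"
  have f0: "f \<in> eigenspace \<nu> n (- j)"
    unfolding f_def by (intro cvec.subspace_scale[OF subspace_eigenspace] proj_eigenspace)
  have hf: "lie h f = (- \<alpha> h) *\<^sub>C f" if "h \<in> t" for h
  proof -
    have "lie h f = (1 / killing e z) *\<^sub>C proj (- j) (lie h z)"
      using that t_subset by (simp add: f_def lie_scale_right lie_proj subset_iff)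
    also have "\<dots> = (- \<alpha> h) *\<^sub>C f"
      unfolding hz[OF that] proj_scale f_def by (simp add: mult.commute)
    finally show ?thesis .
  qed
  have Kf: "killing e f = 1"
    using killing_proj[of e "- j" z] e(1) z(2) by (simp add: f_def killing_scale_right)
  have ef: "lie e f \<in> t"
  proof (rule t_centralizer)
    show "lie e f \<in> eigenspace \<nu> n 0" using eigenspace_lie[OF e(1) f0] by simp
    show "lie h (lie e f) = 0" if "h \<in> t" for h
      using weight_lie[OF e(2) hf, of h] that by simp
  qed
  have "lie e f - hvec t \<alpha> = 0"
  proof (rule nondegenerate_t)
    show "lie e f - hvec t \<alpha> \<in> t" by (rule cvec.subspace_diff[OF subspace_t ef hvec_in[OF \<alpha>]])
    fix h assume h: "h \<in> t"
    have "killing (lie e f) h = - killing e (lie h f)"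
      by (simp add: killing_invariant lie_anti[of h f] killing_minus_right)
    also have "\<dots> = \<alpha> h" using Kf by (simp add: hf[OF h] killing_minus_right killing_scale_right)
    finally show "killing (lie e f - hvec t \<alpha>) h = 0"
      by (simp add: killing_diff_left killing_hvec[OF \<alpha> h])
  qed
  then have "lie e f = hvec t \<alpha>" by simp
  with f0 hf show ?thesis by blast
qed

lemma root_locally_nilpotent:
  assumes "h \<in> t" "c \<noteq> 0" "lie h e = c *\<^sub>C e"
  shows "\<exists>k. (lie e ^^ k) x = 0"
  using locally_nilpotent_lie[OF _ assms(3,2)] semisimple_t[OF assms(1)] by blast

lemma dual_nonzero:
  assumes "\<alpha> \<in> dual t" "\<alpha> \<noteq> (\<lambda>h. 0)"
  obtains h where "h \<in> t" "\<alpha> h \<noteq> 0"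
proof -
  obtain h where "\<alpha> h \<noteq> 0" using assms(2) by blast
  moreover from this have "h \<in> t" using assms(1) unfolding dual_def by blast
  ultimately show thesis using that by blast
qed

text \<open>Stated without dividing by \<open>\<alpha> (hvec t \<alpha>)\<close>, because it must
  apply before this number is known to be nonzero.\<close>

lemma root_string_integral:
  assumes \<alpha>: "affine_root \<alpha> j" and x: "x \<noteq> 0" "lie (hvec t \<alpha>) x = b *\<^sub>C x"
  shows "\<exists>k::int. 2 * b = \<alpha> (hvec t \<alpha>) * of_int k"
proof -
  have dual: "\<alpha> \<in> dual t" "\<alpha> \<noteq> (\<lambda>h. 0)" using \<alpha> by (auto simp: affine_root_def)
  obtain e where e: "e \<in> eigenspace \<nu> n j" "\<And>h. h \<in> t \<Longrightarrow> lie h e = \<alpha> h *\<^sub>C e" "e \<noteq> 0"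
    by (rule affine_root_vector[OF \<alpha>]) blast
  obtain f where f: "f \<in> eigenspace \<nu> n (- j)" "\<And>h. h \<in> t \<Longrightarrow> lie h f = (- \<alpha> h) *\<^sub>C f"
    "lie e f = hvec t \<alpha>"
    using opposite_root_vector[OF dual(1) e] by blast
  \<comment> \<open>Nilpotency is read off from a separate \<open>h\<close>, since \<alpha> might
    still vanish on \<open>hvec t \<alpha>\<close>.\<close>
  obtain h where h: "h \<in> t" "\<alpha> h \<noteq> 0" by (rule dual_nonzero[OF dual])
  have nil: "\<exists>k. (lie e ^^ k) y = 0" "\<exists>k. (lie f ^^ k) y = 0" for y
    using root_locally_nilpotent[OF h(1) _ e(2)] root_locally_nilpotent[OF h(1) _ f(2)] h by auto
  show ?thesis
    by (rule weight_integral[OF f(3) e(2) f(2) nil x]) (rule hvec_in[OF dual(1)])+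
qed

text \<open>In the Heisenberg case every eigenvalue of the diagonalisable operator
  \<open>lie (hvec t \<alpha>)\<close> is 0. Then \<open>hvec t \<alpha>\<close> is central, hence
  0, and \<alpha> would vanish on \<open>t\<close>.\<close>

lemma root_norm_nonzero:
  assumes \<alpha>: "affine_root \<alpha> j"
  shows "\<alpha> (hvec t \<alpha>) \<noteq> 0"
proof
  assume 0: "\<alpha> (hvec t \<alpha>) = 0"
  have dual: "\<alpha> \<in> dual t" "\<alpha> \<noteq> (\<lambda>h. 0)" using \<alpha> by (auto simp: affine_root_def)
  have "hvec t \<alpha> = 0"
  proof (rule center_trivial)
    fix y
    have "lie (hvec t \<alpha>) y = 0 *\<^sub>C y"
    proof (rule clinear_eq_on_span[OF clinear_lie, where g = "\<lambda>x. 0 *\<^sub>C x"])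
      show "y \<in> cvec.span (eigenvectors (hvec t \<alpha>))"
        using semisimple_t[OF hvec_in[OF dual(1)]] by blast
      show "clinear (\<lambda>x::'g. 0 *\<^sub>C x)" by (simp add: clinear_iff)
      show "lie (hvec t \<alpha>) x = 0 *\<^sub>C x" if x: "x \<in> eigenvectors (hvec t \<alpha>)" for x
      proof (cases "x = 0")
        case False
        obtain b where b: "lie (hvec t \<alpha>) x = b *\<^sub>C x" using x by blast
        then have "b = 0" using root_string_integral[OF \<alpha> False b] 0 by auto
        with b show ?thesis by simp
      qed simp
    qed
    then show "lie (hvec t \<alpha>) y = 0" by simp
  qed
  moreover obtain h where h: "h \<in> t" "\<alpha> h \<noteq> 0" by (rule dual_nonzero[OF dual])
  ultimately show False using killing_hvec[OF dual(1) h(1)] by simp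
qed

section \<open>Reality, positivity and integrality of the root pairing\<close>

lemma joint_basis:
  obtains B :: "'g set" and ev :: "'g \<Rightarrow> 'g \<Rightarrow> complex" where "finite B" "cvec.span B = UNIV" "\<And>x. x \<in> B \<Longrightarrow> x \<noteq> 0"
    "\<And>x h. x \<in> B \<Longrightarrow> h \<in> t \<Longrightarrow> lie h x = ev x h *\<^sub>C x"
    "\<And>h h'. h \<in> t \<Longrightarrow> h' \<in> t \<Longrightarrow> killing h h' = (\<Sum>x\<in>B. ev x h * ev x h')"
proof -
  obtain B where B: "B \<subseteq> joint_eigenvectors" "cvec.independent B" "cvec.span B = UNIV" "finite B"
    by (rule basis_within[OF joint_span])
  define ev where "ev x h = (SOME a. lie h x = a *\<^sub>C x)" for x h :: 'g
  have ev: "lie h x = ev x h *\<^sub>C x" if "x \<in> B" "h \<in> t" for x h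
    unfolding ev_def by (rule someI_ex) (use that B(1) in \<open>auto simp: joint_eigenvectors_def\<close>)
  have "killing h h' = (\<Sum>x\<in>B. ev x h * ev x h')" if h: "h \<in> t" "h' \<in> t" for h h'
    unfolding killing_def
  proof (rule trace_op_eigenbasis[OF clinear_lie2 B(2,3)])
    fix x assume "x \<in> B"
    then show "lie h (lie h' x) = (ev x h * ev x h') *\<^sub>C x"
      by (simp add: ev h lie_scale_right mult.commute)
  qed
  moreover have "x \<noteq> 0" if "x \<in> B" for x
    using that B(2) cvec.dependent_zero by auto
  ultimately show thesis using that[OF B(4,3)] ev by blast
qed

text \<open>Since \<open>2 \<beta> (h\<^sub>\<alpha>)\<close> is an integral multiple of \<open>a = \<langle>\<alpha>, \<alpha>\<rangle>\<close> for every weight \<open>\<beta>\<close>, the trace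
  formula for \<open>a\<close> reads \<open>4 a = a\<^sup>2 N\<close> with \<open>N\<close> a sum of squares.\<close>

lemma root_norm_pos:
  assumes \<alpha>: "affine_root \<alpha> j"
  shows "\<alpha> (hvec t \<alpha>) = of_real (root_inner t \<alpha> \<alpha>)" "root_inner t \<alpha> \<alpha> > 0"
proof -
  define H where "H = hvec t \<alpha>"
  have dual: "\<alpha> \<in> dual t" using \<alpha> by (auto simp: affine_root_def)
  have H: "H \<in> t" unfolding H_def by (rule hvec_in[OF dual])
  obtain B :: "'g set" and ev :: "'g \<Rightarrow> 'g \<Rightarrow> complex" where B: "finite B" "cvec.span B = UNIV" "\<And>x. x \<in> B \<Longrightarrow> x \<noteq> 0"
    "\<And>x h. x \<in> B \<Longrightarrow> h \<in> t \<Longrightarrow> lie h x = ev x h *\<^sub>C x"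
    "\<And>h h'. h \<in> t \<Longrightarrow> h' \<in> t \<Longrightarrow> killing h h' = (\<Sum>x\<in>B. ev x h * ev x h')"
    by (rule joint_basis) blast
  have KH: "killing H H = \<alpha> H" using killing_hvec[OF dual H] by (simp add: H_def)
  have "\<forall>x\<in>B. \<exists>k::int. 2 * ev x H = \<alpha> H * of_int k"
    using root_string_integral[OF \<alpha> B(3), folded H_def] B(4) H by blast
  then obtain k where k: "\<And>x. x \<in> B \<Longrightarrow> 2 * ev x H = \<alpha> H * of_int (k x)" by metis
  have "4 * \<alpha> H = (\<Sum>x\<in>B. (2 * ev x H) * (2 * ev x H))"
    unfolding KH[symmetric] B(5)[OF H H] by (simp add: sum_distrib_left mult_ac)
  also have "\<dots> = (\<Sum>x\<in>B. (\<alpha> H * \<alpha> H) * of_int ((k x)\<^sup>2))"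
    by (rule sum.cong) (simp_all add: k power2_eq_square mult_ac)
  also have "\<dots> = \<alpha> H * \<alpha> H * of_int (\<Sum>x\<in>B. (k x)\<^sup>2)"
    by (simp add: sum_distrib_left)
  finally have "\<alpha> H * of_int (\<Sum>x\<in>B. (k x)\<^sup>2) = 4"
    using root_norm_nonzero[OF \<alpha>] by (simp add: H_def[symmetric] mult_ac)
  moreover define N where "N = (\<Sum>x\<in>B. (k x)\<^sup>2)"
  ultimately have N: "\<alpha> H * of_int N = 4" by simp
  then have "N \<noteq> 0" by auto
  moreover have "N \<ge> 0" unfolding N_def by (simp add: sum_nonneg)
  ultimately have "N > 0" by simp
  have \<alpha>H: "\<alpha> H = of_real (4 / real_of_int N)"
    using N \<open>N > 0\<close> by (simp add: field_simps)
  have "root_inner t \<alpha> \<alpha> = 4 / real_of_int N"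
    unfolding root_inner_def H_def[symmetric] KH \<alpha>H by simp
  with \<alpha>H \<open>N > 0\<close> show "\<alpha> (hvec t \<alpha>) = of_real (root_inner t \<alpha> \<alpha>)" "root_inner t \<alpha> \<alpha> > 0"
    by (simp_all add: H_def)
qed

lemma root_inner_integral:
  assumes \<alpha>: "affine_root \<alpha> i" and \<beta>: "affine_root \<beta> j"
  shows "2 * root_inner t \<beta> \<alpha> / root_inner t \<alpha> \<alpha> \<in> \<int>"
proof -
  have dual: "\<alpha> \<in> dual t" "\<beta> \<in> dual t" using \<alpha> \<beta> by (auto simp: affine_root_def)
  obtain x where x: "\<And>h. h \<in> t \<Longrightarrow> lie h x = \<beta> h *\<^sub>C x" "x \<noteq> 0"
    by (rule affine_root_vector[OF \<beta>]) blast
  obtain k :: int where "2 * \<beta> (hvec t \<alpha>) = \<alpha> (hvec t \<alpha>) * of_int k"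
    using root_string_integral[OF \<alpha> x(2) x(1)[OF hvec_in[OF dual(1)]]] by blast
  then have "2 * killing (hvec t \<beta>) (hvec t \<alpha>) = of_real (root_inner t \<alpha> \<alpha> * of_int k)"
    by (simp add: killing_hvec[OF dual(2) hvec_in[OF dual(1)]] root_norm_pos(1)[OF \<alpha>])
  then have "Re (2 * killing (hvec t \<beta>) (hvec t \<alpha>)) = root_inner t \<alpha> \<alpha> * of_int k"
    by (simp only: Re_complex_of_real)
  then have "2 * root_inner t \<beta> \<alpha> = root_inner t \<alpha> \<alpha> * of_int k"
    by (simp add: root_inner_def)
  then show ?thesis using root_norm_pos(2)[OF \<alpha>] by simp
qed

text \<open>Lowering a root vector for \<beta> by one for \<open>- \<alpha>\<close> lands in a zero
  space, so it is a lowest weight vector for \<alpha>. Emptiness is required only in the class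
  \<open>j - i\<close>, where this bracket lies.\<close>

lemma root_inner_nonpos:
  assumes \<alpha>: "affine_root \<alpha> i" and \<beta>: "affine_root \<beta> j"
    and no: "weight_space (eigenspace \<nu> n (j - i)) t (\<lambda>h. \<beta> h - \<alpha> h) = {0}"
  shows "root_inner t \<beta> \<alpha> \<le> 0"
proof -
  have dual: "\<alpha> \<in> dual t" "\<alpha> \<noteq> (\<lambda>h. 0)" "\<beta> \<in> dual t" using \<alpha> \<beta> by (auto simp: affine_root_def)
  note H = hvec_in[OF dual(1)]
  obtain e where e: "e \<in> eigenspace \<nu> n i" "\<And>h. h \<in> t \<Longrightarrow> lie h e = \<alpha> h *\<^sub>C e" "e \<noteq> 0"
    by (rule affine_root_vector[OF \<alpha>]) blast
  obtain f where f: "f \<in> eigenspace \<nu> n (- i)" "\<And>h. h \<in> t \<Longrightarrow> lie h f = (- \<alpha> h) *\<^sub>C f"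
    "lie e f = hvec t \<alpha>"
    using opposite_root_vector[OF dual(1) e] by blast
  obtain x where x: "x \<in> eigenspace \<nu> n j" "\<And>h. h \<in> t \<Longrightarrow> lie h x = \<beta> h *\<^sub>C x" "x \<noteq> 0"
    by (rule affine_root_vector[OF \<beta>]) blast
  have "lie f x \<in> weight_space (eigenspace \<nu> n (j - i)) t (\<lambda>h. \<beta> h - \<alpha> h)"
    using eigenspace_lie[OF f(1) x(1)] weight_lie[OF f(2) x(2)]
    by (simp add: weight_space_def algebra_simps)
  then have fx: "lie f x = 0" using no by blast
  obtain h where h: "h \<in> t" "\<alpha> h \<noteq> 0" by (rule dual_nonzero[OF dual(1,2)])
  have nil: "\<exists>k. (lie e ^^ k) x = 0"
    by (rule root_locally_nilpotent[OF h e(2)[OF h(1)]])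
  obtain k :: nat where "2 * \<beta> (hvec t \<alpha>) = - \<alpha> (hvec t \<alpha>) * of_nat k"
    using lowest_weight[OF f(3) e(2)[OF H] f(2)[OF H] nil x(3) x(2)[OF H] fx] by blast
  then have "2 * killing (hvec t \<beta>) (hvec t \<alpha>) = of_real (- root_inner t \<alpha> \<alpha> * of_nat k)"
    by (simp add: killing_hvec[OF dual(3) H] root_norm_pos(1)[OF \<alpha>])
  then have "Re (2 * killing (hvec t \<beta>) (hvec t \<alpha>)) = - root_inner t \<alpha> \<alpha> * of_nat k"
    by (simp only: Re_complex_of_real)
  then have "2 * root_inner t \<beta> \<alpha> = - root_inner t \<alpha> \<alpha> * of_nat k"
    by (simp add: root_inner_def)
  moreover have "root_inner t \<alpha> \<alpha> * of_nat k \<ge> 0"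
    using root_norm_pos(2)[OF \<alpha>] by simp
  ultimately show ?thesis by linarith
qed

lemma root_inner_sym: "root_inner t \<alpha> \<beta> = root_inner t \<beta> \<alpha>"
  unfolding root_inner_def by (subst killing_sym) rule

text \<open>The double sum is the Killing square of \<open>H\<close>, the combination of the
  \<open>hvec t (\<alpha> i)\<close>, whose eigenvalues are real by the string property; so it is a
  sum of squares. If it vanishes, \<open>H\<close> is central and hence 0, which is a linear
  relation between the roots.\<close>

lemma root_inner_definite:
  fixes c :: "nat \<Rightarrow> real"
  assumes I: "finite I" and \<alpha>: "\<And>i. i \<in> I \<Longrightarrow> \<exists>j. affine_root (\<alpha> i) j"
  shows "(\<Sum>i\<in>I. \<Sum>j\<in>I. c i * c j * root_inner t (\<alpha> i) (\<alpha> j)) \<ge> 0"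
    and "(\<Sum>i\<in>I. \<Sum>j\<in>I. c i * c j * root_inner t (\<alpha> i) (\<alpha> j)) = 0 \<Longrightarrow>
      h \<in> t \<Longrightarrow> (\<Sum>i\<in>I. of_real (c i) * \<alpha> i h) = 0"
proof -
  have dual: "\<alpha> i \<in> dual t" if "i \<in> I" for i using \<alpha>[OF that] by (auto simp: affine_root_def)
  note Hi = hvec_in[OF dual]
  define H where "H = (\<Sum>i\<in>I. of_real (c i) *\<^sub>C hvec t (\<alpha> i))"
  have H: "H \<in> t"
    unfolding H_def by (intro cvec.subspace_sum[OF subspace_t] cvec.subspace_scale[OF subspace_t] Hi)
  obtain B :: "'g set" and ev :: "'g \<Rightarrow> 'g \<Rightarrow> complex" where B: "finite B" "cvec.span B = UNIV" "\<And>x. x \<in> B \<Longrightarrow> x \<noteq> 0"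
    "\<And>x h. x \<in> B \<Longrightarrow> h \<in> t \<Longrightarrow> lie h x = ev x h *\<^sub>C x"
    "\<And>h h'. h \<in> t \<Longrightarrow> h' \<in> t \<Longrightarrow> killing h h' = (\<Sum>x\<in>B. ev x h * ev x h')"
    by (rule joint_basis) blast
  have real: "ev x (hvec t (\<alpha> i)) \<in> \<real>" if xi: "x \<in> B" "i \<in> I" for x i
  proof -
    obtain j where j: "affine_root (\<alpha> i) j" using \<alpha> xi by blast
    obtain k :: int where "2 * ev x (hvec t (\<alpha> i)) = \<alpha> i (hvec t (\<alpha> i)) * of_int k"
      using root_string_integral[OF j B(3)[OF xi(1)] B(4)[OF xi(1) Hi[OF xi(2)]]] by blast
    then have "ev x (hvec t (\<alpha> i)) = of_real (root_inner t (\<alpha> i) (\<alpha> i) * of_int k / 2)"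
      unfolding root_norm_pos(1)[OF j] by (simp add: field_simps)
    then show ?thesis by (metis Reals_of_real)
  qed
  have "ev x H \<in> \<real>" if x: "x \<in> B" for x
  proof -
    have "ev x H *\<^sub>C x = (\<Sum>i\<in>I. of_real (c i) *\<^sub>C lie (hvec t (\<alpha> i)) x)"
      unfolding B(4)[OF x H, symmetric] unfolding H_def
      by (simp add: clinear_sum[OF clinear_lie_left] lie_scale_left)
    also have "\<dots> = (\<Sum>i\<in>I. (of_real (c i) * ev x (hvec t (\<alpha> i))) *\<^sub>C x)"
      by (rule sum.cong) (simp_all add: B(4)[OF x Hi])
    also have "\<dots> = (\<Sum>i\<in>I. of_real (c i) * ev x (hvec t (\<alpha> i))) *\<^sub>C x"
      by (simp add: cvec.scale_sum_left)
    finally have "ev x H = (\<Sum>i\<in>I. of_real (c i) * ev x (hvec t (\<alpha> i)))"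
      using B(3)[OF x] by simp
    then show ?thesis by (simp add: sum_in_Reals real x)
  qed
  then have sq: "ev x H * ev x H = of_real ((Re (ev x H))\<^sup>2)" if "x \<in> B" for x
    using that by (auto simp: power2_eq_square elim!: Reals_cases)
  have "killing H H = of_real (\<Sum>x\<in>B. (Re (ev x H))\<^sup>2)"
    unfolding B(5)[OF H H] using sq by simp
  then have 1: "Re (killing H H) = (\<Sum>x\<in>B. (Re (ev x H))\<^sup>2)" by simp
  have "killing H H = (\<Sum>i\<in>I. \<Sum>j\<in>I. of_real (c i * c j) * killing (hvec t (\<alpha> i)) (hvec t (\<alpha> j)))"
    unfolding H_def killing_sum_left
    by (simp add: killing_sum_right killing_scale_left killing_scale_right mult_ac)
  then have "Re (killing H H) = (\<Sum>i\<in>I. \<Sum>j\<in>I. c i * c j * root_inner t (\<alpha> i) (\<alpha> j))"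
    by (simp add: root_inner_def)
  note 2 = this[unfolded 1, symmetric]
  show "(\<Sum>i\<in>I. \<Sum>j\<in>I. c i * c j * root_inner t (\<alpha> i) (\<alpha> j)) \<ge> 0"
    unfolding 2 by (simp add: sum_nonneg)
  assume "(\<Sum>i\<in>I. \<Sum>j\<in>I. c i * c j * root_inner t (\<alpha> i) (\<alpha> j)) = 0" and h: "h \<in> t"
  then have "Re (ev x H) = 0" if "x \<in> B" for x
    using that B(1) unfolding 2 by (simp add: sum_nonneg_eq_0_iff)
  then have "ev x H = 0" if "x \<in> B" for x using sq[OF that] that by simp
  then have zero: "lie H x = 0" if "x \<in> B" for x using B(4)[OF that H] that by simp
  have "H = 0"
  proof (rule center_trivial)
    fix y
    have "lie H y = 0 *\<^sub>C y"
      by (rule clinear_eq_on_span[OF clinear_lie, where g = "\<lambda>x. 0 *\<^sub>C x" and S = B])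
        (simp_all add: B(2) zero clinear_iff)
    then show "lie H y = 0" by simp
  qed
  then have "killing H h = 0" by simp
  then show "(\<Sum>i\<in>I. of_real (c i) * \<alpha> i h) = 0"
    by (simp add: H_def killing_sum_left killing_scale_left killing_hvec[OF dual h])
qed

section \<open>Affine simple roots\<close>

context
  fixes r :: nat and \<alpha> :: "nat \<Rightarrow> 'g \<Rightarrow> complex" and m :: "nat \<Rightarrow> nat"
  assumes alpha: "affine_simple_roots \<nu> n t r \<alpha>" and marks: "affine_marks t r \<alpha> m" and r: "r > 0"
begin

lemma simple_independent:
  assumes "\<And>h. h \<in> t \<Longrightarrow> (\<Sum>i\<in>{1..r}. c i * \<alpha> i h) = 0" "i \<in> {1..r}"
  shows "c i = 0"
  using alpha assms unfolding affine_simple_roots_def simple_roots_def by blast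

lemma sum_from_0: "(\<Sum>i\<in>{0..r}. f i) = f 0 + (\<Sum>i\<in>{1..r}. f i)" for f :: "nat \<Rightarrow> complex"
  by (simp add: sum.atLeast_Suc_atMost)

lemma mark_relation: "h \<in> t \<Longrightarrow> (\<Sum>i\<in>{0..r}. of_nat (m i) * \<alpha> i h) = 0"
  and mark_0: "m 0 = 1" and mark_pos: "i \<in> {0..r} \<Longrightarrow> m i > 0"
  using marks by (auto simp: affine_marks_def)

lemma affine_roots: "i \<in> {0..r} \<Longrightarrow> affine_root (\<alpha> i) (snd (abar n \<alpha> i))"
proof (cases "i = 0")
  case False
  assume "i \<in> {0..r}"
  with False have "\<alpha> i \<in> roots (eigenspace \<nu> n 0) t"
    using alpha unfolding affine_simple_roots_def simple_roots_def by auto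
  then show ?thesis
    using False by (simp add: affine_root_def roots_def abar_def gspace_def)
next
  case True
  \<comment> \<open>Otherwise the mark relation would relate the independent simple roots, with
    positive coefficient \<open>m 1\<close>; that this term exists is the use of
    \<open>r > 0\<close>.\<close>
  have "\<alpha> 0 \<noteq> (\<lambda>h. 0)"
  proof
    assume 0: "\<alpha> 0 = (\<lambda>h. 0)"
    have "(of_nat (m 1) :: complex) = 0"
    proof (rule simple_independent[of "\<lambda>i. of_nat (m i)"])
      show "(\<Sum>i\<in>{1..r}. of_nat (m i) * \<alpha> i h) = 0" if "h \<in> t" for h
        using mark_relation[OF that] unfolding sum_from_0 by (simp add: 0)
    qed (use r in auto)
    then show False using mark_pos[of 1] r by simp
  qed
  moreover have "abar n \<alpha> 0 \<in> Rbar \<nu> n t"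
    using alpha by (simp add: affine_simple_roots_def)
  ultimately show ?thesis
    using True by (simp add: Rbar_def affine_root_def) (simp add: abar_def)
qed

lemma affine_dual: "i \<in> {0..r} \<Longrightarrow> \<alpha> i \<in> dual t"
  using affine_roots by (simp add: affine_root_def)

text \<open>Subtracting \<open>c 0\<close> times the mark relation removes
  \<open>\<alpha> 0\<close>, because \<open>m 0 = 1\<close>; independence then shows that the given
  relation is this multiple, and one zero coefficient makes the multiple zero.\<close>

lemma proper_relation_trivial:
  assumes rel: "\<And>h. h \<in> t \<Longrightarrow> (\<Sum>i\<in>{0..r}. c i * \<alpha> i h) = 0"
    and k: "k \<in> {0..r}" "c k = 0" and i: "i \<in> {0..r}"
  shows "c i = 0"
proof -
  have eq: "c i = c 0 * of_nat (m i)" if i: "i \<in> {0..r}" for i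
  proof (cases "i = 0")
    case False
    have "c i - c 0 * of_nat (m i) = 0"
    proof (rule simple_independent[of "\<lambda>i. c i - c 0 * of_nat (m i)"])
      fix h assume h: "h \<in> t"
      have "(\<Sum>i\<in>{0..r}. (c i - c 0 * of_nat (m i)) * \<alpha> i h) =
          (\<Sum>i\<in>{0..r}. c i * \<alpha> i h) - c 0 * (\<Sum>i\<in>{0..r}. of_nat (m i) * \<alpha> i h)"
        by (simp add: left_diff_distrib sum_subtractf sum_distrib_left mult.assoc)
      also have "\<dots> = 0" by (simp add: rel[OF h] mark_relation[OF h])
      finally show "(\<Sum>i\<in>{1..r}. (c i - c 0 * of_nat (m i)) * \<alpha> i h) = 0"
        unfolding sum_from_0 by (simp add: mark_0)
    qed (use False i in auto)
    then show ?thesis by simp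
  qed (simp add: mark_0)
  have "c 0 = 0" using eq[OF k(1)] k(2) mark_pos[OF k(1)] by simp
  with eq[OF i] show ?thesis by simp
qed

text \<open>A null vector on \<open>J\<close>, extended by zero, is a relation between all affine
  simple roots whose coefficient at an omitted vertex is 0.\<close>

lemma affine_gram_definite:
  fixes c :: "nat \<Rightarrow> real"
  assumes J: "J \<subset> {0..r}" and c: "\<exists>i\<in>J. c i \<noteq> 0"
  shows "(\<Sum>i\<in>J. \<Sum>j\<in>J. c i * c j * root_inner t (\<alpha> i) (\<alpha> j)) > 0"
proof (rule ccontr)
  have fin: "finite J" using J finite_subset by blast
  have roots: "\<exists>j. affine_root (\<alpha> i) j" if "i \<in> J" for i using affine_roots[of i] J that by blast
  note def = root_inner_definite[where I = J and \<alpha> = \<alpha> and c = c, OF fin roots]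
  assume "\<not> ?thesis"
  then have eq: "(\<Sum>i\<in>J. \<Sum>j\<in>J. c i * c j * root_inner t (\<alpha> i) (\<alpha> j)) = 0"
    using def(1) by simp
  let ?c = "\<lambda>i. if i \<in> J then of_real (c i) else (0 :: complex)"
  have rel: "(\<Sum>i\<in>{0..r}. ?c i * \<alpha> i h) = 0" if "h \<in> t" for h
  proof -
    have "(\<Sum>i\<in>{0..r}. ?c i * \<alpha> i h) = (\<Sum>i\<in>J. ?c i * \<alpha> i h)"
      using J by (intro sum.mono_neutral_right) auto
    also have "\<dots> = (\<Sum>i\<in>J. of_real (c i) * \<alpha> i h)" by simp
    also have "\<dots> = 0" by (rule def(2)[OF _ eq that])
    finally show ?thesis .
  qed
  obtain k where k: "k \<in> {0..r}" "k \<notin> J" using J by blast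
  have "c i = 0" if "i \<in> J" for i
  proof -
    have "?c i = 0" by (rule proper_relation_trivial[of ?c k i, OF rel]) (use k J that in auto)
    with that show ?thesis by simp
  qed
  with c show False by blast
qed

lemma affine_gram_pos: "i \<in> {0..r} \<Longrightarrow> root_inner t (\<alpha> i) (\<alpha> i) > 0"
  by (rule root_norm_pos(2)[OF affine_roots])

lemma affine_cartan_integral:
  "i \<in> {0..r} \<Longrightarrow> j \<in> {0..r} \<Longrightarrow> affine_cartan t \<alpha> i j \<in> \<int>"
  unfolding affine_cartan_def by (rule root_inner_integral[OF affine_roots affine_roots])

lemma dual_diff: "\<beta> \<in> dual t \<Longrightarrow> \<gamma> \<in> dual t \<Longrightarrow> (\<lambda>h. \<beta> h - \<gamma> h) \<in> dual t"
  unfolding dual_def by (auto simp: algebra_simps)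

text \<open>The subtracted root is taken among \<open>1..r\<close> because the characterisation of
  \<open>abar n \<alpha> 0\<close> concerns differences in that order only; symmetry of the pairing
  supplies the remaining case. Two simple roots cannot differ by a root, whose coefficients have one
  sign.\<close>

lemma affine_gram_nonpos_right:
  assumes i: "i \<in> {0..r}" and k: "k \<in> {1..r}" and ik: "i \<noteq> k"
  shows "root_inner t (\<alpha> i) (\<alpha> k) \<le> 0"
proof (rule root_inner_nonpos)
  have k': "k \<in> {0..r}" using k by simp
  show "affine_root (\<alpha> k) 0" using affine_roots[OF k'] k by (simp add: abar_def)
  show "affine_root (\<alpha> i) (snd (abar n \<alpha> i))" by (rule affine_roots[OF i])
  have diff: "(\<lambda>h. \<alpha> i h - \<alpha> k h) \<in> dual t"
    by (rule dual_diff[OF affine_dual[OF i] affine_dual[OF k']])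
  show "weight_space (eigenspace \<nu> n (snd (abar n \<alpha> i) - 0)) t (\<lambda>h. \<alpha> i h - \<alpha> k h) = {0}"
  proof (cases "i = 0")
    case True
    have "(\<lambda>h. \<alpha> 0 h - \<alpha> k h, snd (abar n \<alpha> 0) - snd (abar n \<alpha> k)) \<notin> Rbar \<nu> n t"
      using alpha k by (simp add: affine_simple_roots_def)
    moreover have "snd (abar n \<alpha> k) = 0" using k by (simp add: abar_def)
    ultimately show ?thesis using diff True by (simp add: Rbar_def gspace_def)
  next
    case False
    then have i1: "i \<in> {1..r}" using i by simp
    \<comment> \<open>By independence any expansion of the difference has coefficient 1 at
      \<open>i\<close> and -1 at \<open>k\<close>. Natural coefficients violate the second
      condition, their negatives the first.\<close>
    have no: False if eq: "\<And>h. h \<in> t \<Longrightarrow> \<alpha> i h - \<alpha> k h = (\<Sum>l\<in>{1..r}. d l * \<alpha> l h)"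
      and d: "d i \<noteq> 1 \<or> d k \<noteq> -1" for d
    proof -
      let ?c = "\<lambda>l. (if l = i then 1 else 0) - (if l = k then 1 else 0) - d l"
      have "(\<Sum>l\<in>{1..r}. ?c l * \<alpha> l h) = 0" if "h \<in> t" for h
      proof -
        have "(\<Sum>l\<in>{1..r}. ?c l * \<alpha> l h) = (\<Sum>l\<in>{1..r}. if l = i then \<alpha> l h else 0)
           - (\<Sum>l\<in>{1..r}. if l = k then \<alpha> l h else 0) - (\<Sum>l\<in>{1..r}. d l * \<alpha> l h)"
          unfolding sum_subtractf[symmetric] by (rule sum.cong) (auto simp: algebra_simps)
        also have "\<dots> = \<alpha> i h - \<alpha> k h - (\<Sum>l\<in>{1..r}. d l * \<alpha> l h)"
          using i1 k by simp
        finally show ?thesis using eq[OF that] by simp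
      qed
      then have c: "?c i = 0" "?c k = 0"
        using simple_independent[of ?c i] simple_independent[of ?c k] i1 k by blast+
      show False using c d ik by auto
    qed
    show ?thesis
    proof (rule ccontr)
      assume "weight_space (eigenspace \<nu> n (snd (abar n \<alpha> i) - 0)) t (\<lambda>h. \<alpha> i h - \<alpha> k h) \<noteq> {0}"
      then have W: "weight_space (eigenspace \<nu> n 0) t (\<lambda>h. \<alpha> i h - \<alpha> k h) \<noteq> {0}"
        using False by (simp add: abar_def)
      have "(\<lambda>h. \<alpha> i h - \<alpha> k h) \<noteq> (\<lambda>h. 0)"
      proof
        assume 0: "(\<lambda>h. \<alpha> i h - \<alpha> k h) = (\<lambda>h. 0)"
        have "\<alpha> i h - \<alpha> k h = (\<Sum>l\<in>{1..r}. 0 * \<alpha> l h)" for h using fun_cong[OF 0, of h] by simp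
        then show False by (rule no[of "\<lambda>_. 0"]) simp
      qed
      with diff W have root: "(\<lambda>h. \<alpha> i h - \<alpha> k h) \<in> roots (eigenspace \<nu> n 0) t"
        by (simp add: roots_def)
      have "simple_roots (eigenspace \<nu> n 0) t {1..r} \<alpha>"
        using alpha unfolding affine_simple_roots_def by (elim conjE)
      then have "\<forall>\<gamma>\<in>roots (eigenspace \<nu> n 0) t. \<exists>d :: nat \<Rightarrow> nat.
          (\<forall>h\<in>t. \<gamma> h = (\<Sum>l\<in>{1..r}. of_nat (d l) * \<alpha> l h)) \<or>
          (\<forall>h\<in>t. \<gamma> h = - (\<Sum>l\<in>{1..r}. of_nat (d l) * \<alpha> l h))"
        unfolding simple_roots_def by (elim conjE)
      from bspec[OF this root] obtain d :: "nat \<Rightarrow> nat" where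
        "(\<forall>h\<in>t. \<alpha> i h - \<alpha> k h = (\<Sum>l\<in>{1..r}. of_nat (d l) * \<alpha> l h)) \<or>
         (\<forall>h\<in>t. \<alpha> i h - \<alpha> k h = - (\<Sum>l\<in>{1..r}. of_nat (d l) * \<alpha> l h))"
        by (elim exE)
      then show False
      proof
        assume "\<forall>h\<in>t. \<alpha> i h - \<alpha> k h = (\<Sum>l\<in>{1..r}. of_nat (d l) * \<alpha> l h)"
        moreover have "(of_nat (d k) :: complex) \<noteq> -1"
        proof
          assume "(of_nat (d k) :: complex) = -1"
          then have "Re (of_nat (d k)) = -1" by simp
          then show False by simp
        qed
        ultimately show False by (intro no[of "\<lambda>l. of_nat (d l)"]) auto
      next
        assume "\<forall>h\<in>t. \<alpha> i h - \<alpha> k h = - (\<Sum>l\<in>{1..r}. of_nat (d l) * \<alpha> l h)"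
        moreover have "- (of_nat (d i) :: complex) \<noteq> 1"
        proof
          assume "- (of_nat (d i) :: complex) = 1"
          then have "Re (- of_nat (d i)) = 1" by simp
          then show False by simp
        qed
        ultimately show False by (intro no[of "\<lambda>l. - of_nat (d l)"]) (auto simp: sum_negf)
      qed
    qed
  qed
qed

lemma affine_gram_nonpos:
  assumes "i \<in> {0..r}" "j \<in> {0..r}" "i \<noteq> j"
  shows "root_inner t (\<alpha> i) (\<alpha> j) \<le> 0"
proof (cases "j = 0")
  case True
  then show ?thesis
    using affine_gram_nonpos_right[of j i] assms root_inner_sym[of "\<alpha> i" "\<alpha> j"] by simp
qed (use affine_gram_nonpos_right[of i j] assms in simp)

text \<open>The mark relation evaluated at \<open>hvec t (\<alpha> k)\<close>.\<close>

lemma affine_gram_marks: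
  assumes k: "k \<in> {0..r}"
  shows "(\<Sum>j\<in>{0..r}. real (m j) * root_inner t (\<alpha> j) (\<alpha> k)) = 0"
proof -
  have hk: "hvec t (\<alpha> k) \<in> t" by (rule hvec_in[OF affine_dual[OF k]])
  have "(\<Sum>j\<in>{0..r}. real (m j) * root_inner t (\<alpha> j) (\<alpha> k)) =
      Re (\<Sum>j\<in>{0..r}. of_nat (m j) * killing (hvec t (\<alpha> j)) (hvec t (\<alpha> k)))"
    by (simp add: root_inner_def)
  also have "(\<Sum>j\<in>{0..r}. of_nat (m j) * killing (hvec t (\<alpha> j)) (hvec t (\<alpha> k))) =
      (\<Sum>j\<in>{0..r}. of_nat (m j) * \<alpha> j (hvec t (\<alpha> k)))"
    by (rule sum.cong) (simp_all add: killing_hvec[OF affine_dual hk])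
  finally show ?thesis by (simp add: mark_relation[OF hk])
qed

end

end

section \<open>Partial derivatives\<close>

lemma has_derivative_pderiv_dir:
  assumes "f differentiable (at q)"
  shows "(f has_derivative (\<lambda>h. Re h * pderiv_dir 1 f q + Im h * pderiv_dir \<i> f q)) (at q)"
proof -
  let ?L = "frechet_derivative f (at q)"
  have L: "(f has_derivative ?L) (at q)" using assms by (simp add: frechet_derivative_works)
  have lin: "linear ?L" by (rule linear_frechet_derivative[OF assms])
  have "?L h = Re h * pderiv_dir 1 f q + Im h * pderiv_dir \<i> f q" for h
  proof -
    have "h = Re h *\<^sub>R 1 + Im h *\<^sub>R \<i>" by (simp add: complex_eq_iff)
    then have "?L h = ?L (Re h *\<^sub>R 1 + Im h *\<^sub>R \<i>)" by simp
    also have "\<dots> = Re h * pderiv_dir 1 f q + Im h * pderiv_dir \<i> f q"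
      by (simp add: linear_add[OF lin] linear_scale[OF lin] pderiv_dir_def)
    finally show ?thesis .
  qed
  then have "?L = (\<lambda>h. Re h * pderiv_dir 1 f q + Im h * pderiv_dir \<i> f q)" by blast
  with L show ?thesis by simp
qed

lemma pderiv_dir_eq: "(f has_derivative L) (at q) \<Longrightarrow> pderiv_dir v f q = L v"
  using frechet_derivative_at[of f L q] by (simp add: pderiv_dir_def)

lemma pderiv_dir_has_derivative:
  "f differentiable (at q) \<Longrightarrow> (f has_derivative (\<lambda>v. pderiv_dir v f q)) (at q)"
  by (simp add: pderiv_dir_def[abs_def] frechet_derivative_works)

lemma differentiable_transform_open:
  assumes "open U" "q \<in> U" "\<And>x. x \<in> U \<Longrightarrow> f x = g x" "f differentiable (at q)"
  shows "g differentiable (at q)"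
  using assms has_derivative_transform_within_open unfolding differentiable_def by metis

lemma pderiv_dir_cong:
  assumes "open U" "q \<in> U" "\<And>x. x \<in> U \<Longrightarrow> f x = g x" "f differentiable (at q)"
  shows "pderiv_dir v f q = pderiv_dir v g q"
  unfolding pderiv_dir_def
  using frechet_derivative_transform_within_open[OF assms(4,1,2,3)] by simp

lemma pderiv_dir_lincomb:
  assumes "f differentiable (at q)" "g differentiable (at q)"
  shows "pderiv_dir v (\<lambda>x. a * f x + g x) q = a * pderiv_dir v f q + pderiv_dir v g q"
  by (rule pderiv_dir_eq)
    (intro has_derivative_add has_derivative_mult_right pderiv_dir_has_derivative assms)

lemma ck_on_cong:
  assumes "open U" "\<And>x. x \<in> U \<Longrightarrow> f x = g x" "ck_on k U f"
  shows "ck_on k U g"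
  using assms(2,3)
proof (induction k arbitrary: f g)
  case 0
  then show ?case using continuous_on_cong[of U U f g] by simp
next
  case (Suc k)
  have d: "f differentiable (at q)" if "q \<in> U" for q using Suc.prems(2) that by simp
  have "ck_on k U (pderiv_dir v g)" if "ck_on k U (pderiv_dir v f)" for v
    by (rule Suc.IH[OF _ that])
      (rule pderiv_dir_cong[OF assms(1) _ Suc.prems(1) d])
  then show ?case
    using Suc.prems(2) differentiable_transform_open[OF assms(1) _ Suc.prems(1)] by simp
qed

lemma ck_on_lincomb:
  assumes "open U" "ck_on k U f" "ck_on k U g"
  shows "ck_on k U (\<lambda>x. a * f x + g x)"
  using assms(2,3)
proof (induction k arbitrary: f g)
  case 0
  then show ?case by (auto intro!: continuous_intros)
next
  case (Suc k)
  have d: "f differentiable (at q)" "g differentiable (at q)" if "q \<in> U" for q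
    using Suc.prems that by simp_all
  have "ck_on k U (pderiv_dir v (\<lambda>x. a * f x + g x))"
    if "ck_on k U (pderiv_dir v f)" "ck_on k U (pderiv_dir v g)" for v
    by (rule ck_on_cong[OF assms(1) _ Suc.IH[OF that]]) (simp add: pderiv_dir_lincomb d)
  then show ?case
    using Suc.prems by (auto intro!: derivative_intros)
qed

lemma ck_on_const:
  assumes "open U" shows "ck_on k U (\<lambda>x. b)"
proof (induction k arbitrary: b)
  case (Suc k)
  have "pderiv_dir v (\<lambda>x. b) = (\<lambda>x. 0)" for v by (simp add: pderiv_dir_def fun_eq_iff)
  with Suc show ?case by simp
qed simp

definition flat_lap :: "(complex \<Rightarrow> real) \<Rightarrow> complex \<Rightarrow> real" where
  "flat_lap f q = pderiv_dir 1 (pderiv_dir 1 f) q + pderiv_dir \<i> (pderiv_dir \<i> f) q"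

lemma flat_laplacian_eq: "flat_laplacian c f p = flat_lap (f \<circ> cinv c) (snd c p)"
  by (simp add: flat_laplacian_def flat_lap_def)

lemma ck_on_2D:
  assumes "ck_on 2 U f" "q \<in> U"
  shows "f differentiable (at q)" "pderiv_dir 1 f differentiable (at q)"
    "pderiv_dir \<i> f differentiable (at q)"
  using assms by (simp_all add: numeral_2_eq_2)

lemma flat_lap_lincomb:
  assumes "open U" "q \<in> U" and f: "ck_on 2 U f" and g: "ck_on 2 U g"
  shows "flat_lap (\<lambda>x. a * f x + g x) q = a * flat_lap f q + flat_lap g q"
proof -
  have *: "pderiv_dir v (pderiv_dir v (\<lambda>x. a * f x + g x)) q =
      a * pderiv_dir v (pderiv_dir v f) q + pderiv_dir v (pderiv_dir v g) q"
    if "pderiv_dir v f differentiable (at q)" "pderiv_dir v g differentiable (at q)" for v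
  proof -
    have "pderiv_dir v (\<lambda>x. a * pderiv_dir v f x + pderiv_dir v g x) q =
        pderiv_dir v (pderiv_dir v (\<lambda>x. a * f x + g x)) q"
      by (rule pderiv_dir_cong[OF assms(1,2)])
        (use ck_on_2D[OF f] ck_on_2D[OF g] that in \<open>auto simp: pderiv_dir_lincomb intro!: derivative_intros\<close>)
    then show ?thesis by (simp add: pderiv_dir_lincomb that)
  qed
  show ?thesis
    unfolding flat_lap_def using *[of 1] *[of \<i>] ck_on_2D[OF f assms(2)] ck_on_2D[OF g assms(2)]
    by (simp add: algebra_simps)
qed

lemma flat_lap_const: "flat_lap (\<lambda>x. b) q = 0"
proof -
  have "pderiv_dir v (\<lambda>x. b) = (\<lambda>x. 0)" for v b by (simp add: pderiv_dir_def fun_eq_iff)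
  then show ?thesis by (simp add: flat_lap_def)
qed

text \<open>Apply the chain rule twice and add the directions 1 and \<i>. The terms with the second
  derivative of \<psi> cancel since \<i> squares to -1, the mixed second derivatives cancel in
  pairs, and by the Cauchy-Riemann equations the rest carries the factor
  \<open>(cmod (deriv \<psi> z))\<^sup>2\<close>.\<close>

lemma flat_lap_conformal:
  assumes U: "open U" and V: "open V" and \<psi>: "\<psi> holomorphic_on U" "\<psi> ` U \<subseteq> V"
    and f: "ck_on 2 V f" and g: "\<And>w. w \<in> U \<Longrightarrow> g w = f (\<psi> w)" and z: "z \<in> U"
  shows "flat_lap g z = (cmod (deriv \<psi> z))\<^sup>2 * flat_lap f (\<psi> z)"
proof -
  let ?P = "pderiv_dir 1 f" and ?Q = "pderiv_dir \<i> f"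
  have d\<psi>: "(\<psi> has_derivative (\<lambda>h. deriv \<psi> w * h)) (at w)" if "w \<in> U" for w
    using holomorphic_derivI[OF \<psi>(1) U that] by (simp add: has_field_derivative_def)
  have dd\<psi>: "(deriv \<psi> has_derivative (\<lambda>h. deriv (deriv \<psi>) z * h)) (at z)"
    using holomorphic_derivI[OF holomorphic_deriv[OF \<psi>(1) U] U z]
    by (simp add: has_field_derivative_def)
  have chain: "((\<lambda>w. F (\<psi> w)) has_derivative
      (\<lambda>h. Re (deriv \<psi> w * h) * pderiv_dir 1 F (\<psi> w) + Im (deriv \<psi> w * h) * pderiv_dir \<i> F (\<psi> w))) (at w)"
    if "w \<in> U" "F differentiable (at (\<psi> w))" for F w
    using has_derivative_compose[OF d\<psi>[OF that(1)] has_derivative_pderiv_dir[OF that(2)]] by simp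
  have \<psi>V: "\<psi> w \<in> V" if "w \<in> U" for w using \<psi>(2) that by blast
  have dg: "pderiv_dir v g w = Re (deriv \<psi> w * v) * ?P (\<psi> w) + Im (deriv \<psi> w * v) * ?Q (\<psi> w)"
    if "w \<in> U" for v w
    by (rule pderiv_dir_eq)
      (rule has_derivative_transform_within_open[OF chain[OF that ck_on_2D(1)[OF f \<psi>V[OF that]]] U that],
        simp add: g)
  have lin: "((\<lambda>w. Re (deriv \<psi> w * v)) has_derivative (\<lambda>h. Re (deriv (deriv \<psi>) z * h * v))) (at z)"
    "((\<lambda>w. Im (deriv \<psi> w * v)) has_derivative (\<lambda>h. Im (deriv (deriv \<psi>) z * h * v))) (at z)" for v
    by (intro has_derivative_Re has_derivative_Im has_derivative_mult_left dd\<psi>)+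
  have second: "pderiv_dir v (pderiv_dir v g) z =
      (Re (deriv \<psi> z * v) * (Re (deriv \<psi> z * v) * pderiv_dir 1 ?P (\<psi> z) + Im (deriv \<psi> z * v) * pderiv_dir \<i> ?P (\<psi> z))
       + Re (deriv (deriv \<psi>) z * v * v) * ?P (\<psi> z)) +
      (Im (deriv \<psi> z * v) * (Re (deriv \<psi> z * v) * pderiv_dir 1 ?Q (\<psi> z) + Im (deriv \<psi> z * v) * pderiv_dir \<i> ?Q (\<psi> z))
       + Im (deriv (deriv \<psi>) z * v * v) * ?Q (\<psi> z))" for v
  proof -
    note PQ = ck_on_2D(2,3)[OF f \<psi>V[OF z]]
    have "(pderiv_dir v g has_derivative (\<lambda>h.
      (Re (deriv \<psi> z * v) * (Re (deriv \<psi> z * h) * pderiv_dir 1 ?P (\<psi> z) + Im (deriv \<psi> z * h) * pderiv_dir \<i> ?P (\<psi> z))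
       + Re (deriv (deriv \<psi>) z * h * v) * ?P (\<psi> z)) +
      (Im (deriv \<psi> z * v) * (Re (deriv \<psi> z * h) * pderiv_dir 1 ?Q (\<psi> z) + Im (deriv \<psi> z * h) * pderiv_dir \<i> ?Q (\<psi> z))
       + Im (deriv (deriv \<psi>) z * h * v) * ?Q (\<psi> z)))) (at z)"
      by (rule has_derivative_transform_within_open[OF has_derivative_add[OF
            has_derivative_mult[OF lin(1)[of v] chain[OF z PQ(1)]]
            has_derivative_mult[OF lin(2)[of v] chain[OF z PQ(2)]]] U z])
        (simp add: dg)
    from pderiv_dir_eq[OF this, of v] show ?thesis .
  qed
  show ?thesis
    unfolding flat_lap_def second cmod_power2
    by (simp add: algebra_simps power2_eq_square)
qed

section \<open>Harmonic functions\<close>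

text \<open>The mean value theorem in direction \<open>v\<close>, applied to the first difference in
  direction \<open>w\<close>, leaves a difference of two values of \<open>pderiv_dir v f\<close>,
  which its differentiability at \<open>z\<close> estimates. The bound \<open>3 * e\<close> adds
  remainders at distances at most \<open>2 * s\<close> and \<open>s\<close>.\<close>

lemma second_difference:
  fixes f :: "complex \<Rightarrow> real"
  assumes U: "open U" "z \<in> U" and f: "\<And>x. x \<in> U \<Longrightarrow> f differentiable (at x)"
    and D: "pderiv_dir v f differentiable (at z)" and vw: "cmod v = 1" "cmod w = 1" and e: "e > 0"
  shows "\<exists>d>0. \<forall>s. 0 < s \<and> s < d \<longrightarrow>
    \<bar>f (z + s *\<^sub>R v + s *\<^sub>R w) - f (z + s *\<^sub>R v) - f (z + s *\<^sub>R w) + f z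
      - s\<^sup>2 * pderiv_dir w (pderiv_dir v f) z\<bar> \<le> 3 * e * s\<^sup>2"
proof -
  let ?g = "pderiv_dir v f"
  let ?L = "\<lambda>h. pderiv_dir h ?g z"
  have L: "(?g has_derivative ?L) (at z)" by (rule pderiv_dir_has_derivative[OF D])
  have lin: "linear ?L" using has_derivative_linear[OF L] .
  obtain d1 where d1: "d1 > 0" "\<And>y. norm (y - z) < d1 \<Longrightarrow> norm (?g y - ?g z - ?L (y - z)) \<le> e * norm (y - z)"
    using L[unfolded has_derivative_at_alt] e by blast
  obtain d2 where d2: "d2 > 0" "ball z d2 \<subseteq> U" using U open_contains_ball by blast
  \<comment> \<open>A third of the radius, so that points at distance up to \<open>2 * s\<close>
    from \<open>z\<close> stay inside both balls.\<close>
  define d where "d = min d1 d2 / 3"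
  have d: "d > 0" using d1 d2 by (simp add: d_def)
  have R: "\<bar>?g (z + h) - ?g z - ?L h\<bar> \<le> e * c * s" if "norm h \<le> c * s" "c * s < 3 * d" for h c s
  proof -
    have "norm h < d1" using that by (simp add: d_def)
    then have "\<bar>?g (z + h) - ?g z - ?L h\<bar> \<le> e * norm h" using d1(2)[of "z + h"] by simp
    also have "\<dots> \<le> e * (c * s)" using that(1) e by simp
    finally show ?thesis by (simp add: mult.assoc)
  qed
  have inU: "z + h \<in> U" if "norm h < 3 * d" for h
    using that d2(2) by (auto simp: d_def dist_norm subset_iff)
  have "\<bar>f (z + s *\<^sub>R v + s *\<^sub>R w) - f (z + s *\<^sub>R v) - f (z + s *\<^sub>R w) + f z
      - s\<^sup>2 * ?L w\<bar> \<le> 3 * e * s\<^sup>2" if s: "0 < s" "s < d" for s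
  proof -
    define \<phi> where "\<phi> u = f (z + u *\<^sub>R v + s *\<^sub>R w) - f (z + u *\<^sub>R v)" for u
    have norms: "norm (u *\<^sub>R v + s *\<^sub>R w) \<le> 2 * s" "norm (u *\<^sub>R v) \<le> 1 * s" if "0 \<le> u" "u \<le> s" for u
      using norm_triangle_ineq[of "u *\<^sub>R v" "s *\<^sub>R w"] that s vw by simp_all
    have deriv: "(\<phi> has_real_derivative (?g (z + u *\<^sub>R v + s *\<^sub>R w) - ?g (z + u *\<^sub>R v))) (at u)"
      if u: "0 \<le> u" "u \<le> s" for u
    proof -
      have line: "((\<lambda>u. f (z + u *\<^sub>R v + h)) has_real_derivative ?g (z + u *\<^sub>R v + h)) (at u)"
        if "z + u *\<^sub>R v + h \<in> U" for h
      proof -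
        have "((\<lambda>u. z + u *\<^sub>R v + h) has_derivative (\<lambda>k. k *\<^sub>R v)) (at u)"
          by (auto intro!: derivative_eq_intros)
        from has_derivative_compose[OF this pderiv_dir_has_derivative[OF f[OF that]]]
        have "((\<lambda>u. f (z + u *\<^sub>R v + h)) has_derivative (\<lambda>k. pderiv_dir (k *\<^sub>R v) f (z + u *\<^sub>R v + h))) (at u)" .
        moreover have "pderiv_dir (k *\<^sub>R v) f (z + u *\<^sub>R v + h) = ?g (z + u *\<^sub>R v + h) * k" for k
          using linear_scale[OF linear_frechet_derivative[OF f[OF that]], of k v]
          by (simp add: pderiv_dir_def)
        ultimately show ?thesis by (simp add: has_field_derivative_def)
      qed
      have "z + u *\<^sub>R v + s *\<^sub>R w \<in> U" "z + u *\<^sub>R v + 0 \<in> U"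
        using inU[of "u *\<^sub>R v + s *\<^sub>R w"] inU[of "u *\<^sub>R v"] norms[OF u] s by (simp_all add: add.assoc)
      from DERIV_diff[OF line[OF this(1)] line[OF this(2)]]
      show ?thesis by (simp add: \<phi>_def[abs_def])
    qed
    obtain \<xi> where \<xi>: "0 < \<xi>" "\<xi> < s" and mvt: "\<phi> s - \<phi> 0 = (s - 0) * (?g (z + \<xi> *\<^sub>R v + s *\<^sub>R w) - ?g (z + \<xi> *\<^sub>R v))"
      using MVT2[OF s(1), of \<phi> "\<lambda>u. ?g (z + u *\<^sub>R v + s *\<^sub>R w) - ?g (z + u *\<^sub>R v)"] deriv by blast
    let ?R = "\<lambda>h. ?g (z + h) - ?g z - ?L h"
    have "?L (\<xi> *\<^sub>R v + s *\<^sub>R w) - ?L (\<xi> *\<^sub>R v) = s * ?L w"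
      by (simp add: linear_add[OF lin] linear_scale[OF lin])
    then have "?g (z + \<xi> *\<^sub>R v + s *\<^sub>R w) - ?g (z + \<xi> *\<^sub>R v) - s * ?L w =
        ?R (\<xi> *\<^sub>R v + s *\<^sub>R w) - ?R (\<xi> *\<^sub>R v)"
      by (simp add: add.assoc)
    moreover have "\<bar>?R (\<xi> *\<^sub>R v + s *\<^sub>R w)\<bar> \<le> e * 2 * s" "\<bar>?R (\<xi> *\<^sub>R v)\<bar> \<le> e * 1 * s"
      by (rule R; use norms[of \<xi>] \<xi> s in simp)+
    ultimately have "\<bar>?g (z + \<xi> *\<^sub>R v + s *\<^sub>R w) - ?g (z + \<xi> *\<^sub>R v) - s * ?L w\<bar> \<le> 3 * e * s"
      by linarith
    then have "s * \<bar>?g (z + \<xi> *\<^sub>R v + s *\<^sub>R w) - ?g (z + \<xi> *\<^sub>R v) - s * ?L w\<bar> \<le> s * (3 * e * s)"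
      using s by (intro mult_left_mono) auto
    moreover have "s * \<bar>?g (z + \<xi> *\<^sub>R v + s *\<^sub>R w) - ?g (z + \<xi> *\<^sub>R v) - s * ?L w\<bar> =
        \<bar>\<phi> s - \<phi> 0 - s\<^sup>2 * ?L w\<bar>"
    proof -
      have "\<phi> s - \<phi> 0 - s\<^sup>2 * ?L w = s * (?g (z + \<xi> *\<^sub>R v + s *\<^sub>R w) - ?g (z + \<xi> *\<^sub>R v) - s * ?L w)"
        unfolding mvt by (simp add: algebra_simps power2_eq_square)
      then show ?thesis using s by (simp add: abs_mult)
    qed
    ultimately show ?thesis by (simp add: \<phi>_def power2_eq_square algebra_simps)
  qed
  with d show ?thesis by blast
qed

lemma mixed_partials_sym:
  assumes U: "open U" "z \<in> U" and f: "ck_on 2 U f"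
  shows "pderiv_dir \<i> (pderiv_dir 1 f) z = pderiv_dir 1 (pderiv_dir \<i> f) z"
proof (rule ccontr)
  let ?a = "pderiv_dir \<i> (pderiv_dir 1 f) z" and ?b = "pderiv_dir 1 (pderiv_dir \<i> f) z"
  assume "?a \<noteq> ?b"
  \<comment> \<open>Comparing the two orders of differences costs \<open>3 * e + 3 * e\<close>; any
    divisor above 6 gives the contradiction.\<close>
  define e where "e = \<bar>?a - ?b\<bar> / 7"
  have e: "e > 0" using \<open>?a \<noteq> ?b\<close> by (simp add: e_def)
  note D = ck_on_2D[OF f]
  obtain d1 where d1: "d1 > 0" "\<And>s. 0 < s \<and> s < d1 \<Longrightarrow>
    \<bar>f (z + s *\<^sub>R 1 + s *\<^sub>R \<i>) - f (z + s *\<^sub>R 1) - f (z + s *\<^sub>R \<i>) + f z - s\<^sup>2 * ?a\<bar> \<le> 3 * e * s\<^sup>2"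
    using second_difference[OF U D(1) D(2)[OF U(2)] _ _ e, of \<i>] by auto
  obtain d2 where d2: "d2 > 0" "\<And>s. 0 < s \<and> s < d2 \<Longrightarrow>
    \<bar>f (z + s *\<^sub>R \<i> + s *\<^sub>R 1) - f (z + s *\<^sub>R \<i>) - f (z + s *\<^sub>R 1) + f z - s\<^sup>2 * ?b\<bar> \<le> 3 * e * s\<^sup>2"
    using second_difference[OF U D(1) D(3)[OF U(2)] _ _ e, of 1] by auto
  define s where "s = min d1 d2 / 2"
  have s: "0 < s" "s < d1" "s < d2" using d1(1) d2(1) by (auto simp: s_def)
  have "\<bar>s\<^sup>2 * ?a - s\<^sup>2 * ?b\<bar> \<le> 6 * e * s\<^sup>2"
    using d1(2)[of s] d2(2)[of s] s by (simp add: ac_simps)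
  also have "\<bar>s\<^sup>2 * ?a - s\<^sup>2 * ?b\<bar> = s\<^sup>2 * (7 * e)"
    by (simp add: e_def abs_mult right_diff_distrib[symmetric])
  finally have "s\<^sup>2 * e \<le> 0" by (simp add: mult.commute)
  then show False using s e by (simp add: mult_le_0_iff)
qed

text \<open>For harmonic \<open>f\<close> the function \<open>h\<close>, the x-derivative minus \<i>
  times the y-derivative, satisfies the Cauchy-Riemann equations. A primitive \<open>G\<close> on
  the ball has real part \<open>f\<close> up to a constant, so the maximum of \<open>f\<close> is a
  maximum of the modulus of \<open>exp (G x)\<close>.\<close>

lemma harmonic_local_maximum:
  assumes f: "ck_on 2 (ball z e) f" and lap: "\<And>w. w \<in> ball z e \<Longrightarrow> flat_lap f w = 0"
    and max: "\<And>w. w \<in> ball z e \<Longrightarrow> f w \<le> f z" and w: "w \<in> ball z e"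
  shows "f w = f z"
proof -
  let ?B = "ball z e" and ?P = "pderiv_dir 1 f" and ?Q = "pderiv_dir \<i> f"
  have z: "z \<in> ?B" using w by (metis ball_eq_empty centre_in_ball empty_iff not_le)
  note D = ck_on_2D[OF f]
  define h where "h x = complex_of_real (?P x) - \<i> * complex_of_real (?Q x)" for x
  have "(h has_field_derivative (of_real (pderiv_dir 1 ?P x) - \<i> * of_real (pderiv_dir \<i> ?P x))) (at x)"
    if x: "x \<in> ?B" for x
  proof -
    have Q: "pderiv_dir 1 ?Q x = pderiv_dir \<i> ?P x" "pderiv_dir \<i> ?Q x = - pderiv_dir 1 ?P x"
      using mixed_partials_sym[OF open_ball x f] lap[OF x] by (simp_all add: flat_lap_def)
    have "(h has_derivative (\<lambda>k. of_real (Re k * pderiv_dir 1 ?P x + Im k * pderiv_dir \<i> ?P x)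
       - \<i> * of_real (Re k * pderiv_dir 1 ?Q x + Im k * pderiv_dir \<i> ?Q x))) (at x)"
      unfolding h_def[abs_def]
      by (intro has_derivative_diff has_derivative_mult_right has_derivative_of_real
          has_derivative_pderiv_dir D x)
    also have "(\<lambda>k. of_real (Re k * pderiv_dir 1 ?P x + Im k * pderiv_dir \<i> ?P x)
       - \<i> * of_real (Re k * pderiv_dir 1 ?Q x + Im k * pderiv_dir \<i> ?Q x)) =
       (*) (of_real (pderiv_dir 1 ?P x) - \<i> * of_real (pderiv_dir \<i> ?P x))"
      unfolding Q by (simp add: fun_eq_iff complex_eq_iff algebra_simps)
    finally show ?thesis by (simp add: has_field_derivative_def)
  qed
  then have "h holomorphic_on ?B" unfolding holomorphic_on_open[OF open_ball] by blast
  then obtain G where G: "\<And>x. x \<in> ?B \<Longrightarrow> (G has_field_derivative h x) (at x within ?B)"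
    using holomorphic_convex_primitive'[of ?B h] by auto
  then have G': "(G has_field_derivative h x) (at x)" if "x \<in> ?B" for x
    using that by (simp add: at_within_open[OF _ open_ball])
  have const: "f x - Re (G x) = f z - Re (G z)" if x: "x \<in> ?B" for x
  proof (rule has_derivative_zero_unique[OF convex_ball _ x z])
    fix y assume y: "y \<in> ?B"
    have "((\<lambda>x. f x - Re (G x)) has_derivative
        (\<lambda>k. (Re k * ?P y + Im k * ?Q y) - Re (h y * k))) (at y)"
      using G'[OF y] by (intro has_derivative_diff has_derivative_pderiv_dir D y has_derivative_Re)
        (simp add: has_field_derivative_def)
    also have "(\<lambda>k. (Re k * ?P y + Im k * ?Q y) - Re (h y * k)) = (\<lambda>k. 0)"
      by (simp add: h_def fun_eq_iff)
    finally show "((\<lambda>x. f x - Re (G x)) has_derivative (\<lambda>k. 0)) (at y within ?B)"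
      by (rule has_derivative_at_withinI)
  qed
  have "G holomorphic_on ?B" using G' unfolding holomorphic_on_open[OF open_ball] by blast
  then have "(\<lambda>x. exp (G x)) holomorphic_on ?B" by (intro holomorphic_intros)
  then have "(\<lambda>x. exp (G x)) constant_on ?B"
  proof (rule maximum_modulus_principle[OF _ open_ball connected_ball open_ball subset_refl z])
    show "norm (exp (G x)) \<le> norm (exp (G z))" if "x \<in> ?B" for x
      using max[OF that] const[OF that] by simp
  qed
  then have "exp (G w) = exp (G z)" using w z unfolding constant_on_def by auto
  then have "norm (exp (G w)) = norm (exp (G z))" by simp
  then have "Re (G w) = Re (G z)" by simp
  with const[OF w] show ?thesis by simp
qed

text \<open>Along the line through \<open>z\<close> the first derivative is 0 at the maximum; a
  positive second derivative would make it positive just to the right, and the function would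
  grow.\<close>

lemma second_derivative_at_maximum:
  fixes f :: "complex \<Rightarrow> real"
  assumes U: "open U" "z \<in> U" and f: "\<And>x. x \<in> U \<Longrightarrow> f differentiable (at x)"
    and D: "pderiv_dir v f differentiable (at z)" and max: "\<And>x. x \<in> U \<Longrightarrow> f x \<le> f z"
  shows "pderiv_dir v (pderiv_dir v f) z \<le> 0"
proof (rule ccontr)
  let ?g = "pderiv_dir v f"
  assume "\<not> ?thesis"
  then have pos: "pderiv_dir v ?g z > 0" by simp
  define l where "l u = z + u *\<^sub>R v" for u
  have l: "(l has_derivative (\<lambda>k. k *\<^sub>R v)) (at u)" for u
    unfolding l_def[abs_def] by (auto intro!: derivative_eq_intros)
  have line: "((\<lambda>u. F (l u)) has_real_derivative pderiv_dir v F (l u)) (at u)"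
    if "F differentiable (at (l u))" for F u
  proof -
    have "((\<lambda>u. F (l u)) has_derivative (\<lambda>k. pderiv_dir (k *\<^sub>R v) F (l u))) (at u)"
      by (rule has_derivative_compose[OF l pderiv_dir_has_derivative[OF that]])
    moreover have "pderiv_dir (k *\<^sub>R v) F (l u) = pderiv_dir v F (l u) * k" for k
      using linear_scale[OF linear_frechet_derivative[OF that], of k v] by (simp add: pderiv_dir_def)
    ultimately show ?thesis by (simp add: has_field_derivative_def)
  qed
  have l0: "l 0 = z" by (simp add: l_def)
  have "open (l -` U)"
    by (rule open_vimage[OF U(1)]) (auto simp: l_def intro!: continuous_intros)
  then obtain d1 where d1: "d1 > 0" "ball 0 d1 \<subseteq> l -` U"
    using U(2) l0 open_contains_ball by (metis vimage_eq)
  have lU: "l u \<in> U" if "\<bar>u\<bar> < d1" for u using d1(2) that by auto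
  have g0: "?g z = 0"
  proof (rule DERIV_local_max[OF _ d1(1)])
    show "((\<lambda>u. f (l u)) has_real_derivative ?g z) (at 0)"
      using line[of f 0] f[OF U(2)] l0 by simp
    show "\<forall>y. \<bar>0 - y\<bar> < d1 \<longrightarrow> f (l y) \<le> f (l 0)" using max lU l0 by simp
  qed
  have "((\<lambda>u. ?g (l u)) has_real_derivative pderiv_dir v ?g z) (at 0)"
    using line[of ?g 0] D l0 by simp
  from DERIV_pos_inc_right[OF this pos] obtain d2 where
    d2: "d2 > 0" "\<And>h. 0 < h \<Longrightarrow> h < d2 \<Longrightarrow> ?g (l h) > 0" using g0 l0 by auto
  define s where "s = min d1 d2 / 2"
  have s: "0 < s" "s < d1" "s < d2" using d1(1) d2(1) by (auto simp: s_def)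
  obtain \<xi> where "0 < \<xi>" "\<xi> < s" "f (l s) - f (l 0) = (s - 0) * ?g (l \<xi>)"
    using MVT2[OF s(1), of "\<lambda>u. f (l u)" "\<lambda>u. ?g (l u)"] line[OF f[OF lU]] s by auto
  then have "f (l s) - f (l 0) > 0" using d2(2)[of \<xi>] s by simp
  with max[OF lU[of s]] s l0 show False by simp
qed

section \<open>The Laplacian on a compact Riemann surface\<close>

lemma surfaceD:
  assumes "compact_riemann_surface A"
  shows "compact (UNIV :: 's::t2_space set)" "connected (UNIV :: 's set)" "(\<Union>c\<in>A. fst c) = (UNIV :: 's set)"
    "\<And>c. c \<in> A \<Longrightarrow> open (fst c)" "\<And>c. c \<in> A \<Longrightarrow> open (snd c ` fst c)"
    "\<And>c. c \<in> A \<Longrightarrow> homeomorphism (fst c) (snd c ` fst c) (snd c) (cinv c)"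
    "\<And>c c'. c \<in> A \<Longrightarrow> c' \<in> A \<Longrightarrow> (snd c' \<circ> cinv c) holomorphic_on snd c ` (fst c \<inter> fst c')"
  using assms unfolding compact_riemann_surface_def by auto

lemma chart_at_works:
  assumes "compact_riemann_surface A"
  shows "chart_at A p \<in> A" "p \<in> fst (chart_at A p)"
proof -
  have "\<exists>c. c \<in> A \<and> p \<in> fst c" using surfaceD(3)[OF assms] by blast
  then have "chart_at A p \<in> A \<and> p \<in> fst (chart_at A p)"
    unfolding chart_at_def by (rule someI_ex)
  then show "chart_at A p \<in> A" "p \<in> fst (chart_at A p)" by auto
qed

lemma cinv_chart:
  assumes "compact_riemann_surface A" "c \<in> A" "p \<in> fst c"
  shows "cinv c (snd c p) = p"
  using surfaceD(6)[OF assms(1,2)] assms(3) by (simp add: homeomorphism_def)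

lemma ck_on_subset: "ck_on k V f \<Longrightarrow> U \<subseteq> V \<Longrightarrow> ck_on k U f"
  by (induction k arbitrary: f) (auto intro: continuous_on_subset)

lemma kaehler_metric_pos: "kaehler_metric A \<rho> \<Longrightarrow> c \<in> A \<Longrightarrow> p \<in> fst c \<Longrightarrow> \<rho> c p > 0"
  unfolding kaehler_metric_def by blast

lemma surface_ck_UNIV: "surface_ck A k UNIV u \<longleftrightarrow> (\<forall>c\<in>A. ck_on k (snd c ` fst c) (u \<circ> cinv c))"
  by (simp add: surface_ck_def)

text \<open>\<open>laplacian\<close> evaluates each point in its own chosen chart. This carries its
  vanishing over to all points of one fixed chart, where local arguments take place.\<close>

lemma flat_laplacian_transform:
  assumes A: "compact_riemann_surface A" and u: "surface_ck A 2 UNIV u"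
    and c: "c \<in> A" "c' \<in> A" "p \<in> fst c" "p \<in> fst c'"
  shows "flat_laplacian c u p = (cmod (dcoord c c' p))\<^sup>2 * flat_laplacian c' u p"
proof -
  let ?U = "snd c ` (fst c \<inter> fst c')" and ?\<psi> = "snd c' \<circ> cinv c"
  have "openin (top_of_set (snd c ` fst c)) ?U"
    by (rule homeomorphism_imp_open_map[OF surfaceD(6)[OF A c(1)]])
      (use surfaceD(4)[OF A c(2)] in \<open>simp add: openin_open_Int\<close>)
  then have U: "open ?U" using surfaceD(5)[OF A c(1)] openin_open_trans by blast
  have \<psi>: "?\<psi> (snd c p) = snd c' p" by (simp add: cinv_chart[OF A c(1,3)])
  have "flat_lap (u \<circ> cinv c) (snd c p) =
      (cmod (deriv ?\<psi> (snd c p)))\<^sup>2 * flat_lap (u \<circ> cinv c') (?\<psi> (snd c p))"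
  proof (rule flat_lap_conformal[OF U surfaceD(5)[OF A c(2)] surfaceD(7)[OF A c(1,2)]])
    show "?\<psi> ` ?U \<subseteq> snd c' ` fst c'" using cinv_chart[OF A c(1)] by auto
    show "ck_on 2 (snd c' ` fst c') (u \<circ> cinv c')" using u c(2) by (simp add: surface_ck_UNIV)
    show "(u \<circ> cinv c) w = (u \<circ> cinv c') (?\<psi> w)" if "w \<in> ?U" for w
      using that cinv_chart[OF A c(1)] cinv_chart[OF A c(2)] by auto
    show "snd c p \<in> ?U" using c(3,4) by blast
  qed
  then show ?thesis unfolding \<psi> by (simp add: flat_laplacian_eq dcoord_def)
qed

lemma surface_ck_lincomb:
  assumes A: "compact_riemann_surface A" and "surface_ck A k UNIV u" "surface_ck A k UNIV v"
  shows "surface_ck A k UNIV (\<lambda>p. a * u p + v p)"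
  unfolding surface_ck_UNIV
proof
  fix c assume c: "c \<in> A"
  have "ck_on k (snd c ` fst c) (u \<circ> cinv c)" "ck_on k (snd c ` fst c) (v \<circ> cinv c)"
    using assms(2,3) c by (simp_all only: surface_ck_UNIV)
  from ck_on_lincomb[OF surfaceD(5)[OF A c] this, of a] show "ck_on k (snd c ` fst c) ((\<lambda>p. a * u p + v p) \<circ> cinv c)" by (simp add: comp_def)
qed

lemma surface_ck_const:
  assumes A: "compact_riemann_surface A"
  shows "surface_ck A k UNIV (\<lambda>p. b)"
  unfolding surface_ck_UNIV using ck_on_const[OF surfaceD(5)[OF A]] by (simp add: comp_def)

lemma laplacian_lincomb:
  assumes A: "compact_riemann_surface A" and u: "surface_ck A 2 UNIV u" and v: "surface_ck A 2 UNIV v"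
  shows "laplacian A \<rho> (\<lambda>p. a * u p + v p) p = a * laplacian A \<rho> u p + laplacian A \<rho> v p"
proof -
  define c where "c = chart_at A p"
  have c: "c \<in> A" "p \<in> fst c" using chart_at_works[OF A] by (simp_all add: c_def)
  have "snd c p \<in> snd c ` fst c" "ck_on 2 (snd c ` fst c) (u \<circ> cinv c)" "ck_on 2 (snd c ` fst c) (v \<circ> cinv c)"
    using u v c by (simp_all only: surface_ck_UNIV imageI)
  from flat_lap_lincomb[OF surfaceD(5)[OF A c(1)] this, of a] have "flat_laplacian c (\<lambda>p. a * u p + v p) p = a * flat_laplacian c u p + flat_laplacian c v p"
    by (simp add: flat_laplacian_eq comp_def)
  then show ?thesis
    by (simp add: laplacian_def c_def[symmetric] Let_def minus_divide_left[symmetric] add_divide_distrib)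
qed

lemma laplacian_const: "laplacian A \<rho> (\<lambda>p. b) p = 0"
  by (simp add: laplacian_def Let_def flat_laplacian_eq comp_def flat_lap_const)

lemma laplacian_sum:
  assumes A: "compact_riemann_surface A" and "finite J"
    and "\<And>j. j \<in> J \<Longrightarrow> surface_ck A 2 UNIV (w j)"
  shows "surface_ck A 2 UNIV (\<lambda>p. \<Sum>j\<in>J. k j * w j p)"
    and "laplacian A \<rho> (\<lambda>p. \<Sum>j\<in>J. k j * w j p) p = (\<Sum>j\<in>J. k j * laplacian A \<rho> (w j) p)"
proof -
  have "surface_ck A 2 UNIV (\<lambda>p. \<Sum>j\<in>J. k j * w j p) \<and>
    laplacian A \<rho> (\<lambda>p. \<Sum>j\<in>J. k j * w j p) p = (\<Sum>j\<in>J. k j * laplacian A \<rho> (w j) p)"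
    using assms(2,3)
  proof (induction rule: finite_induct)
    case (insert j J)
    then show ?case
      using surface_ck_lincomb[OF A, of 2 "w j" "\<lambda>p. \<Sum>j\<in>J. k j * w j p" "k j"]
        laplacian_lincomb[OF A, of "w j" "\<lambda>p. \<Sum>j\<in>J. k j * w j p" \<rho> "k j" p] by simp
  qed (simp add: surface_ck_const[OF A] laplacian_const)
  then show "surface_ck A 2 UNIV (\<lambda>p. \<Sum>j\<in>J. k j * w j p)"
    "laplacian A \<rho> (\<lambda>p. \<Sum>j\<in>J. k j * w j p) p = (\<Sum>j\<in>J. k j * laplacian A \<rho> (w j) p)" by auto
qed

lemma surface_ck_continuous:
  assumes A: "compact_riemann_surface A" and u: "surface_ck A 2 UNIV u"
  shows "continuous_on UNIV u"
proof -
  have "isCont u p" for p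
  proof -
    define c where "c = chart_at A p"
    have c: "c \<in> A" "p \<in> fst c" using chart_at_works[OF A] by (simp_all add: c_def)
    have ck: "ck_on 2 (snd c ` fst c) (u \<circ> cinv c)" using u c by (simp add: surface_ck_UNIV)
    have "continuous_on (snd c ` fst c) (u \<circ> cinv c)"
      using ck_on_2D(1)[OF ck] differentiable_imp_continuous_within
      by (intro continuous_at_imp_continuous_on) blast
    moreover have "continuous_on (fst c) (snd c)"
      using surfaceD(6)[OF A c(1)] by (simp add: homeomorphism_def)
    ultimately have "continuous_on (fst c) ((u \<circ> cinv c) \<circ> snd c)"
      by (rule continuous_on_compose[rotated])
    then have "continuous_on (fst c) u"
      by (rule continuous_on_cong[THEN iffD1, OF refl, rotated]) (simp add: cinv_chart[OF A c(1)])
    then show "isCont u p"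
      using continuous_on_eq_continuous_at[OF surfaceD(4)[OF A c(1)]] c(2) by blast
  qed
  then show ?thesis by (simp add: continuous_at_imp_continuous_on)
qed

section \<open>The maximum principle on the surface\<close>

lemma laplacian_at_maximum:
  assumes A: "compact_riemann_surface A" and \<rho>: "kaehler_metric A \<rho>"
    and u: "surface_ck A 2 UNIV u" and max: "\<And>x. u x \<le> u p"
  shows "laplacian A \<rho> u p \<ge> 0"
proof -
  define c where "c = chart_at A p"
  have c: "c \<in> A" "p \<in> fst c" using chart_at_works[OF A] by (simp_all add: c_def)
  let ?U = "snd c ` fst c" and ?f = "u \<circ> cinv c"
  have U: "open ?U" "snd c p \<in> ?U" using surfaceD(5)[OF A c(1)] c by auto
  have ck: "ck_on 2 ?U ?f" using u c by (simp add: surface_ck_UNIV)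
  have m: "?f x \<le> ?f (snd c p)" for x using max by (simp add: cinv_chart[OF A c])
  have "flat_lap ?f (snd c p) \<le> 0"
    unfolding flat_lap_def
    by (intro add_nonpos_nonpos second_derivative_at_maximum[OF U ck_on_2D(1)[OF ck]]
        ck_on_2D[OF ck U(2)] m)
  moreover have "\<rho> c p > 0" by (rule kaehler_metric_pos[OF \<rho> c])
  ultimately show ?thesis
    by (simp add: laplacian_def c_def[symmetric] Let_def flat_laplacian_eq divide_nonpos_pos)
qed

text \<open>The set where the maximum is attained is closed by continuity and open by the local
  maximum principle in a chart; connectedness finishes.\<close>

lemma harmonic_constant:
  assumes A: "compact_riemann_surface A" and \<rho>: "kaehler_metric A \<rho>"
    and u: "surface_ck A 2 UNIV u" and harm: "\<And>p. laplacian A \<rho> u p = 0"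
  shows "u p = u q"
proof -
  note cont = surface_ck_continuous[OF A u]
  obtain p0 where p0: "\<And>x. u x \<le> u p0"
    using continuous_attains_sup[OF surfaceD(1)[OF A] _ cont] by auto
  have flat: "flat_laplacian c u x = 0" if "c \<in> A" "x \<in> fst c" for c x
  proof -
    have "\<rho> (chart_at A x) x > 0" by (rule kaehler_metric_pos[OF \<rho> chart_at_works[OF A]])
    then have "flat_laplacian (chart_at A x) u x = 0"
      using harm[of x] by (simp add: laplacian_def Let_def)
    then show ?thesis
      using flat_laplacian_transform[OF A u that(1) chart_at_works(1)[OF A] that(2) chart_at_works(2)[OF A]]
      by simp
  qed
  define Z where "Z = {x. u x = u p0}"
  have "open Z"
    unfolding openin_subopen[of euclidean Z, simplified]
  proof
    fix x assume "x \<in> Z"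
    define c where "c = chart_at A x"
    have c: "c \<in> A" "x \<in> fst c" using chart_at_works[OF A] by (simp_all add: c_def)
    obtain e where e: "e > 0" "ball (snd c x) e \<subseteq> snd c ` fst c"
      using surfaceD(5)[OF A c(1)] c(2) open_contains_ball by (metis imageI)
    let ?f = "u \<circ> cinv c"
    have ck: "ck_on 2 (snd c ` fst c) ?f" using u c by (simp add: surface_ck_UNIV)
    have ckb: "ck_on 2 (ball (snd c x) e) ?f"
      by (rule ck_on_subset[OF ck e(2)])
    have max: "?f w \<le> ?f (snd c x)" for w
      using p0 \<open>x \<in> Z\<close> by (simp add: cinv_chart[OF A c] Z_def)
    have const: "?f w = ?f (snd c x)" if "w \<in> ball (snd c x) e" for w
    proof (rule harmonic_local_maximum[OF ckb _ max that])
      fix w assume "w \<in> ball (snd c x) e"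
      then obtain y where "y \<in> fst c" "w = snd c y" using e(2) by blast
      then show "flat_lap ?f w = 0" using flat[OF c(1)] by (simp add: flat_laplacian_eq)
    qed
    let ?N = "fst c \<inter> snd c -` ball (snd c x) e"
    have "open ?N"
      by (rule continuous_open_preimage[OF _ surfaceD(4)[OF A c(1)] open_ball])
        (use surfaceD(6)[OF A c(1)] in \<open>simp add: homeomorphism_def\<close>)
    moreover have "x \<in> ?N" using c e by simp
    moreover have "?N \<subseteq> Z"
    proof
      fix y assume y: "y \<in> ?N"
      then have "?f (snd c y) = ?f (snd c x)" by (intro const) auto
      then show "y \<in> Z" using y c \<open>x \<in> Z\<close> by (simp add: cinv_chart[OF A c(1)] Z_def)
    qed
    ultimately show "\<exists>T. open T \<and> x \<in> T \<and> T \<subseteq> Z" by blast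
  qed
  moreover have "closed Z"
    unfolding Z_def by (rule closed_Collect_eq[OF cont continuous_on_const])
  ultimately have "Z = {} \<or> Z = UNIV"
    using surfaceD(2)[OF A] by (simp add: connected_clopen)
  then have "Z = UNIV" unfolding Z_def by blast
  then have "u x = u p0" for x unfolding Z_def by blast
  then show ?thesis by metis
qed

text \<open>The sign of \<open>k\<close> is read off at a maximum of \<open>u\<close> and at a
  minimum, that is at a maximum of \<open>- u\<close>. This replaces integrating the equation over
  the surface.\<close>

lemma constant_laplacian:
  assumes A: "compact_riemann_surface A" and \<rho>: "kaehler_metric A \<rho>"
    and u: "surface_ck A 2 UNIV u" and lap: "\<And>p. laplacian A \<rho> u p = k"
  shows "k = 0" "u p = u q"
proof -
  note cont = surface_ck_continuous[OF A u]
  obtain p0 where "\<And>x. u x \<le> u p0"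
    using continuous_attains_sup[OF surfaceD(1)[OF A] _ cont] by auto
  from laplacian_at_maximum[OF A \<rho> u this] have "k \<ge> 0" by (simp add: lap)
  obtain p1 where p1: "\<And>x. u p1 \<le> u x"
    using continuous_attains_inf[OF surfaceD(1)[OF A] _ cont] by auto
  have "laplacian A \<rho> (\<lambda>p. -1 * u p + 0) p1 \<ge> 0"
    by (rule laplacian_at_maximum[OF A \<rho> surface_ck_lincomb[OF A u surface_ck_const[OF A]]])
      (simp add: p1)
  then have "k \<le> 0"
    unfolding laplacian_lincomb[OF A u surface_ck_const[OF A]] by (simp add: lap laplacian_const)
  with \<open>k \<ge> 0\<close> show "k = 0" by simp
  then show "u p = u q" using harmonic_constant[OF A \<rho> u] lap by simp
qed

section \<open>Cartan matrices\<close>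

text \<open>Elimination of one index at a time. The vector \<open>y\<close>, with entry 1 at
  \<open>a\<close>, is orthogonal to the old indices, and its value \<open>s\<close> against
  \<open>a\<close> is its own norm, the Schur complement, hence positive.\<close>

lemma positive_definite_solve:
  fixes G :: "nat \<Rightarrow> nat \<Rightarrow> real"
  assumes "finite J" and sym: "\<And>i j. G i j = G j i"
    and pos: "\<And>c. \<exists>i\<in>J. c i \<noteq> 0 \<Longrightarrow> (\<Sum>i\<in>J. \<Sum>j\<in>J. c i * c j * G i j) > 0"
  shows "\<exists>x. \<forall>k\<in>J. (\<Sum>j\<in>J. x j * G j k) = v k"
  using assms(1) pos
proof (induction arbitrary: v rule: finite_induct)
  case (insert a J)
  have restrict: "(\<Sum>i\<in>J. \<Sum>j\<in>J. c i * c j * G i j) > 0" if c: "\<exists>i\<in>J. c i \<noteq> 0" for c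
  proof -
    let ?c = "\<lambda>i. if i = a then 0 else c i"
    have "(\<Sum>i\<in>insert a J. \<Sum>j\<in>insert a J. ?c i * ?c j * G i j) > 0"
      using c insert.hyps by (intro insert.prems) auto
    also have "(\<Sum>i\<in>insert a J. \<Sum>j\<in>insert a J. ?c i * ?c j * G i j) =
        (\<Sum>i\<in>J. \<Sum>j\<in>J. ?c i * ?c j * G i j)"
      using insert.hyps by simp
    also have "\<dots> = (\<Sum>i\<in>J. \<Sum>j\<in>J. c i * c j * G i j)"
      using insert.hyps by (intro sum.cong) auto
    finally show ?thesis .
  qed
  obtain x where x: "\<And>k. k \<in> J \<Longrightarrow> (\<Sum>j\<in>J. x j * G j k) = G a k"
    using insert.IH[OF restrict, of "G a"] by blast
  obtain z where z: "\<And>k. k \<in> J \<Longrightarrow> (\<Sum>j\<in>J. z j * G j k) = v k"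
    using insert.IH[OF restrict, of v] by blast
  define y where "y j = (if j = a then 1 else - x j)" for j
  have yJ: "(\<Sum>j\<in>insert a J. y j * G j k) = G a k - (\<Sum>j\<in>J. x j * G j k)" for k
  proof -
    have "(\<Sum>j\<in>J. y j * G j k) = (\<Sum>j\<in>J. - (x j * G j k))"
      using insert.hyps by (intro sum.cong) (auto simp: y_def)
    then show ?thesis using insert.hyps by (simp add: y_def sum_negf)
  qed
  have y0: "(\<Sum>j\<in>insert a J. y j * G j k) = 0" if "k \<in> J" for k
    unfolding yJ by (simp add: x that)
  define s where "s = (\<Sum>j\<in>insert a J. y j * G j a)"
  have "(\<Sum>i\<in>insert a J. \<Sum>j\<in>insert a J. y i * y j * G i j) =
      (\<Sum>i\<in>insert a J. y i * (\<Sum>j\<in>insert a J. y j * G j i))"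
    by (simp only: sum_distrib_left mult.assoc sym)
  also have "\<dots> = y a * s"
    using insert.hyps y0 by (simp only: sum.insert s_def) simp
  finally have "(\<Sum>i\<in>insert a J. \<Sum>j\<in>insert a J. y i * y j * G i j) = s" by (simp add: y_def)
  moreover have "(\<Sum>i\<in>insert a J. \<Sum>j\<in>insert a J. y i * y j * G i j) > 0"
    by (rule insert.prems) (auto simp: y_def)
  ultimately have s: "s > 0" by simp
  \<comment> \<open>Adding a multiple of \<open>y\<close> leaves the equations on \<open>J\<close>
    intact; this multiple repairs the equation at \<open>a\<close>.\<close>
  define q where "q = (v a - (\<Sum>j\<in>J. z j * G j a)) / s"
  let ?w = "\<lambda>j. (if j = a then 0 else z j) + q * y j"
  have w: "(\<Sum>j\<in>insert a J. ?w j * G j k) = (\<Sum>j\<in>J. z j * G j k) + q * (\<Sum>j\<in>insert a J. y j * G j k)" for k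
  proof -
    have "(\<Sum>j\<in>insert a J. ?w j * G j k) = (\<Sum>j\<in>insert a J. (if j = a then 0 else z j) * G j k)
        + q * (\<Sum>j\<in>insert a J. y j * G j k)"
      unfolding sum_distrib_left sum.distrib[symmetric] by (simp only: distrib_right mult.assoc)
    also have "(\<Sum>j\<in>insert a J. (if j = a then 0 else z j) * G j k) = (\<Sum>j\<in>J. z j * G j k)"
    proof -
      have "(\<Sum>j\<in>J. (if j = a then 0 else z j) * G j k) = (\<Sum>j\<in>J. z j * G j k)"
        using insert.hyps by (intro sum.cong) auto
      then show ?thesis using insert.hyps by simp
    qed
    finally show ?thesis .
  qed
  have "(\<Sum>j\<in>insert a J. ?w j * G j k) = v k" if "k \<in> insert a J" for k
  proof (cases "k = a")
    case True
    show ?thesis unfolding w True s_def[symmetric] using s by (simp add: q_def)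
  next
    case False
    then have "k \<in> J" using that by simp
    then show ?thesis unfolding w by (simp add: y0 z)
  qed
  then show ?case by (intro exI[of _ ?w]) blast
qed simp

text \<open>With weights \<open>1 / G i i\<close> the symmetrised matrix is
  \<open>2 * G i j / (G i i * G j j)\<close>, twice the Gram matrix of the vectors divided by their
  squared lengths.\<close>

lemma finite_cartan_matrix_gram:
  fixes G :: "nat \<Rightarrow> nat \<Rightarrow> real"
  assumes S: "finite S" and C: "\<And>i j. C i j = 2 * G i j / G j j" and sym: "\<And>i j. G i j = G j i"
    and diag: "\<And>i. i \<in> S \<Longrightarrow> G i i > 0"
    and int: "\<And>i j. i \<in> S \<Longrightarrow> j \<in> S \<Longrightarrow> C i j \<in> \<int>"
    and nonpos: "\<And>i j. i \<in> S \<Longrightarrow> j \<in> S \<Longrightarrow> i \<noteq> j \<Longrightarrow> G i j \<le> 0"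
    and pos: "\<And>c. \<exists>i\<in>S. c i \<noteq> 0 \<Longrightarrow> (\<Sum>i\<in>S. \<Sum>j\<in>S. c i * c j * G i j) > 0"
  shows "finite_cartan_matrix C S"
  unfolding finite_cartan_matrix_def
proof (intro conjI ballI impI exI[of _ "\<lambda>i. 1 / G i i"] allI)
  show "C i i = 2" if "i \<in> S" for i using diag[OF that] by (simp add: C)
  show "C i j \<in> \<int>" if "i \<in> S" "j \<in> S" for i j using int that by blast
  show "C i j \<le> 0" if "i \<in> S" "j \<in> S" "i \<noteq> j" for i j
    using diag[OF that(2)] nonpos[OF that] by (simp add: C divide_nonpos_pos)
  show "C i j = 0 \<longleftrightarrow> C j i = 0" if "i \<in> S" "j \<in> S" for i j
    using diag[OF that(1)] diag[OF that(2)] sym[of i j] by (simp add: C)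
  show "1 / G i i > 0" if "i \<in> S" for i using diag[OF that] by simp
  show "1 / G i i * C i j = 1 / G j j * C j i" if "i \<in> S" "j \<in> S" for i j
    using sym[of i j] by (simp add: C)
  show "(\<Sum>i\<in>S. \<Sum>j\<in>S. x i * (1 / G i i * C i j) * x j) > 0" if x: "\<exists>i\<in>S. x i \<noteq> 0" for x
  proof -
    have "(\<Sum>i\<in>S. \<Sum>j\<in>S. x i * (1 / G i i * C i j) * x j) =
        2 * (\<Sum>i\<in>S. \<Sum>j\<in>S. (x i / G i i) * (x j / G j j) * G i j)"
      unfolding sum_distrib_left by (intro sum.cong) (simp_all add: C mult_ac)
    moreover have "\<exists>i\<in>S. x i / G i i \<noteq> 0" using x diag by fastforce
    ultimately show ?thesis using pos[of "\<lambda>i. x i / G i i"] by simp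
  qed
qed (rule S)

section \<open>Connected components of a diagram\<close>

lemma diagram_components_subset:
  "S \<in> diagram_components C J \<Longrightarrow> S \<subseteq> J"
proof -
  assume "S \<in> diagram_components C J"
  then obtain j where j: "j \<in> J"
    "S = {k. (j, k) \<in> {(x, y). x \<in> J \<and> y \<in> J \<and> x \<noteq> y \<and> C x y \<noteq> 0}\<^sup>*}"
    by (auto simp: diagram_components_def)
  have "k \<in> J" if "(j, k) \<in> {(x, y). x \<in> J \<and> y \<in> J \<and> x \<noteq> y \<and> C x y \<noteq> 0}\<^sup>*" for k
    using that j(1) by (induction rule: rtrancl_induct) auto
  then show ?thesis unfolding j(2) by blast
qed

lemma diagram_components_cover: "\<Union> (diagram_components C J) = J"
proof
  show "\<Union> (diagram_components C J) \<subseteq> J" using diagram_components_subset[of _ C J] by blast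
  show "J \<subseteq> \<Union> (diagram_components C J)" by (auto simp: diagram_components_def)
qed

lemma diagram_components_closed:
  assumes "S \<in> diagram_components C J" "j \<in> S" "k \<in> J" "j \<noteq> k" "C j k \<noteq> 0"
  shows "k \<in> S"
proof -
  obtain i where i: "S = {k. (i, k) \<in> {(x, y). x \<in> J \<and> y \<in> J \<and> x \<noteq> y \<and> C x y \<noteq> 0}\<^sup>*}"
    using assms(1) by (auto simp: diagram_components_def)
  have "j \<in> J" using assms(1,2) diagram_components_subset[of S C J] by blast
  with assms(2-) show ?thesis unfolding i by (auto intro: rtrancl_into_rtrancl)
qed

text \<open>A path in \<open>J\<close> from the base point never leaves the component, so it is a
  path in \<open>S\<close> as well; symmetry makes every vertex of \<open>S\<close> an equally good
  base point.\<close>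

lemma diagram_component_connected:
  assumes sym: "\<And>i j. i \<in> J \<Longrightarrow> j \<in> J \<Longrightarrow> C i j = 0 \<longleftrightarrow> C j i = 0"
    and S: "S \<in> diagram_components C J"
  shows "S \<noteq> {}" "diagram_components C S = {S}"
proof -
  let ?R = "\<lambda>J. {(x, y). x \<in> J \<and> y \<in> J \<and> x \<noteq> y \<and> C x y \<noteq> 0}"
  obtain i where i: "i \<in> J" "S = {k. (i, k) \<in> (?R J)\<^sup>*}"
    using S by (auto simp: diagram_components_def)
  have SJ: "S \<subseteq> J" by (rule diagram_components_subset[OF S])
  have "i \<in> S" by (simp add: i(2))
  then show "S \<noteq> {}" by blast
  have reach: "(i, k) \<in> (?R S)\<^sup>*" if "(i, k) \<in> (?R J)\<^sup>*" for k
    using that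
  proof (induction rule: rtrancl_induct)
    case (step y z)
    then have "y \<in> S" "z \<in> S" unfolding i(2) by (auto intro: rtrancl_into_rtrancl)
    with step show ?case by (auto intro: rtrancl_into_rtrancl)
  qed simp
  have "sym (?R S)" using sym SJ by (intro symI) blast
  then have symS: "sym ((?R S)\<^sup>*)" by (rule sym_rtrancl)
  have "{k. (j, k) \<in> (?R S)\<^sup>*} = S" if j: "j \<in> S" for j
  proof
    show "{k. (j, k) \<in> (?R S)\<^sup>*} \<subseteq> S"
    proof
      fix k assume "k \<in> {k. (j, k) \<in> (?R S)\<^sup>*}"
      then have "(j, k) \<in> (?R S)\<^sup>*" by simp
      then show "k \<in> S" using j by (induction rule: rtrancl_induct) auto
    qed
    show "S \<subseteq> {k. (j, k) \<in> (?R S)\<^sup>*}"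
    proof
      fix k assume k: "k \<in> S"
      have "(i, j) \<in> (?R S)\<^sup>*" "(i, k) \<in> (?R S)\<^sup>*"
        using reach j k unfolding i(2) by blast+
      with symS show "k \<in> {k. (j, k) \<in> (?R S)\<^sup>*}" by (auto dest: symD intro: rtrancl_trans)
    qed
  qed
  then show "diagram_components C S = {S}"
    unfolding diagram_components_def using \<open>i \<in> S\<close> by auto
qed

section \<open>Reduction of the Toda equations\<close>

text \<open>No root theory remains here: \<kappa>, the identity for the marks and the vanishing of
  \<open>q\<close> outside \<open>J\<close> are hypotheses. Everything rests on the defects
  \<open>v l\<close>, whose Laplacians are constant for affine solutions and which are themselves
  constant under the reduced system.\<close>

lemma toda_reduction:
  fixes w q :: "nat \<Rightarrow> 's::t2_space \<Rightarrow> real" and C \<kappa> :: "nat \<Rightarrow> nat \<Rightarrow> real" and d :: "nat \<Rightarrow> int"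
  assumes A: "compact_riemann_surface A" and \<rho>: "kaehler_metric A \<rho>"
    and J: "J \<subseteq> {0..r}"
    and q0: "\<And>k p. k \<in> {0..r} - J \<Longrightarrow> q k p = 0"
    and \<kappa>: "\<And>l k. l \<in> {0..r} - J \<Longrightarrow> k \<in> J \<Longrightarrow> C l k = (\<Sum>j\<in>J. \<kappa> l j * C j k)"
    and m\<kappa>: "\<And>j. j \<in> J \<Longrightarrow> (\<Sum>l\<in>{0..r} - J. m l * \<kappa> l j) = - m j"
    and w: "\<And>j. j \<in> {0..r} \<Longrightarrow> surface_ck A 2 UNIV (w j)"
  shows "(\<forall>p. (\<Sum>j\<in>{0..r}. m j * w j p) = 0) \<and> toda_equations A \<rho> lab C q d {0..r} w \<longleftrightarrow>
     (\<forall>S\<in>diagram_components C J. toda_equations A \<rho> lab C q d S w) \<and>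
     (\<forall>l\<in>{0..r} - J. of_int (d l) = (\<Sum>j\<in>J. \<kappa> l j * of_int (d j))) \<and>
     (\<exists>b. (\<Sum>l\<in>{0..r} - J. m l * b l) = 0 \<and>
          (\<forall>l\<in>{0..r} - J. \<forall>p. w l p = (\<Sum>j\<in>J. \<kappa> l j * w j p) + b l))"
    (is "?affine \<longleftrightarrow> ?reduced")
proof -
  let ?K = "{0..r} - J"
  have fin: "finite J" using J finite_subset by blast
  define part where "part s j p = (\<Sum>k\<in>{k\<in>J. lab k = s}. q k p * exp (w k p) * C j k)" for s j p
  define R where "R j p = part 1 j p - part (-1) j p" for j p
  have full: "(\<Sum>k\<in>{k\<in>{0..r}. lab k = s}. q k p * exp (w k p) * C j k) = part s j p" for s j p
    unfolding part_def using J q0 by (intro sum.mono_neutral_right) auto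
  have component: "(\<Sum>k\<in>{k\<in>S. lab k = s}. q k p * exp (w k p) * C j k) = part s j p"
    if S: "S \<in> diagram_components C J" and j: "j \<in> S" for S s j p
    unfolding part_def
  proof (rule sum.mono_neutral_left)
    show "{k \<in> S. lab k = s} \<subseteq> {k \<in> J. lab k = s}" using diagram_components_subset[OF S] by blast
    \<comment> \<open>A nonzero \<open>C j k\<close> would put \<open>k\<close> into the component
      of \<open>j\<close>, so the system on a component is closed.\<close>
    show "\<forall>k\<in>{k \<in> J. lab k = s} - {k \<in> S. lab k = s}. q k p * exp (w k p) * C j k = 0"
      using diagram_components_closed[OF S j] j by auto
  qed (use fin in simp)
  have affine_iff: "toda_equations A \<rho> lab C q d {0..r} w \<longleftrightarrow>
      (\<forall>j\<in>{0..r}. \<forall>p. laplacian A \<rho> (w j) p = R j p - of_int (d j))"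
    unfolding toda_equations_def full R_def ..
  have "(\<forall>S\<in>diagram_components C J. toda_equations A \<rho> lab C q d S w) \<longleftrightarrow>
      (\<forall>S\<in>diagram_components C J. \<forall>j\<in>S. \<forall>p. laplacian A \<rho> (w j) p = R j p - of_int (d j))"
    unfolding toda_equations_def R_def by (intro ball_cong refl) (simp add: component)
  also have "\<dots> \<longleftrightarrow> (\<forall>j\<in>\<Union> (diagram_components C J). \<forall>p. laplacian A \<rho> (w j) p = R j p - of_int (d j))"
    by blast
  finally have components_iff: "(\<forall>S\<in>diagram_components C J. toda_equations A \<rho> lab C q d S w) \<longleftrightarrow>
      (\<forall>j\<in>J. \<forall>p. laplacian A \<rho> (w j) p = R j p - of_int (d j))"
    unfolding diagram_components_cover .
  have part_\<kappa>: "part s l p = (\<Sum>j\<in>J. \<kappa> l j * part s j p)" if l: "l \<in> ?K" for s l p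
  proof -
    have "part s l p = (\<Sum>k\<in>{k\<in>J. lab k = s}. \<Sum>j\<in>J. \<kappa> l j * (q k p * exp (w k p) * C j k))"
      unfolding part_def by (rule sum.cong) (simp_all add: \<kappa>[OF l] sum_distrib_left mult_ac)
    then show ?thesis unfolding part_def by (subst (asm) sum.swap) (simp add: sum_distrib_left)
  qed
  have R_\<kappa>: "R l p = (\<Sum>j\<in>J. \<kappa> l j * R j p)" if "l \<in> ?K" for l p
    unfolding R_def part_\<kappa>[OF that] by (simp add: right_diff_distrib sum_subtractf)
  define v where "v l p = (-1) * (\<Sum>j\<in>J. \<kappa> l j * w j p) + w l p" for l p
  have wJ: "surface_ck A 2 UNIV (w j)" if "j \<in> J" for j using w J that by blast
  have sum_ck: "surface_ck A 2 UNIV (\<lambda>p. \<Sum>j\<in>J. k j * w j p)"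
    and sum_lap: "laplacian A \<rho> (\<lambda>p. \<Sum>j\<in>J. k j * w j p) p = (\<Sum>j\<in>J. k j * laplacian A \<rho> (w j) p)" for k p
    using laplacian_sum[OF A fin, of w] wJ by blast+
  have v_ck: "surface_ck A 2 UNIV (v l)" if "l \<in> ?K" for l
    unfolding v_def[abs_def] by (rule surface_ck_lincomb[OF A sum_ck w]) (use that in auto)
  have v_lap: "laplacian A \<rho> (v l) p = laplacian A \<rho> (w l) p - (\<Sum>j\<in>J. \<kappa> l j * laplacian A \<rho> (w j) p)"
    if "l \<in> ?K" for l p
  proof -
    have "surface_ck A 2 UNIV (w l)" using that w by blast
    from laplacian_lincomb[OF A sum_ck this, where \<rho> = \<rho> and a = "-1"] show ?thesis
      unfolding v_def[abs_def] sum_lap by simp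
  qed
  \<comment> \<open>By the hypothesis on \<open>m\<close> and \<kappa> all terms with index in
    \<open>J\<close> cancel, so the constraint on \<open>w\<close> concerns the defects
    only.\<close>
  have marks: "(\<Sum>j\<in>{0..r}. m j * w j p) = (\<Sum>l\<in>?K. m l * v l p)" for p
  proof -
    have "(\<Sum>l\<in>?K. m l * (\<Sum>j\<in>J. \<kappa> l j * w j p)) = (\<Sum>j\<in>J. (\<Sum>l\<in>?K. m l * \<kappa> l j) * w j p)"
      unfolding sum_distrib_left sum_distrib_right by (subst sum.swap) (simp add: mult.assoc)
    also have "\<dots> = - (\<Sum>j\<in>J. m j * w j p)" by (simp add: m\<kappa> sum_negf)
    finally have "(\<Sum>l\<in>?K. m l * v l p) = (\<Sum>j\<in>J. m j * w j p) + (\<Sum>l\<in>?K. m l * w l p)"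
      unfolding v_def by (simp add: algebra_simps sum.distrib sum_subtractf)
    then show ?thesis
      using sum.subset_diff[OF J, of "\<lambda>j. m j * w j p"] by simp
  qed
  show ?thesis
  proof
    assume affine: ?affine
    have "\<forall>j\<in>{0..r}. \<forall>p. laplacian A \<rho> (w j) p = R j p - of_int (d j)"
      by (rule affine_iff[THEN iffD1, OF affine[THEN conjunct2]])
    then have eq: "laplacian A \<rho> (w j) p = R j p - of_int (d j)" if "j \<in> {0..r}" for j p
      using that by blast
    have lap: "laplacian A \<rho> (v l) p = (\<Sum>j\<in>J. \<kappa> l j * of_int (d j)) - of_int (d l)" if l: "l \<in> ?K" for l p
    proof -
      have "(\<Sum>j\<in>J. \<kappa> l j * laplacian A \<rho> (w j) p) = (\<Sum>j\<in>J. \<kappa> l j * (R j p - of_int (d j)))"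
        using J by (intro sum.cong) (auto simp: eq)
      also have "\<dots> = R l p - (\<Sum>j\<in>J. \<kappa> l j * of_int (d j))"
        unfolding R_\<kappa>[OF l] by (simp add: right_diff_distrib sum_subtractf)
      finally show ?thesis using v_lap[OF l] eq[of l p] l by simp
    qed
    note const = constant_laplacian[OF A \<rho> v_ck lap]
    have "of_int (d l) = (\<Sum>j\<in>J. \<kappa> l j * of_int (d j))" if "l \<in> ?K" for l
      using const(1)[OF that that] by simp
    moreover have "\<exists>b. (\<Sum>l\<in>?K. m l * b l) = 0 \<and> (\<forall>l\<in>?K. \<forall>p. w l p = (\<Sum>j\<in>J. \<kappa> l j * w j p) + b l)"
    proof (intro exI conjI ballI allI)
      \<comment> \<open>The defects are constant, so their values at an arbitrary point serve as the
        witness for \<open>b\<close>.\<close>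
      show "(\<Sum>l\<in>?K. m l * v l undefined) = 0" using marks[of undefined] affine[THEN conjunct1] by simp
      show "w l p = (\<Sum>j\<in>J. \<kappa> l j * w j p) + v l undefined" if "l \<in> ?K" for l p
        using const(2)[OF that that, of p undefined] by (simp add: v_def)
    qed
    moreover have "\<forall>j\<in>J. \<forall>p. laplacian A \<rho> (w j) p = R j p - of_int (d j)" using eq J by blast
    ultimately show ?reduced unfolding components_iff by simp
  next
    assume reduced: ?reduced
    note red = reduced[THEN conjunct1] reduced[THEN conjunct2, THEN conjunct1]
      reduced[THEN conjunct2, THEN conjunct2]
    from red(3) obtain b where "(\<Sum>l\<in>?K. m l * b l) = 0 \<and>
      (\<forall>l\<in>?K. \<forall>p. w l p = (\<Sum>j\<in>J. \<kappa> l j * w j p) + b l)" by (rule exE)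
    then have b: "(\<Sum>l\<in>?K. m l * b l) = 0"
      "\<And>l p. l \<in> ?K \<Longrightarrow> w l p = (\<Sum>j\<in>J. \<kappa> l j * w j p) + b l" by simp_all
    have eqJ: "laplacian A \<rho> (w j) p = R j p - of_int (d j)" if "j \<in> J" for j p
      using components_iff[THEN iffD1, OF red(1)] that by blast
    have v: "v l = (\<lambda>p. b l)" if "l \<in> ?K" for l
      using b(2)[OF that] by (simp add: v_def fun_eq_iff)
    have eqK: "laplacian A \<rho> (w l) p = R l p - of_int (d l)" if l: "l \<in> ?K" for l p
    proof -
      have "laplacian A \<rho> (w l) p = (\<Sum>j\<in>J. \<kappa> l j * laplacian A \<rho> (w j) p)"
        using v_lap[OF l, of p] by (simp add: v[OF l] laplacian_const)
      also have "\<dots> = (\<Sum>j\<in>J. \<kappa> l j * (R j p - of_int (d j)))" by (simp add: eqJ)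
      also have "\<dots> = R l p - (\<Sum>j\<in>J. \<kappa> l j * of_int (d j))"
        unfolding R_\<kappa>[OF l] by (simp add: right_diff_distrib sum_subtractf)
      also have "(\<Sum>j\<in>J. \<kappa> l j * of_int (d j)) = of_int (d l)"
        using bspec[OF red(2) l] by (rule sym)
      finally show ?thesis .
    qed
    have "(\<Sum>j\<in>{0..r}. m j * w j p) = 0" for p unfolding marks using b(1) v by simp
    moreover have "toda_equations A \<rho> lab C q d {0..r} w" unfolding affine_iff using eqJ eqK by blast
    ultimately show ?affine by (intro conjI allI)
  qed
qed

lemma section_norm2_zero:
  assumes A: "compact_riemann_surface A" and W: "(\<Union>a. W a) = UNIV"
    and H: "hermitian_metric A W \<tau> V H" "v \<in> V" and s: "section_zero A W s"
  shows "section_norm2 A \<rho> W H s p = 0"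
proof -
  define a where "a = (SOME a. p \<in> W a)"
  have "\<exists>a. p \<in> W a" using W by blast
  then have a: "p \<in> W a" unfolding a_def by (rule someI_ex)
  have "s a (chart_at A p) p = 0"
    using s a chart_at_works[OF A] unfolding section_zero_def by blast
  \<comment> \<open>The metric gives the zero vector norm 0 by homogeneity with scalar 0, for which
    some \<open>v\<close> in the fibre must be at hand.\<close>
  moreover have "H a p (0 *\<^sub>C v) = (cmod 0)\<^sup>2 * H a p v"
    using H a unfolding hermitian_metric_def by blast
  ultimately show ?thesis by (simp add: section_norm2_def Let_def a_def[symmetric])
qed

text \<open>\<kappa> is quantified before \<open>w\<close>, since it depends on the roots and
  \<open>J\<close> only. If a single vertex is omitted, the constraint forces \<open>b = 0\<close>;
  otherwise the \<open>b l\<close> are additive constants bound by one equation. The relations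
  between the degrees are a necessary condition for solvability.\<close>

theorem proposition4p8:
  fixes \<nu> :: "'g::complex_lie_algebra \<Rightarrow> 'g" and n r g :: nat and t :: "'g set"
    and \<alpha> :: "nat \<Rightarrow> 'g \<Rightarrow> complex" and m :: "nat \<Rightarrow> nat" and lab :: "nat \<Rightarrow> int"
    and A :: "'s::t2_space chart set" and \<rho> :: "'s chart \<Rightarrow> 's \<Rightarrow> real"
    and W :: "'i \<Rightarrow> 's set" and \<tau> :: "'i \<Rightarrow> 'i \<Rightarrow> 's \<Rightarrow> 'g \<Rightarrow> 'g"
    and \<phi> :: "nat \<Rightarrow> 'i \<Rightarrow> 's chart \<Rightarrow> 's \<Rightarrow> 'g"
    and d :: "nat \<Rightarrow> int" and H :: "nat \<Rightarrow> 'i \<Rightarrow> 's \<Rightarrow> 'g \<Rightarrow> real"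
    and C :: "nat \<Rightarrow> nat \<Rightarrow> real" and q :: "nat \<Rightarrow> 's \<Rightarrow> real" and J :: "nat set"
  assumes simple: "simple_lie_algebra TYPE('g)"
    and nu: "diagram_automorphism \<nu> n"
    and cartan: "cartan_subalgebra (eigenspace \<nu> n 0) t"
    and alpha: "affine_simple_roots \<nu> n t r \<alpha>"
    and marks: "affine_marks t r \<alpha> m"
    and label: "toda_labelling n r m lab"
    and surface: "compact_riemann_surface A" and genus: "has_genus A g"
    and metric: "normalised_metric A g \<rho>"
    and pair: "toda_pair A \<nu> n t r \<alpha> W \<tau> \<phi>"
    and degree: "\<And>k. k \<in> {0..r} \<Longrightarrow>
      d k = bundle_degree A \<rho> W \<tau> (gspace \<nu> n t (abar n \<alpha> k))"
    and hermitian: "\<And>k. k \<in> {0..r} \<Longrightarrow>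
      constant_curvature_metric A \<rho> W \<tau> (gspace \<nu> n t (abar n \<alpha> k)) (d k) (H k)"
    and C: "C = affine_cartan t \<alpha>" and q: "q = toda_coefficient A \<rho> t \<alpha> W H \<phi>"
    and noncyclic: "noncyclic A r W \<phi>"
    and J: "J \<subset> {0..r}" "J \<noteq> {}"
    and vanish: "\<And>k. k \<in> {0..r} - J \<Longrightarrow> section_zero A W (\<phi> k)"
  shows "(\<forall>S\<in>diagram_components C J. simple_cartan_matrix C S) \<and>
    (\<exists>\<kappa> :: nat \<Rightarrow> nat \<Rightarrow> real.
      (\<forall>l\<in>{0..r} - J. \<forall>k\<in>J. C l k = (\<Sum>j\<in>J. \<kappa> l j * C j k)) \<and>
      (\<forall>w :: nat \<Rightarrow> 's \<Rightarrow> real. (\<forall>j\<in>{0..r}. surface_ck A 2 UNIV (w j)) \<longrightarrow>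
        ((\<forall>p. (\<Sum>j\<in>{0..r}. real (m j) * w j p) = 0) \<and> toda_equations A \<rho> lab C q d {0..r} w
          \<longleftrightarrow>
         (\<forall>S\<in>diagram_components C J. toda_equations A \<rho> lab C q d S w) \<and>
         (\<forall>l\<in>{0..r} - J. of_int (d l) = (\<Sum>j\<in>J. \<kappa> l j * of_int (d j))) \<and>
         (\<exists>b. (\<Sum>l\<in>{0..r} - J. real (m l) * b l) = 0 \<and>
              (\<forall>l\<in>{0..r} - J. \<forall>p. w l p = (\<Sum>j\<in>J. \<kappa> l j * w j p) + b l)))))"
proof -
  interpret twisted_cartan \<nu> n t
    by unfold_locales (fact simple nu cartan)+
  have r: "r > 0"
  proof (rule ccontr)
    assume "\<not> r > 0"
    with J show False by auto
  qed
  have fin: "finite J" using J finite_subset by blast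
  define G where "G i j = root_inner t (\<alpha> i) (\<alpha> j)" for i j
  have CG: "C i j = 2 * G i j / G j j" for i j by (simp add: C affine_cartan_def G_def)
  have sym: "G i j = G j i" for i j unfolding G_def by (rule root_inner_sym)
  have pos: "G i i > 0" if "i \<in> {0..r}" for i
    unfolding G_def by (rule affine_gram_pos[OF alpha marks r that])
  have definite: "(\<Sum>i\<in>S. \<Sum>j\<in>S. c i * c j * G i j) > 0" if "S \<subset> {0..r}" "\<exists>i\<in>S. c i \<noteq> 0" for S c
    unfolding G_def by (rule affine_gram_definite[OF alpha marks r that])
  have components: "simple_cartan_matrix C S" if S: "S \<in> diagram_components C J" for S
  proof -
    have SJ: "S \<subseteq> J" by (rule diagram_components_subset[OF S])
    then have Sr: "S \<subset> {0..r}" using J by blast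
    have "finite_cartan_matrix C S"
    proof (rule finite_cartan_matrix_gram[where G = G])
      show "finite S" using SJ fin finite_subset by blast
      show "C i j \<in> \<int>" if "i \<in> S" "j \<in> S" for i j
        unfolding C using affine_cartan_integral[OF alpha marks r] Sr that by blast
      show "G i j \<le> 0" if "i \<in> S" "j \<in> S" "i \<noteq> j" for i j
        unfolding G_def using affine_gram_nonpos[OF alpha marks r] Sr that by blast
      show "G i i > 0" if "i \<in> S" for i using pos Sr that by blast
    qed (rule CG sym definite[OF Sr]; assumption?)+
    moreover have sym0: "C i j = 0 \<longleftrightarrow> C j i = 0" if "i \<in> J" "j \<in> J" for i j
    proof -
      have "G i i > 0" "G j j > 0" using pos J that by blast+
      then show ?thesis using sym[of i j] by (simp add: CG)
    qed
    ultimately show ?thesis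
      using diagram_component_connected[OF sym0 S] by (simp add: simple_cartan_matrix_def)
  qed
  \<comment> \<open>The equations are solved for the symmetric Gram matrix; passing to
    \<open>C\<close> only multiplies column \<open>k\<close> by \<open>2 / G k k\<close>.\<close>
  have "\<exists>x. \<forall>k\<in>J. (\<Sum>j\<in>J. x j * G j k) = G l k" for l
    by (rule positive_definite_solve[OF fin sym definite[OF J(1)]])
  then obtain \<kappa> where \<kappa>: "\<And>l k. k \<in> J \<Longrightarrow> (\<Sum>j\<in>J. \<kappa> l j * G j k) = G l k" by metis
  have \<kappa>C: "C l k = (\<Sum>j\<in>J. \<kappa> l j * C j k)" if "k \<in> J" for l k
  proof -
    have "(\<Sum>j\<in>J. \<kappa> l j * C j k) = 2 * (\<Sum>j\<in>J. \<kappa> l j * G j k) / G k k"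
      by (simp add: CG sum_distrib_left sum_divide_distrib mult_ac)
    then show ?thesis by (simp add: \<kappa>[OF that] CG)
  qed
  have m\<kappa>: "(\<Sum>l\<in>{0..r} - J. real (m l) * \<kappa> l j) = - real (m j)" if j: "j \<in> J" for j
  proof -
    \<comment> \<open>These are the coefficients on \<open>J\<close> left when each row
      \<open>l \<notin> J\<close> of the mark relation is replaced by its combination of rows in
      \<open>J\<close>. They annihilate the definite Gram matrix on \<open>J\<close>, so they
      vanish.\<close>
    define c where "c j = real (m j) + (\<Sum>l\<in>{0..r} - J. real (m l) * \<kappa> l j)" for j
    have 0: "(\<Sum>j\<in>J. c j * G j k) = 0" if k: "k \<in> J" for k
    proof -
      have "(\<Sum>j\<in>J. (\<Sum>l\<in>{0..r} - J. real (m l) * \<kappa> l j) * G j k) =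
          (\<Sum>l\<in>{0..r} - J. real (m l) * (\<Sum>j\<in>J. \<kappa> l j * G j k))"
        unfolding sum_distrib_left sum_distrib_right by (subst sum.swap) (simp add: mult.assoc)
      also have "\<dots> = (\<Sum>l\<in>{0..r} - J. real (m l) * G l k)" by (simp add: \<kappa>[OF k])
      finally have "(\<Sum>j\<in>J. c j * G j k) = (\<Sum>l\<in>{0..r} - J. real (m l) * G l k) + (\<Sum>j\<in>J. real (m j) * G j k)"
        by (simp add: c_def distrib_right sum.distrib)
      also have "\<dots> = (\<Sum>j\<in>{0..r}. real (m j) * G j k)"
        by (rule sum.subset_diff[symmetric]) (use J in auto)
      also have "\<dots> = 0" unfolding G_def by (rule affine_gram_marks[OF alpha marks r]) (use J k in auto)
      finally show ?thesis .
    qed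
    have "(\<Sum>i\<in>J. \<Sum>j\<in>J. c i * c j * G i j) = (\<Sum>j\<in>J. c j * (\<Sum>i\<in>J. c i * G i j))"
      by (subst sum.swap) (simp add: sum_distrib_left mult_ac)
    also have "\<dots> = 0" by (simp add: 0)
    finally have "c j = 0" using definite[OF J(1), of c] j by fastforce
    then show ?thesis by (simp add: c_def)
  qed
  have q0: "q k p = 0" if k: "k \<in> {0..r} - J" for k p
  proof -
    \<comment> \<open>The zero vector is enough as the fibre element asked for by
      \<open>section_norm2_zero\<close>.\<close>
    have "0 \<in> gspace \<nu> n t (abar n \<alpha> k)"
      using subspace_eigenspace by (simp add: gspace_def weight_space_def cvec.subspace_0)
    moreover have "hermitian_metric A W \<tau> (gspace \<nu> n t (abar n \<alpha> k)) (H k)"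
      using hermitian[of k] k unfolding constant_curvature_metric_def by blast
    moreover have "(\<Union>a. W a) = UNIV"
      using pair unfolding toda_pair_def principal_bundle_def by blast
    ultimately have "section_norm2 A \<rho> W (H k) (\<phi> k) p = 0"
      using section_norm2_zero[OF surface _ _ _ vanish[OF k]] by blast
    then show ?thesis by (simp add: q toda_coefficient_def)
  qed
  have kaehler: "kaehler_metric A \<rho>" using metric by (simp add: normalised_metric_def)
  have Jr: "J \<subseteq> {0..r}" using J by blast
  show ?thesis
  proof (intro conjI exI[of _ \<kappa>] ballI allI impI)
    fix w :: "nat \<Rightarrow> 's \<Rightarrow> real"
    assume w: "\<forall>j\<in>{0..r}. surface_ck A 2 UNIV (w j)"
    show "(\<forall>p. (\<Sum>j\<in>{0..r}. real (m j) * w j p) = 0) \<and> toda_equations A \<rho> lab C q d {0..r} w \<longleftrightarrow>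
         (\<forall>S\<in>diagram_components C J. toda_equations A \<rho> lab C q d S w) \<and>
         (\<forall>l\<in>{0..r} - J. of_int (d l) = (\<Sum>j\<in>J. \<kappa> l j * of_int (d j))) \<and>
         (\<exists>b. (\<Sum>l\<in>{0..r} - J. real (m l) * b l) = 0 \<and>
              (\<forall>l\<in>{0..r} - J. \<forall>p. w l p = (\<Sum>j\<in>J. \<kappa> l j * w j p) + b l))"
      by (rule toda_reduction[OF surface kaehler Jr q0 \<kappa>C m\<kappa> bspec[OF w]])
  qed (rule components \<kappa>C; assumption)+
qed

end
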